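(* Let $0<m<1$, let $\nu>0$, and let $h$ be a probability density on $\mathbb{R}$. Consider the stationary Poisson branching-cluster process on $\mathbb{R}$ with immigrant rate $\nu$ and offspring displacement intensity measure $m h(x)\,dx$. Put $$\Phi(\omega):=m\widehat h(\omega),\qquad R(\omega):=\frac{1}{1-\Phi(\omega)},\qquad \lambda:=\frac{\nu}{1-m}.$$ Then the Fourier--Stieltjes transform $B_{\mathrm{comp}}$ of the reduced complete third cumulant measure $\gamma_3^{\mathrm{red}}$ is $$B_{\mathrm{comp}}(\omega_1,\omega_2)=\lambda R(\omega_1)R(\omega_2)R(\omega_3)\{R(-\omega_1)+R(-\omega_2)+R(-\omega_3)-2\},\qquad \omega_3:=-\omega_1-\omega_2 .$$ Equivalently, $$B_{\mathrm{comp}}(\omega_1,\omega_2)=\lambda\,\frac{1-m^2Q(\omega_1,\omega_2)}{|1-m\widehat h(\omega_1)|^2\,|1-m\widehat h(\omega_2)|^2\,|1-m\widehat h(-\omega_1-\omega_2)|^2},$$ where $$Q(\omega_1,\omega_2):=\widehat h(-\omega_1)\widehat h(-\omega_2)+\widehat h(\omega_1+\omega_2)\{\widehat h(-\omega_1)+\widehat h(-\omega_2)-2m\widehat h(-\omega_1)\widehat h(-\omega_2)\}.$$ The denominator in the last formula for $B_{\mathrm{comp}}$ is real and strictly positive. Hence $$\operatorname{Im}B_{\mathrm{comp}}(\omega_1,\omega_2)=-\lambda m^2\,\frac{\operatorname{Im}Q(\omega_1,\omega_2)}{|1-m\widehat h(\omega_1)|^2\,|1-m\widehat h(\omega_2)|^2\,|1-m\widehat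 h(-\omega_1-\omega_2)|^2}.$$
   Context: Fourier convention: $\widehat f(\omega)=\int e^{-\mathrm{i}\omega\cdot t}f(t)\,dt$ for $f\in L^1(\mathbb{R}^q)$, $q\in\{1,2\}$, and likewise for finite signed measures (Fourier--Stieltjes transform). Poisson branching-cluster process: the rooted branching cluster $C$ is the counting measure of all individuals of a branching process started from one individual (the root) at $0$, in which each individual at position $x$ independently produces offspring at the points of a Poisson process on $\mathbb{R}$ with intensity $m h(y-x)\,dy$ (so offspring numbers are Poisson with mean $m$ and displacements are i.i.d. with density $h$). The stationary process is $N=\sum_j\vartheta_{U_j}C_j$, where $\{U_j\}$ is a homogeneous Poisson process of rate $\nu$ on $\mathbb{R}$, independent of the i.i.d. copies $C_j$ of $C$, and $(\vartheta_u\mu)(A)=\mu(A-u)$. Complete (ordinary) cumulant measures: with $N(f)=\int f\,dN$ and $K_{\mathrm{comp}}(f)=\log\mathbb{E}e^{N(f)}$ (when finite), $\gamma_n$ is the measure on $\mathbb{R}^n$ with $$\int\prod_{j=0}^{n-1}f_j(t_j)\,\gamma_n(dt_0,\dots,dt_{n-1})=\partial_{s_0}\cdots\partial_{s_{n-1}}K_{\mathrm{comp}}\Big(\sum_js_jf_j\Big)\Big|_{s=0}$$ for bounded compactly supported $f_j$, interpreted as a finite-order variational derivative at the origin (i.e. the left side is the joint cumulant of $N(f_0),\dots,N(f_{n-1})$). The reduced measure $\gamma_n^{\mathrm{red}}$ on $\mathbb{R}^{n-1}$ is defined by $\int F\,d\gamma_n=\int_{\mathbb{R}}\int_{\mathbb{R}^{n-1}}F(t_0,t_0+\tau_1,\dots,t_0+\tau_{n-1})\,\gamma_n^{\mathrm{red}}(d\tau)\,dt_0$.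 *)

theory Defs
  imports "HOL-Probability.Probability"
begin

definition fourier :: "(real \<Rightarrow> real) \<Rightarrow> real \<Rightarrow> complex" where
  "fourier f \<omega> = (LINT t|lborel. exp (- (\<i> * of_real (\<omega> * t))) * of_real (f t))"

text \<open>Vectors indexed by a finite set \<open>I\<close> are elements of the product space over \<open>I\<close>.\<close>

definition fourier_stieltjes ::
    "nat set \<Rightarrow> (nat \<Rightarrow> real) measure \<Rightarrow> (nat \<Rightarrow> real) \<Rightarrow> complex" where
  "fourier_stieltjes I \<mu> \<omega> = (LINT t|\<mu>. exp (- (\<i> * of_real (\<Sum>j\<in>I. \<omega> j * t j))))"

definition prob_density :: "(real \<Rightarrow> real) \<Rightarrow> bool" where
  "prob_density h \<longleftrightarrow>
     h \<in> borel_measurable borel \<and> (\<forall>x. 0 \<le> h x) \<and> (\<integral>\<^sup>+ x. ennreal (h x) \<partial>lborel) = 1"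

text \<open>The sum of the unit masses at the points \<open>x i\<close>, \<open>i \<in> I\<close>, counted with multiplicity.\<close>

definition points :: "'i set \<Rightarrow> ('i \<Rightarrow> real) \<Rightarrow> real measure" where
  "points I x = distr (count_space I) borel x"

definition shift :: "real \<Rightarrow> real measure \<Rightarrow> real measure" where
  "shift u \<mu> = distr \<mu> borel (\<lambda>x. x + u)"

definition superpose :: "(nat \<Rightarrow> real measure) \<Rightarrow> real measure" where
  "superpose \<mu> = measure_of UNIV (sets borel) (\<lambda>A. \<Sum>j. emeasure (\<mu> j) A)"

lemma emeasure_points:
  "A \<in> sets borel \<Longrightarrow> emeasure (points I x) A = emeasure (count_space I) {i \<in> I. x i \<in> A}"
  unfolding points_def by (subst emeasure_distr) (auto intro!: arg_cong2[where f = emeasure])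

lemma emeasure_shift:
  assumes "sets \<mu> = sets borel" "A \<in> sets borel"
  shows "emeasure (shift u \<mu>) A = emeasure \<mu> {x. x + u \<in> A}"
proof -
  have "(\<lambda>x. x + u) \<in> measurable \<mu> borel"
    by (subst measurable_cong_sets[OF assms(1) refl]) simp
  moreover have "space \<mu> = UNIV"
    using sets_eq_imp_space_eq[OF assms(1)] by simp
  ultimately show ?thesis
    unfolding shift_def using assms(2) by (simp add: emeasure_distr vimage_def)
qed

lemma sets_superpose: "sets (superpose \<mu>) = sets borel"
  unfolding superpose_def using sets.sigma_sets_eq[of "borel :: real measure"]
  by (simp add: sets_measure_of)

lemma emeasure_superpose:
  assumes "\<And>j. sets (\<mu> j) = sets borel" "A \<in> sets borel"
  shows "emeasure (superpose \<mu>) A = (\<Sum>j. emeasure (\<mu> j) A)"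
proof (rule emeasure_measure_of[OF superpose_def])
  show "A \<in> sets (superpose \<mu>)" using assms(2) by (simp add: sets_superpose)
  show "countably_additive (sets (superpose \<mu>)) (\<lambda>A. \<Sum>j. emeasure (\<mu> j) A)"
  proof (rule countably_additiveI)
    fix B :: "nat \<Rightarrow> real set"
    assume B: "range B \<subseteq> sets (superpose \<mu>)" "disjoint_family B"
    have "(\<Sum>i. \<Sum>j. emeasure (\<mu> j) (B i)) = (\<Sum>j. \<Sum>i. emeasure (\<mu> j) (B i))"
      unfolding nn_integral_count_space_nat[symmetric]
      by (rule pair_sigma_finite.Fubini')
        (simp_all add: pair_sigma_finite_def sigma_finite_measure_count_space pair_measure_countable)
    also have "\<dots> = (\<Sum>j. emeasure (\<mu> j) (\<Union>i. B i))"
      using B by (intro suminf_cong suminf_emeasure) (auto simp: assms(1) sets_superpose)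
    finally show "(\<Sum>i. \<Sum>j. emeasure (\<mu> j) (B i)) = (\<Sum>j. emeasure (\<mu> j) (\<Union>i. B i))" .
  qed
qed (auto simp: positive_def)

text \<open>
  The defining formula of the Poisson distribution is written out because the mean
  \<open>\<Lambda> A\<close> may be \<open>0\<close> (then \<open>0 ^ 0 = 1\<close> gives the unit mass at \<open>0\<close>).
\<close>

definition poisson_process ::
    "'w measure \<Rightarrow> ('w \<Rightarrow> real measure) \<Rightarrow> real measure \<Rightarrow> bool" where
  "poisson_process M X \<Lambda> \<longleftrightarrow>
     (\<forall>w\<in>space M. sets (X w) = sets borel) \<and>
     (\<forall>A\<in>sets borel. (\<lambda>w. emeasure (X w) A) \<in> borel_measurable M) \<and>
     (\<forall>A\<in>sets borel. emeasure \<Lambda> A < \<infinity> \<longrightarrow>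
        (\<forall>k. measure M {w \<in> space M. emeasure (X w) A = of_nat k}
              = exp (- measure \<Lambda> A) * measure \<Lambda> A ^ k / fact k)) \<and>
     (\<forall>(I :: nat set) A. finite I \<longrightarrow> disjoint_family_on A I \<longrightarrow>
        (\<forall>i\<in>I. A i \<in> sets borel \<and> emeasure \<Lambda> (A i) < \<infinity>) \<longrightarrow>
        prob_space.indep_vars M (\<lambda>_. borel) (\<lambda>i w. emeasure (X w) (A i)) I)"

text \<open>
  Individuals carry Ulam-Harris labels: the root is \<open>[]\<close> and the \<open>i\<close>-th child of \<open>u\<close> is
  \<open>i # u\<close>. A genealogy assigns to each potential individual \<open>u\<close> the number \<open>k\<close> of its
  children and a sequence \<open>d\<close>, of which \<open>d 0, \<dots>, d (k - 1)\<close> are the displacements of the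
  children relative to \<open>u\<close>; the other entries of \<open>d\<close> are irrelevant.
\<close>

type_synonym brood = "nat \<times> (nat \<Rightarrow> real)"
type_synonym genealogy = "nat list \<Rightarrow> brood"

primrec alive :: "genealogy \<Rightarrow> nat list \<Rightarrow> bool" where
  "alive g [] \<longleftrightarrow> True"
| "alive g (i # u) \<longleftrightarrow> alive g u \<and> i < fst (g u)"

primrec pos :: "genealogy \<Rightarrow> nat list \<Rightarrow> real" where
  "pos g [] = 0"
| "pos g (i # u) = pos g u + snd (g u) i"

definition cluster :: "genealogy \<Rightarrow> real measure" where
  "cluster g = points {u. alive g u} (pos g)"

definition brood_space :: "brood measure" where
  "brood_space = count_space UNIV \<Otimes>\<^sub>M Pi\<^sub>M UNIV (\<lambda>_. borel)"

definition genealogy_space :: "genealogy measure" where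
  "genealogy_space = Pi\<^sub>M UNIV (\<lambda>_. brood_space)"

text \<open>
  The offspring of an individual at \<open>x\<close> form a Poisson process of intensity
  \<open>m * h (y - x) dy\<close>; equivalently their displacements form one of intensity
  \<open>m * h y dy\<close>. Independence is required of the enumerated broods, so that the order in
  which siblings are listed carries no information about other individuals.
\<close>

definition branching_genealogy ::
    "'w measure \<Rightarrow> real \<Rightarrow> (real \<Rightarrow> real) \<Rightarrow> ('w \<Rightarrow> genealogy) \<Rightarrow> bool" where
  "branching_genealogy M m h g \<longleftrightarrow>
     prob_space.indep_vars M (\<lambda>_. brood_space) (\<lambda>u w. g w u) UNIV \<and>
     (\<forall>u. poisson_process M (\<lambda>w. points {..<fst (g w u)} (snd (g w u)))
            (density lborel (\<lambda>y. ennreal (m * h y))))"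

text \<open>
  The sigma-algebras generated by the sequences \<open>U\<close> and \<open>g\<close> are required to be independent;
  \<open>indep_var\<close> only relates random variables of the same type.
\<close>

definition poisson_branching_cluster_process ::
    "'w measure \<Rightarrow> real \<Rightarrow> real \<Rightarrow> (real \<Rightarrow> real) \<Rightarrow> ('w \<Rightarrow> real measure) \<Rightarrow> bool" where
  "poisson_branching_cluster_process M \<nu> m h N \<longleftrightarrow>
     prob_space M \<and>
     (\<exists>(U :: nat \<Rightarrow> 'w \<Rightarrow> real) (g :: nat \<Rightarrow> 'w \<Rightarrow> genealogy).
        poisson_process M (\<lambda>w. points UNIV (\<lambda>j. U j w)) (density lborel (\<lambda>_. ennreal \<nu>)) \<and>
        (\<forall>j. branching_genealogy M m h (g j)) \<and>
        prob_space.indep_vars M (\<lambda>_. genealogy_space) g UNIV \<and>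
        prob_space.indep_set M
          (sets (vimage_algebra (space M) (\<lambda>w j. U j w) (Pi\<^sub>M UNIV (\<lambda>_. borel))))
          (sets (vimage_algebra (space M) (\<lambda>w j. g j w) (Pi\<^sub>M UNIV (\<lambda>_. genealogy_space)))) \<and>
        (\<forall>w\<in>space M. N w = superpose (\<lambda>j. shift (U j w) (cluster (g j w)))))"

definition K_comp :: "'w measure \<Rightarrow> ('w \<Rightarrow> real measure) \<Rightarrow> (real \<Rightarrow> real) \<Rightarrow> real" where
  "K_comp M N f = ln (LINT w|M. exp (LINT x|N w. f x))"

definition partial_deriv ::
    "nat \<Rightarrow> ((nat \<Rightarrow> real) \<Rightarrow> real) \<Rightarrow> (nat \<Rightarrow> real) \<Rightarrow> real" where
  "partial_deriv j H s = deriv (\<lambda>x. H (s(j := x))) (s j)"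

text \<open>\<open>mixed_partial n H\<close> is the derivative of \<open>H\<close> by \<open>s 0, \<dots>, s (n - 1)\<close>, once each.\<close>

primrec mixed_partial ::
    "nat \<Rightarrow> ((nat \<Rightarrow> real) \<Rightarrow> real) \<Rightarrow> (nat \<Rightarrow> real) \<Rightarrow> real" where
  "mixed_partial 0 H = H"
| "mixed_partial (Suc n) H = mixed_partial n (partial_deriv n H)"

definition joint_cumulant ::
    "'w measure \<Rightarrow> ('w \<Rightarrow> real measure) \<Rightarrow> nat \<Rightarrow> (nat \<Rightarrow> real \<Rightarrow> real) \<Rightarrow> real" where
  "joint_cumulant M N n f =
     mixed_partial n (\<lambda>s. K_comp M N (\<lambda>x. \<Sum>j<n. s j * f j x)) (\<lambda>_. 0)"

definition test_function :: "(real \<Rightarrow> real) \<Rightarrow> bool" where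
  "test_function f \<longleftrightarrow>
     f \<in> borel_measurable borel \<and> bounded (range f) \<and> compact (closure {x. f x \<noteq> 0})"

text \<open>
  The cumulant measures of a Poisson cluster process are nonnegative, so the library's
  (nonnegative) measures suffice. The test functions determine \<open>\<gamma>\<close> uniquely, thanks to
  the integrability clause. The coordinates of \<open>\<gamma>\<close> are indexed by \<open>0, \<dots>, n - 1\<close>,
  those of the reduced measure by \<open>1, \<dots>, n - 1\<close>.
\<close>

definition complete_cumulant_measure ::
    "'w measure \<Rightarrow> ('w \<Rightarrow> real measure) \<Rightarrow> nat \<Rightarrow> (nat \<Rightarrow> real) measure \<Rightarrow> bool" where
  "complete_cumulant_measure M N n \<gamma> \<longleftrightarrow>
     sets \<gamma> = sets (Pi\<^sub>M {..<n} (\<lambda>_. borel)) \<and>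
     (\<forall>f. (\<forall>j<n. test_function (f j)) \<longrightarrow>
        integrable \<gamma> (\<lambda>t. \<Prod>j<n. f j (t j)) \<and>
        (LINT t|\<gamma>. (\<Prod>j<n. f j (t j))) = joint_cumulant M N n f)"

definition reduced_measure ::
    "nat \<Rightarrow> (nat \<Rightarrow> real) measure \<Rightarrow> (nat \<Rightarrow> real) measure \<Rightarrow> bool" where
  "reduced_measure n \<gamma> \<gamma>red \<longleftrightarrow>
     sets \<gamma>red = sets (Pi\<^sub>M {1..<n} (\<lambda>_. borel)) \<and>
     (\<forall>F :: (nat \<Rightarrow> real) \<Rightarrow> ennreal. F \<in> borel_measurable (Pi\<^sub>M {..<n} (\<lambda>_. borel)) \<longrightarrow>
        (\<integral>\<^sup>+ t. F t \<partial>\<gamma>) =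
        (\<integral>\<^sup>+ t0. (\<integral>\<^sup>+ \<tau>. F (\<lambda>j\<in>{..<n}. if j = 0 then t0 else t0 + \<tau> j) \<partial>\<gamma>red) \<partial>lborel))"

definition Phi :: "real \<Rightarrow> (real \<Rightarrow> real) \<Rightarrow> real \<Rightarrow> complex" where
  "Phi m h \<omega> = of_real m * fourier h \<omega>"

definition Rfun :: "real \<Rightarrow> (real \<Rightarrow> real) \<Rightarrow> real \<Rightarrow> complex" where
  "Rfun m h \<omega> = 1 / (1 - Phi m h \<omega>)"

definition Qfun :: "real \<Rightarrow> (real \<Rightarrow> real) \<Rightarrow> real \<Rightarrow> real \<Rightarrow> complex" where
  "Qfun m h \<omega>1 \<omega>2 =
     fourier h (- \<omega>1) * fourier h (- \<omega>2) +
     fourier h (\<omega>1 + \<omega>2) *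
       (fourier h (- \<omega>1) + fourier h (- \<omega>2)
        - 2 * of_real m * fourier h (- \<omega>1) * fourier h (- \<omega>2))"

definition denom :: "real \<Rightarrow> (real \<Rightarrow> real) \<Rightarrow> real \<Rightarrow> real \<Rightarrow> real" where
  "denom m h \<omega>1 \<omega>2 =
     (cmod (1 - of_real m * fourier h \<omega>1))\<^sup>2 *
     (cmod (1 - of_real m * fourier h \<omega>2))\<^sup>2 *
     (cmod (1 - of_real m * fourier h (- \<omega>1 - \<omega>2)))\<^sup>2"

definition B_comp :: "(nat \<Rightarrow> real) measure \<Rightarrow> real \<Rightarrow> real \<Rightarrow> complex" where
  "B_comp \<gamma>red \<omega>1 \<omega>2 =
     fourier_stieltjes {1..<3} \<gamma>red (\<lambda>j. if j = 1 then \<omega>1 else \<omega>2)"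

end

theory Submission
  imports Defs
begin

text \<open>
  The joint cumulant of \<open>N f0\<close>, \<open>N f1\<close>, \<open>N f2\<close> is \<open>\<nu> * \<integral> E (C_u f0 * C_u f1 * C_u f2) du\<close>, where \<open>C_u f\<close>
  is the sum of \<open>f\<close> over one cluster rooted at \<open>u\<close>: differentiate
  \<open>log E exp (N f) = \<nu> * \<integral> (E exp (C_u f) - 1) du\<close>. The moments of a cluster come from the same
  computation one level down: the offspring of the root form a Poisson process, so
  \<open>log E exp (C_x f) = f x + \<integral> (E exp (C_(x + y) f) - 1) m h y dy\<close>. On exponentials
  \<open>f t = exp (- \<i> \<omega> t)\<close> the integral operator on the right multiplies by \<open>\<Phi>\<close>, and the identities for
  the first three cumulants can be solved for the moments. Since \<open>E exp (\<epsilon> |C|)\<close> is finite for some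
  \<open>\<epsilon> > 0\<close>, all derivatives at the origin exist.
\<close>

section \<open>Measurability and integration\<close>

text \<open>Integration over the root position is translation invariant, so the reduced measure can
  be written down: it is \<open>\<nu>\<close> times the expected sum, over ordered triples of
  individuals of one cluster, of the unit mass at the two displacements relative to the first
  individual. Its transform is \<open>\<nu> * E3\<close> at waves whose frequencies
  \<open>\<omega>3\<close>, \<open>\<omega>1\<close>, \<open>\<omega>2\<close> add up to zero. Hence
  \<open>E3\<close> has the coefficient \<open>1 - \<Phi> 0 = 1 - m\<close> in its own equation,
  which turns \<open>\<nu>\<close> into \<open>\<lambda>\<close>. The product of the three means
  contributes \<open>1\<close> to the bracket and each pair contributes \<open>R - 1\<close>; this
  is the origin of the \<open>- 2\<close>. Three obstacles shape the rest. Lebesgue measure is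
  infinite, so constants are not integrable over immigrant positions: \<open>exp - 1\<close>
  replaces \<open>exp\<close>, and bounds carry a sum over a bounded window. The generating
  functionals are real, so waves are reached through multilinearity. The theorem speaks of every
  measure with the defining property, so existence and uniqueness both have to be shown.\<close>

lemma borel_measurable_sum_random_set:
  fixes F :: "'i::countable \<Rightarrow> 'a \<Rightarrow> 'b::{real_normed_vector, second_countable_topology}"
  assumes P [measurable]: "\<And>i. Measurable.pred M (P i)"
    and F [measurable]: "\<And>i. F i \<in> borel_measurable M"
  shows "(\<lambda>w. \<Sum>i | P i w. F i w) \<in> borel_measurable M"
proof -
  define D where "D n = {i :: 'i. to_nat i < n}" for n
  have fin_D: "finite (D n)" for n
    unfolding D_def by (rule finite_imageD[of to_nat]) (auto intro: finite_subset[of _ "{..<n}"])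
  \<comment> \<open>Finiteness is boundedness of the codes, a condition with countable quantifiers
    only, hence a measurable event.\<close>
  have fin_iff: "finite {i. P i w} \<longleftrightarrow> (\<exists>n. \<forall>i. P i w \<longrightarrow> to_nat i < n)" for w
  proof
    assume "finite {i. P i w}"
    then have "finite (to_nat ` {i. P i w})" by simp
    then show "\<exists>n. \<forall>i. P i w \<longrightarrow> to_nat i < n"
      unfolding finite_nat_set_iff_bounded by auto
  next
    assume "\<exists>n. \<forall>i. P i w \<longrightarrow> to_nat i < n"
    then obtain n where "{i. P i w} \<subseteq> D n" by (auto simp: D_def)
    then show "finite {i. P i w}" using fin_D finite_subset by blast
  qed
  have [measurable]: "Measurable.pred M (\<lambda>w. finite {i. P i w})"
    unfolding fin_iff by measurable
  \<comment> \<open>A sum over an infinite set is \<open>0\<close>; the cut-off makes the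
    approximations agree with that default.\<close>
  define S where "S n w = (if finite {i. P i w} then \<Sum>i\<in>D n. if P i w then F i w else 0 else 0)" for n w
  show ?thesis
  proof (rule borel_measurable_LIMSEQ_metric)
    show "S n \<in> borel_measurable M" for n
      unfolding S_def by measurable
    fix w assume "w \<in> space M"
    show "(\<lambda>n. S n w) \<longlonglongrightarrow> (\<Sum>i | P i w. F i w)"
    proof (cases "finite {i. P i w}")
      case True
      then obtain n where n: "\<forall>i. P i w \<longrightarrow> to_nat i < n" using fin_iff by blast
      have "S k w = (\<Sum>i | P i w. F i w)" if "k \<ge> n" for k
      proof -
        have "S k w = (\<Sum>i\<in>{i\<in>D k. P i w}. F i w)"
          unfolding S_def using True fin_D by (simp add: sum.inter_filter)
        also have "{i\<in>D k. P i w} = {i. P i w}"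
          using n that by (fastforce simp: D_def)
        finally show ?thesis .
      qed
      then show ?thesis
        by (intro tendsto_eventually) (auto simp: eventually_sequentially)
    qed (simp add: S_def)
  qed
qed

text \<open>Independence is spelled out on events because \<open>X\<close> and \<open>Y\<close> may
  have different types. It makes the joint law a product measure, and Tonelli's theorem applies.
  This is how the root is separated from its descendants, and the immigrant positions from their
  genealogies.\<close>

lemma (in prob_space) nn_integral_independent_pair:
  assumes X [measurable]: "X \<in> measurable M S" and Y [measurable]: "Y \<in> measurable M T"
    and indep: "\<And>A B. A \<in> sets S \<Longrightarrow> B \<in> sets T \<Longrightarrow>
      prob ((X -` A \<inter> space M) \<inter> (Y -` B \<inter> space M)) = prob (X -` A \<inter> space M) * prob (Y -` B \<inter> space M)"
    and F [measurable]: "F \<in> borel_measurable (S \<Otimes>\<^sub>M T)"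
  shows "(\<integral>\<^sup>+ w. F (X w, Y w) \<partial>M) = (\<integral>\<^sup>+ w. (\<integral>\<^sup>+ w'. F (X w, Y w') \<partial>M) \<partial>M)"
proof -
  interpret X: prob_space "distr M S X" by (rule prob_space_distr) fact
  interpret Y: prob_space "distr M T Y" by (rule prob_space_distr) fact
  have eq: "distr M S X \<Otimes>\<^sub>M distr M T Y = distr M (S \<Otimes>\<^sub>M T) (\<lambda>w. (X w, Y w))"
  proof (rule pair_measure_eqI)
    show "sigma_finite_measure (distr M S X)" "sigma_finite_measure (distr M T Y)"
      by unfold_locales
    show "sets (distr M S X \<Otimes>\<^sub>M distr M T Y) = sets (distr M (S \<Otimes>\<^sub>M T) (\<lambda>w. (X w, Y w)))"
      by (simp cong: sets_pair_measure_cong)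
    fix A B assume "A \<in> sets (distr M S X)" "B \<in> sets (distr M T Y)"
    then have AB [measurable]: "A \<in> sets S" "B \<in> sets T" by auto
    have "(\<lambda>w. (X w, Y w)) -` (A \<times> B) \<inter> space M = (X -` A \<inter> space M) \<inter> (Y -` B \<inter> space M)"
      by auto
    then show "emeasure (distr M S X) A * emeasure (distr M T Y) B
        = emeasure (distr M (S \<Otimes>\<^sub>M T) (\<lambda>w. (X w, Y w))) (A \<times> B)"
      using indep[OF AB] by (simp add: emeasure_distr emeasure_eq_measure ennreal_mult)
  qed
  have "(\<integral>\<^sup>+ w. F (X w, Y w) \<partial>M) = (\<integral>\<^sup>+ z. F z \<partial>(distr M S X \<Otimes>\<^sub>M distr M T Y))"
    unfolding eq by (subst nn_integral_distr) auto
  also have "\<dots> = (\<integral>\<^sup>+ x. (\<integral>\<^sup>+ y. F (x, y) \<partial>distr M T Y) \<partial>distr M S X)"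
    by (rule Y.nn_integral_fst[symmetric]) measurable
  also have "\<dots> = (\<integral>\<^sup>+ w. (\<integral>\<^sup>+ y. F (X w, y) \<partial>distr M T Y) \<partial>M)"
  proof -
    have "(\<lambda>x. \<integral>\<^sup>+ y. F (x, y) \<partial>distr M T Y) \<in> borel_measurable S"
      by (rule Y.borel_measurable_nn_integral) measurable
    then show ?thesis by (simp add: nn_integral_distr)
  qed
  also have "\<dots> = (\<integral>\<^sup>+ w. (\<integral>\<^sup>+ w'. F (X w, Y w') \<partial>M) \<partial>M)"
    using measurable_space[OF X]
    by (intro nn_integral_cong) (simp add: nn_integral_distr)
  finally show ?thesis .
qed

text \<open>By the mean value theorem a bound on the derivative also bounds the difference
  quotients, so dominated convergence applies along every sequence tending to
  \<open>t\<close>.\<close>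

lemma has_real_derivative_integral:
  fixes F F' :: "real \<Rightarrow> 'a \<Rightarrow> real"
  assumes t: "t \<in> {a<..<b}"
    and F: "\<And>s. s \<in> {a<..<b} \<Longrightarrow> integrable \<mu> (F s)"
    and deriv: "\<And>s w. s \<in> {a<..<b} \<Longrightarrow> w \<in> space \<mu> \<Longrightarrow> ((\<lambda>s. F s w) has_real_derivative F' s w) (at s)"
    and bound: "\<And>s w. s \<in> {a<..<b} \<Longrightarrow> w \<in> space \<mu> \<Longrightarrow> \<bar>F' s w\<bar> \<le> D w"
    and D: "integrable \<mu> D"
    and F' [measurable]: "F' t \<in> borel_measurable \<mu>"
  shows "((\<lambda>s. LINT w|\<mu>. F s w) has_real_derivative (LINT w|\<mu>. F' t w)) (at t)"
  unfolding has_field_derivative_iff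
proof (subst tendsto_at_iff_sequentially, intro allI impI)
  fix X :: "nat \<Rightarrow> real"
  assume X: "\<forall>i. X i \<in> UNIV - {t}" "X \<longlonglongrightarrow> t"
  have "\<forall>\<^sub>F n in sequentially. X n \<in> {a<..<b}"
    using X(2) t by (intro topological_tendstoD) auto
  then obtain N where N: "\<And>n. n \<ge> N \<Longrightarrow> X n \<in> {a<..<b}"
    by (auto simp: eventually_sequentially)
  define Y where "Y n = X (n + N)" for n
  have Y: "Y n \<in> {a<..<b}" "Y n \<noteq> t" for n
    using N X(1) by (auto simp: Y_def)
  have Y_lim: "Y \<longlonglongrightarrow> t" unfolding Y_def using X(2) by (rule LIMSEQ_ignore_initial_segment)
  have "(\<lambda>n. LINT w|\<mu>. (F (Y n) w - F t w) / (Y n - t)) \<longlonglongrightarrow> (LINT w|\<mu>. F' t w)"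
  proof (rule integral_dominated_convergence[where w = D])
    show "(\<lambda>w. (F (Y n) w - F t w) / (Y n - t)) \<in> borel_measurable \<mu>" for n
      using F[OF Y(1)[of n]] F[OF t] by (auto dest: borel_measurable_integrable)
    show "AE w in \<mu>. (\<lambda>n. (F (Y n) w - F t w) / (Y n - t)) \<longlonglongrightarrow> F' t w"
    proof (rule AE_I2)
      fix w assume w: "w \<in> space \<mu>"
      have "((\<lambda>s. (F s w - F t w) / (s - t)) \<longlongrightarrow> F' t w) (at t)"
        using deriv[OF t w] by (simp add: has_field_derivative_iff)
      then show "(\<lambda>n. (F (Y n) w - F t w) / (Y n - t)) \<longlonglongrightarrow> F' t w"
        by (rule filterlim_compose) (use Y Y_lim in \<open>auto simp: filterlim_at\<close>)
    qed
    show "AE w in \<mu>. norm ((F (Y n) w - F t w) / (Y n - t)) \<le> D w" for n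
    proof (rule AE_I2)
      fix w assume w: "w \<in> space \<mu>"
      have "norm (F (Y n) w - F t w) \<le> D w * norm (Y n - t)"
      proof (rule field_differentiable_bound[where S = "{a<..<b}"])
        show "((\<lambda>s. F s w) has_field_derivative F' s w) (at s within {a<..<b})" if "s \<in> {a<..<b}" for s
          using deriv[OF that w] by (rule has_field_derivative_at_within)
        show "norm (F' s w) \<le> D w" if "s \<in> {a<..<b}" for s
          using bound[OF that w] by simp
      qed (use t Y in auto)
      then show "norm ((F (Y n) w - F t w) / (Y n - t)) \<le> D w"
        using Y(2)[of n] by (simp add: field_simps abs_divide)
    qed
  qed (use D F' in auto)
  moreover have "(LINT w|\<mu>. (F (Y n) w - F t w) / (Y n - t))
      = ((LINT w|\<mu>. F (Y n) w) - (LINT w|\<mu>. F t w)) / (Y n - t)" for n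
    using F[OF Y(1)[of n]] F[OF t] by simp
  ultimately have "(\<lambda>n. ((LINT w|\<mu>. F (Y n) w) - (LINT w|\<mu>. F t w)) / (Y n - t)) \<longlonglongrightarrow> (LINT w|\<mu>. F' t w)"
    by (simp only:)
  then show "((\<lambda>y. ((LINT w|\<mu>. F y w) - (LINT w|\<mu>. F t w)) / (y - t)) \<circ> X) \<longlonglongrightarrow> (LINT w|\<mu>. F' t w)"
    unfolding Y_def comp_def by (rule LIMSEQ_offset)
qed

section \<open>The generating functional of a Poisson process\<close>

text \<open>The power \<open>v ^ c\<close> for a count \<open>c\<close> that is only known as an
  extended real. The floor merely makes the function total and measurable, and the value at infinity
  is a default: for Poisson counts only the values \<open>of_nat k\<close> have positive
  probability.\<close>

definition count_power :: "real \<Rightarrow> ennreal \<Rightarrow> ennreal" where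
  "count_power v c = (if c = \<infinity> then 0 else ennreal (v ^ nat \<lfloor>enn2real c\<rfloor>))"

lemma count_power_of_nat [simp]: "count_power v (of_nat k) = ennreal (v ^ k)"
  by (simp add: count_power_def)

lemma borel_measurable_count_power [measurable]: "count_power v \<in> borel_measurable borel"
proof -
  have [measurable]: "(\<lambda>k::nat. ennreal (v ^ k)) \<in> measurable (count_space UNIV) borel" by simp
  show ?thesis unfolding count_power_def[abs_def] by measurable
qed

text \<open>The Poisson weights already sum to one, so all other values of \<open>N\<close>,
  infinity included, form a null event. The second claim is then the exponential series.\<close>

lemma (in prob_space)
  fixes N :: "'a \<Rightarrow> ennreal"
  assumes N [measurable]: "N \<in> borel_measurable M" and a: "0 \<le> a"
    and P: "\<And>k. prob {w \<in> space M. N w = of_nat k} = exp (- a) * a ^ k / fact k"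
  shows AE_poisson_count: "AE w in M. \<exists>k. N w = of_nat k"
    and nn_integral_poisson_count_power: "0 \<le> v \<Longrightarrow> (\<integral>\<^sup>+ w. count_power v (N w) \<partial>M) = ennreal (exp (a * (v - 1)))"
proof -
  define A where "A k = {w \<in> space M. N w = of_nat k}" for k :: nat
  have A [measurable]: "A k \<in> sets M" for k unfolding A_def by measurable
  have disj: "disjoint_family A"
    by (auto simp: disjoint_family_on_def A_def)
  have "(\<lambda>k. prob (A k)) sums prob (\<Union>k. A k)"
    by (rule finite_measure_UNION) (auto simp: disj)
  moreover have "(\<lambda>k. prob (A k)) sums (exp (- a) * exp a)"
  proof -
    have "(\<lambda>k. exp (- a) * (a ^ k /\<^sub>R fact k)) sums (exp (- a) * exp a)"
      by (intro sums_mult exp_converges)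
    then show ?thesis by (simp add: A_def P field_simps)
  qed
  ultimately have "prob (\<Union>k. A k) = 1"
    by (metis exp_minus_inverse mult.commute sums_unique2)
  from AE_prob_1[OF this] have AE_A: "AE w in M. w \<in> (\<Union>k. A k)" .
  then show "AE w in M. \<exists>k. N w = of_nat k" by (auto simp: A_def)
  assume v: "0 \<le> v"
  have "AE w in M. count_power v (N w) = (\<Sum>k. ennreal (v ^ k) * indicator (A k) w)"
    using AE_A
  proof eventually_elim
    fix w assume "w \<in> (\<Union>k. A k)"
    then obtain k where k: "w \<in> A k" by auto
    have "(\<Sum>k. ennreal (v ^ k) * indicator (A k) w) = ennreal (v ^ k)"
      using disj k by (rule suminf_cmult_indicator)
    then show "count_power v (N w) = (\<Sum>k. ennreal (v ^ k) * indicator (A k) w)"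
      using k by (simp add: A_def)
  qed
  then have "(\<integral>\<^sup>+ w. count_power v (N w) \<partial>M) = (\<integral>\<^sup>+ w. (\<Sum>k. ennreal (v ^ k) * indicator (A k) w) \<partial>M)"
    by (rule nn_integral_cong_AE)
  also have "\<dots> = (\<Sum>k. ennreal (v ^ k) * emeasure M (A k))"
    by (subst nn_integral_suminf) (auto simp: nn_integral_cmult_indicator)
  also have "\<dots> = (\<Sum>k. ennreal (exp (- a) * ((v * a) ^ k /\<^sub>R fact k)))"
  proof (intro arg_cong[where f = suminf] ext)
    fix k
    have "ennreal (v ^ k) * emeasure M (A k) = ennreal (v ^ k * (exp (- a) * a ^ k / fact k))"
      using v by (simp only: emeasure_eq_measure ennreal_mult' P[folded A_def] zero_le_power)
    then show "ennreal (v ^ k) * emeasure M (A k) = ennreal (exp (- a) * ((v * a) ^ k /\<^sub>R fact k))"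
      by (simp add: power_mult_distrib field_simps)
  qed
  also have "\<dots> = ennreal (exp (- a) * exp (v * a))"
  proof (rule suminf_ennreal_eq)
    show "(\<lambda>k. exp (- a) * ((v * a) ^ k /\<^sub>R fact k)) sums (exp (- a) * exp (v * a))"
      by (intro sums_mult exp_converges)
  qed (use v a in auto)
  also have "exp (- a) * exp (v * a) = exp (a * (v - 1))"
    by (simp add: exp_add[symmetric] algebra_simps)
  finally show "(\<integral>\<^sup>+ w. count_power v (N w) \<partial>M) = ennreal (exp (a * (v - 1)))" .
qed

lemma emeasure_points_eq_card:
  assumes "A \<in> sets borel" "finite {i \<in> I. x i \<in> A}"
  shows "emeasure (points I x) A = of_nat (card {i \<in> I. x i \<in> A})"
  using assms by (simp add: emeasure_points emeasure_count_space_finite)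

lemma emeasure_points_eq_infinity:
  assumes "A \<in> sets borel" "infinite {i \<in> I. x i \<in> A}"
  shows "emeasure (points I x) A = \<infinity>"
  using assms by (simp add: emeasure_points emeasure_count_space_infinite)

lemma AE_poisson_process_finite:
  assumes M: "prob_space M" and X: "poisson_process M (\<lambda>w. points (I w) (x w)) \<Lambda>"
    and A: "A \<in> sets borel" "emeasure \<Lambda> A < \<infinity>"
  shows "AE w in M. finite {i \<in> I w. x w i \<in> A}"
proof -
  interpret prob_space M by fact
  have "AE w in M. \<exists>k. emeasure (points (I w) (x w)) A = of_nat k"
    by (rule AE_poisson_count[where a = "measure \<Lambda> A"])
      (use X A in \<open>auto simp: poisson_process_def\<close>)
  then show ?thesis
  proof eventually_elim
    case (elim w)
    show ?case
    proof (rule ccontr)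
      assume "infinite {i \<in> I w. x w i \<in> A}"
      from emeasure_points_eq_infinity[OF A(1) this] elim show False
        by (auto simp: ennreal_of_nat_neq_top)
    qed
  qed
qed

text \<open>For infinitely many points in \<open>B\<close> the product is \<open>1\<close> by convention; below this is a null event.\<close>
abbreviation point_product :: "'i set \<Rightarrow> ('i \<Rightarrow> real) \<Rightarrow> real set \<Rightarrow> (real \<Rightarrow> real) \<Rightarrow> ennreal" where
  "point_product I x B \<phi> \<equiv> \<Prod>j | j \<in> I \<and> x j \<in> B. ennreal (\<phi> (x j))"

text \<open>Counts on disjoint sets are independent, so the expectation splits into one-set
  generating functions.\<close>

lemma nn_integral_poisson_process_prod_step:
  fixes a :: "nat \<Rightarrow> real set" and v :: "nat \<Rightarrow> real"
  assumes M: "prob_space M" and X: "poisson_process M (\<lambda>w. points (I w) (x w)) \<Lambda>"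
    and a: "\<And>i. i < n \<Longrightarrow> a i \<in> sets borel" "\<And>i. i < n \<Longrightarrow> emeasure \<Lambda> (a i) < \<infinity>"
    and disj: "disjoint_family_on a {..<n}" and v: "\<And>i. i < n \<Longrightarrow> 0 \<le> v i"
  shows "(\<integral>\<^sup>+ w. (\<Prod>i<n. count_power (v i) (emeasure (points (I w) (x w)) (a i))) \<partial>M)
    = ennreal (exp (\<Sum>i<n. measure \<Lambda> (a i) * (v i - 1)))"
proof -
  interpret prob_space M by fact
  let ?N = "\<lambda>i w. emeasure (points (I w) (x w)) (a i)"
  have "indep_vars (\<lambda>_. borel) ?N {..<n}"
    using X disj a unfolding poisson_process_def by auto
  then have ind: "indep_vars (\<lambda>_. borel) (\<lambda>i w. count_power (v i) (?N i w)) {..<n}"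
    by (rule indep_vars_compose2) measurable
  have "(\<integral>\<^sup>+ w. (\<Prod>i<n. count_power (v i) (?N i w)) \<partial>M)
    = (\<Prod>i<n. \<integral>\<^sup>+ w. count_power (v i) (?N i w) \<partial>M)"
    by (rule indep_vars_nn_integral[OF _ ind]) auto
  also have "\<dots> = (\<Prod>i<n. ennreal (exp (measure \<Lambda> (a i) * (v i - 1))))"
  proof (rule prod.cong[OF refl])
    fix i assume i: "i \<in> {..<n}"
    show "(\<integral>\<^sup>+ w. count_power (v i) (?N i w) \<partial>M) = ennreal (exp (measure \<Lambda> (a i) * (v i - 1)))"
      by (rule nn_integral_poisson_count_power)
        (use X a v i in \<open>auto simp: poisson_process_def\<close>)
  qed
  also have "\<dots> = ennreal (exp (\<Sum>i<n. measure \<Lambda> (a i) * (v i - 1)))"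
    by (simp add: prod_ennreal exp_sum)
  finally show ?thesis .
qed

text \<open>Group the points by the set \<open>a i\<close> that contains them: \<open>\<phi>\<close>
  is constant there, so a group contributes a power of \<open>v i\<close> whose exponent is its
  count.\<close>

lemma prod_random_set_count_power:
  fixes v :: "nat \<Rightarrow> real"
  assumes a: "\<And>i. i < n \<Longrightarrow> a i \<in> sets borel" and disj: "disjoint_family_on a {..<n}"
    and fin: "finite {j \<in> I. x j \<in> (\<Union>i<n. a i)}"
    and \<phi>: "\<And>i y. i < n \<Longrightarrow> y \<in> a i \<Longrightarrow> \<phi> y = v i" and v: "\<And>i. i < n \<Longrightarrow> 0 \<le> v i"
  shows "point_product I x (\<Union>i<n. a i) \<phi> = (\<Prod>i<n. count_power (v i) (emeasure (points I x) (a i)))"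
proof -
  have fin': "finite {j \<in> I. x j \<in> a i}" if "i < n" for i
    by (rule finite_subset[OF _ fin]) (use that in auto)
  have "{j. j \<in> I \<and> x j \<in> (\<Union>i<n. a i)} = (\<Union>i<n. {j \<in> I. x j \<in> a i})" by auto
  then have "point_product I x (\<Union>i<n. a i) \<phi>
    = (\<Prod>j\<in>(\<Union>i<n. {j \<in> I. x j \<in> a i}). ennreal (\<phi> (x j)))" by simp
  also have "\<dots> = (\<Prod>i<n. \<Prod>j\<in>{j \<in> I. x j \<in> a i}. ennreal (\<phi> (x j)))"
    by (rule prod.UNION_disjoint) (use fin' disj in \<open>auto simp: disjoint_family_on_def\<close>)
  also have "\<dots> = (\<Prod>i<n. count_power (v i) (emeasure (points I x) (a i)))"
  proof (rule prod.cong[OF refl])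
    fix i assume i: "i \<in> {..<n}"
    then have "(\<Prod>j\<in>{j \<in> I. x j \<in> a i}. ennreal (\<phi> (x j))) = (\<Prod>j\<in>{j \<in> I. x j \<in> a i}. ennreal (v i))"
      by (intro prod.cong) (auto simp: \<phi>)
    then show "(\<Prod>j\<in>{j \<in> I. x j \<in> a i}. ennreal (\<phi> (x j))) = count_power (v i) (emeasure (points I x) (a i))"
      using i a v fin' by (simp add: emeasure_points_eq_card ennreal_power)
  qed
  finally show ?thesis .
qed

lemma nn_integral_poisson_process_prod_simple:
  fixes \<phi> :: "real \<Rightarrow> real"
  assumes M: "prob_space M" and X: "poisson_process M (\<lambda>w. points (I w) (x w)) \<Lambda>"
    and sets_\<Lambda>: "sets \<Lambda> = sets borel" and B: "B \<in> sets borel" "emeasure \<Lambda> B < \<infinity>"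
    and \<phi>: "simple_function borel \<phi>" "\<And>y. 0 \<le> \<phi> y"
  shows "(\<lambda>w. point_product (I w) (x w) B \<phi>) \<in> borel_measurable M" (is ?m)
    and "(\<integral>\<^sup>+ w. point_product (I w) (x w) B \<phi> \<partial>M)
      = ennreal (exp (LINT y|\<Lambda>. indicator B y * (\<phi> y - 1)))" (is ?e)
proof -
  interpret prob_space M by fact
  have "finite (range \<phi>)" using \<phi>(1) by (simp add: simple_function_def)
  then obtain v and n :: nat where v: "bij_betw v {..<n} (range \<phi>)"
    using ex_bij_betw_nat_finite[of "range \<phi>"] by (auto simp: atLeast0LessThan)
  define a where "a i = \<phi> -` {v i} \<inter> B" for i
  have \<phi>_meas: "\<phi> \<in> borel_measurable borel" using \<phi>(1) by (rule borel_measurable_simple_function)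
  have a: "a i \<in> sets borel" for i
    using measurable_sets[OF \<phi>_meas, of "{v i}"] B(1) by (auto simp: a_def)
  have a_fin: "emeasure \<Lambda> (a i) < \<infinity>" for i
    using B emeasure_mono[of "a i" B \<Lambda>] by (auto simp: a_def sets_\<Lambda> intro: le_less_trans)
  have UN: "(\<Union>i<n. a i) = B"
    using v by (force simp: a_def bij_betw_def)
  have v_inj: "i = j" if "i < n" "j < n" "v i = v j" for i j
    using v that by (auto simp: bij_betw_def inj_on_def)
  have disj: "disjoint_family_on a {..<n}"
    using v_inj by (auto simp: disjoint_family_on_def a_def)
  have v0: "0 \<le> v i" if "i < n" for i
    using bij_betwE[OF v] that \<phi>(2) by (metis imageE lessThan_iff)
  let ?N = "\<lambda>A w. emeasure (points (I w) (x w)) A"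
  have N [measurable]: "?N A \<in> borel_measurable M" if "A \<in> sets borel" for A
    using X that by (auto simp: poisson_process_def)
  \<comment> \<open>The branch for infinitely many points makes the identity hold for every
    \<open>w\<close>, not only almost surely; measurability of the product is read off from
    it.\<close>
  have eq: "point_product (I w) (x w) B \<phi>
      = (if ?N B w = \<infinity> then 1 else \<Prod>i<n. count_power (v i) (?N (a i) w))" for w
  proof (cases "finite {j \<in> I w. x w j \<in> B}")
    case True
    with emeasure_points_eq_card[OF B(1) True] prod_random_set_count_power[of n a "I w" "x w" \<phi> v] show ?thesis
      using a disj v0 by (simp add: UN ennreal_of_nat_neq_top) (simp add: a_def)
  next
    case False
    then show ?thesis by (simp add: emeasure_points_eq_infinity[OF B(1) False])
  qed
  show ?m unfolding eq using a B(1) by measurable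
  have "(\<integral>\<^sup>+ w. point_product (I w) (x w) B \<phi> \<partial>M)
      = (\<integral>\<^sup>+ w. (\<Prod>i<n. count_power (v i) (?N (a i) w)) \<partial>M)"
  proof (rule nn_integral_cong_AE)
    show "AE w in M. point_product (I w) (x w) B \<phi> = (\<Prod>i<n. count_power (v i) (?N (a i) w))"
      using AE_poisson_process_finite[OF M X B]
      by eventually_elim (auto simp: eq emeasure_points_eq_card[OF B(1)] ennreal_of_nat_neq_top)
  qed
  also have "\<dots> = ennreal (exp (\<Sum>i<n. measure \<Lambda> (a i) * (v i - 1)))"
    by (rule nn_integral_poisson_process_prod_step[OF M X a a_fin disj v0]) auto
  also have "(\<Sum>i<n. measure \<Lambda> (a i) * (v i - 1)) = (LINT y|\<Lambda>. (\<Sum>i<n. indicator (a i) y * (v i - 1)))"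
    using a a_fin by (subst Bochner_Integration.integral_sum) (auto simp: sets_\<Lambda> sets_eq_imp_space_eq[OF sets_\<Lambda>] intro!: integrable_real_indicator)
  also have "(\<lambda>y. \<Sum>i<n. indicator (a i) y * (v i - 1)) = (\<lambda>y. indicator B y * (\<phi> y - 1))"
  proof
    fix y show "(\<Sum>i<n. indicator (a i) y * (v i - 1)) = indicator B y * (\<phi> y - 1)"
  proof (cases "y \<in> B")
    case True
    then obtain k where k: "k < n" "y \<in> a k" using UN by auto
    have "(\<Sum>i<n. indicator (a i) y * (v i - 1)) = (\<Sum>i<n. if i = k then v k - 1 else 0)"
      using k disj by (intro sum.cong) (auto simp: indicator_def disjoint_family_on_def)
    then show ?thesis using k True by (simp add: a_def)
  next
    case False
    then have "y \<notin> a i" for i by (auto simp: a_def)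
    then show ?thesis using False by simp
  qed
  qed
  finally show ?e .
qed

text \<open>Approximation by simple functions from below: monotone convergence on the left,
  dominated convergence on the right. Values of \<open>\<phi>\<close> above one are allowed, so the
  exponent has no sign; the finite mass of \<open>B\<close> and the bound \<open>K\<close> make
  \<open>1 + K\<close> an integrable majorant.\<close>

lemma nn_integral_poisson_process_prod:
  fixes \<phi> :: "real \<Rightarrow> real"
  assumes M: "prob_space M" and X: "poisson_process M (\<lambda>w. points (I w) (x w)) \<Lambda>"
    and sets_\<Lambda>: "sets \<Lambda> = sets borel" and B: "B \<in> sets borel" "emeasure \<Lambda> B < \<infinity>"
    and \<phi> [measurable]: "\<phi> \<in> borel_measurable borel" and \<phi>_bounds: "\<And>y. 0 \<le> \<phi> y" "\<And>y. \<phi> y \<le> K"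
  shows "(\<integral>\<^sup>+ w. point_product (I w) (x w) B \<phi> \<partial>M)
      = ennreal (exp (LINT y|\<Lambda>. indicator B y * (\<phi> y - 1)))"
proof -
  interpret prob_space M by fact
  obtain f where f: "incseq f" "\<And>i. simple_function borel (f i)" "\<And>y. bdd_above (range (\<lambda>i. f i y))"
      "\<And>i y. 0 \<le> f i y" and \<phi>_eq: "\<phi> = (SUP i. f i)"
    using borel_measurable_implies_simple_function_sequence_real[OF \<phi> \<phi>_bounds(1)] by metis
  have lim: "(\<lambda>i. f i y) \<longlonglongrightarrow> \<phi> y" for y
    unfolding \<phi>_eq SUP_apply using f(1,3) by (intro LIMSEQ_incseq_SUP) (auto simp: incseq_def le_fun_def)
  have f_le: "f i y \<le> \<phi> y" for i y
    by (rule incseq_le[OF _ lim]) (use f(1) in \<open>auto simp: incseq_def le_fun_def\<close>)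
  have "(\<lambda>n. \<integral>\<^sup>+ w. point_product (I w) (x w) B (f n) \<partial>M)
    \<longlonglongrightarrow> (\<integral>\<^sup>+ w. point_product (I w) (x w) B \<phi> \<partial>M)"
  proof (rule nn_integral_LIMSEQ)
    show "incseq (\<lambda>n w. point_product (I w) (x w) B (f n))"
      using f(1,4) by (auto simp: incseq_def le_fun_def prod_ennreal intro!: ennreal_leI prod_mono)
    show "(\<lambda>w. point_product (I w) (x w) B (f n)) \<in> borel_measurable M" for n
      by (rule nn_integral_poisson_process_prod_simple(1)[OF M X sets_\<Lambda> B f(2,4)])
    fix w
    show "(\<lambda>n. \<Prod>j | j \<in> I w \<and> x w j \<in> B. ennreal (f n (x w j))) \<longlonglongrightarrow> point_product (I w) (x w) B \<phi>"
    proof -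
      have "(\<lambda>n. \<Prod>j | j \<in> I w \<and> x w j \<in> B. f n (x w j)) \<longlonglongrightarrow> (\<Prod>j | j \<in> I w \<and> x w j \<in> B. \<phi> (x w j))"
        by (intro tendsto_prod lim)
      then have "(\<lambda>n. ennreal (\<Prod>j | j \<in> I w \<and> x w j \<in> B. f n (x w j))) \<longlonglongrightarrow> ennreal (\<Prod>j | j \<in> I w \<and> x w j \<in> B. \<phi> (x w j))"
        by (rule tendsto_ennrealI)
      then show ?thesis using f(4) \<phi>_bounds(1) by (simp add: prod_ennreal)
    qed
  qed
  moreover have "(\<lambda>n. \<integral>\<^sup>+ w. point_product (I w) (x w) B (f n) \<partial>M)
    \<longlonglongrightarrow> ennreal (exp (LINT y|\<Lambda>. indicator B y * (\<phi> y - 1)))"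
  proof -
    have meas: "borel_measurable \<Lambda> = borel_measurable (borel :: real measure)"
      using sets_\<Lambda> by (rule measurable_cong_sets) simp
    have "(\<lambda>n. LINT y|\<Lambda>. indicator B y * (f n y - 1)) \<longlonglongrightarrow> (LINT y|\<Lambda>. indicator B y * (\<phi> y - 1))"
    proof (rule integral_dominated_convergence[where w = "\<lambda>y. indicator B y * (1 + K)"])
      show "integrable \<Lambda> (\<lambda>y. indicator B y * (1 + K))"
        using B by (auto simp: sets_\<Lambda> intro!: integrable_real_indicator)
      show "(\<lambda>y. indicator B y * (\<phi> y - 1)) \<in> borel_measurable \<Lambda>"
        unfolding meas using B(1) by measurable
      show "(\<lambda>y. indicator B y * (f n y - 1)) \<in> borel_measurable \<Lambda>" for n
        unfolding meas using B(1) borel_measurable_simple_function[OF f(2)[of n]] by measurable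
      show "AE y in \<Lambda>. norm (indicator B y * (f n y - 1)) \<le> indicator B y * (1 + K)" for n
      proof (rule AE_I2)
        fix y
        have "norm (f n y - 1) \<le> 1 + K"
          using f(4)[of n y] f_le[of n y] \<phi>_bounds(2)[of y] by auto
        then show "norm (indicator B y * (f n y - 1)) \<le> indicator B y * (1 + K)"
          by (simp add: indicator_def)
      qed
    qed (auto intro!: tendsto_intros lim)
    then show ?thesis
      by (subst nn_integral_poisson_process_prod_simple(2)[OF M X sets_\<Lambda> B f(2,4)])
        (intro tendsto_ennrealI tendsto_exp)
  qed
  ultimately show ?thesis by (rule LIMSEQ_unique)
qed

section \<open>Clusters and their genealogies\<close>

text \<open>Labels grow at the head, so the ancestor in the first generation is the last entry of a
  label. Descending into child \<open>i\<close> of the root therefore appends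
  \<open>[i]\<close>.\<close>

definition subtree :: "nat \<Rightarrow> genealogy \<Rightarrow> genealogy" where
  "subtree i \<gamma> u = \<gamma> (u @ [i])"

text \<open>
  \<open>cluster_sum f \<gamma> x\<close> sums \<open>f\<close> over the cluster rooted at \<open>x\<close>. For an infinite cluster it is \<open>0\<close>,
  and so is \<open>cluster_size\<close>: linearity and bounds therefore need no finiteness assumption.
\<close>
definition cluster_sum :: "(real \<Rightarrow> 'b) \<Rightarrow> genealogy \<Rightarrow> real \<Rightarrow> 'b::comm_monoid_add" where
  "cluster_sum f \<gamma> x = (\<Sum>u | alive \<gamma> u. f (x + pos \<gamma> u))"

definition cluster_sum_upto :: "nat \<Rightarrow> (real \<Rightarrow> 'b) \<Rightarrow> genealogy \<Rightarrow> real \<Rightarrow> 'b::comm_monoid_add" where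
  "cluster_sum_upto n f \<gamma> x = (\<Sum>u | alive \<gamma> u \<and> length u \<le> n. f (x + pos \<gamma> u))"

definition cluster_size :: "genealogy \<Rightarrow> nat" where
  "cluster_size \<gamma> = card {u. alive \<gamma> u}"

lemma alive_append: "alive \<gamma> (u @ [i]) \<longleftrightarrow> i < fst (\<gamma> []) \<and> alive (subtree i \<gamma>) u"
  by (induction u) (auto simp: subtree_def)

lemma pos_append: "pos \<gamma> (u @ [i]) = snd (\<gamma> []) i + pos (subtree i \<gamma>) u"
  by (induction u) (auto simp: subtree_def)

lemma alive_upto_Suc:
  "{u. alive \<gamma> u \<and> length u \<le> Suc n}
    = insert [] (\<Union>i<fst (\<gamma> []). (\<lambda>u. u @ [i]) ` {u. alive (subtree i \<gamma>) u \<and> length u \<le> n})"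
proof (intro set_eqI iffI)
  fix u assume u: "u \<in> {u. alive \<gamma> u \<and> length u \<le> Suc n}"
  show "u \<in> insert [] (\<Union>i<fst (\<gamma> []). (\<lambda>u. u @ [i]) ` {u. alive (subtree i \<gamma>) u \<and> length u \<le> n})"
  proof (cases u rule: rev_cases)
    case (snoc v i)
    then show ?thesis using u by (auto simp: alive_append)
  qed simp
qed (auto simp: alive_append)

lemma finite_alive_upto: "finite {u. alive \<gamma> u \<and> length u \<le> n}"
proof (induction n arbitrary: \<gamma>)
  case 0
  show ?case by (rule finite_subset[of _ "{[]}"]) auto
qed (simp add: alive_upto_Suc)

lemma cluster_sum_upto_0 [simp]: "cluster_sum_upto 0 f \<gamma> x = f x"
proof -
  have "{u. alive \<gamma> u \<and> length u \<le> 0} = {[]}" by auto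
  then show ?thesis by (simp add: cluster_sum_upto_def)
qed

text \<open>Only finitely many individuals live in the first \<open>n\<close> generations of any
  genealogy, so the cut at the root is an identity for every \<open>\<gamma>\<close>, before almost
  sure finiteness of clusters is known.\<close>

lemma cluster_sum_upto_Suc:
  "cluster_sum_upto (Suc n) f \<gamma> x
    = f x + (\<Sum>i<fst (\<gamma> []). cluster_sum_upto n f (subtree i \<gamma>) (x + snd (\<gamma> []) i))"
proof -
  let ?A = "\<lambda>i. {u. alive (subtree i \<gamma>) u \<and> length u \<le> n}"
  have "cluster_sum_upto (Suc n) f \<gamma> x
      = f x + (\<Sum>u\<in>(\<Union>i<fst (\<gamma> []). (\<lambda>u. u @ [i]) ` ?A i). f (x + pos \<gamma> u))"
    unfolding cluster_sum_upto_def alive_upto_Suc by (subst sum.insert) (auto simp: finite_alive_upto)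
  also have "(\<Sum>u\<in>(\<Union>i<fst (\<gamma> []). (\<lambda>u. u @ [i]) ` ?A i). f (x + pos \<gamma> u))
      = (\<Sum>i<fst (\<gamma> []). \<Sum>u\<in>(\<lambda>u. u @ [i]) ` ?A i. f (x + pos \<gamma> u))"
    by (rule sum.UNION_disjoint) (auto simp: finite_alive_upto)
  also have "\<dots> = (\<Sum>i<fst (\<gamma> []). cluster_sum_upto n f (subtree i \<gamma>) (x + snd (\<gamma> []) i))"
    unfolding cluster_sum_upto_def
  proof (rule sum.cong[OF refl])
    fix i
    show "(\<Sum>u\<in>(\<lambda>u. u @ [i]) ` ?A i. f (x + pos \<gamma> u))
        = (\<Sum>u | alive (subtree i \<gamma>) u \<and> length u \<le> n. f (x + snd (\<gamma> []) i + pos (subtree i \<gamma>) u))"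
      by (subst sum.reindex) (auto simp: inj_on_def pos_append add.assoc)
  qed
  finally show ?thesis .
qed

lemma cluster_sum_upto_tendsto:
  fixes f :: "real \<Rightarrow> 'b::topological_comm_monoid_add"
  assumes "finite {u. alive \<gamma> u}"
  shows "(\<lambda>n. cluster_sum_upto n f \<gamma> x) \<longlonglongrightarrow> cluster_sum f \<gamma> x"
proof -
  from assms obtain N where N: "\<forall>u. alive \<gamma> u \<longrightarrow> length u \<le> N"
    using finite_nat_set_iff_bounded_le[of "length ` {u. alive \<gamma> u}"] by auto
  have "cluster_sum_upto n f \<gamma> x = cluster_sum f \<gamma> x" if "n \<ge> N" for n
    unfolding cluster_sum_upto_def cluster_sum_def
    using N that by (intro sum.cong) (auto intro: order_trans)
  then show ?thesis by (intro tendsto_eventually) (auto simp: eventually_sequentially)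
qed

lemma abs_cluster_sum_le: "\<bar>cluster_sum f \<gamma> x\<bar> \<le> cluster_sum (\<lambda>y. \<bar>f y\<bar>) \<gamma> x" for f :: "real \<Rightarrow> real"
  unfolding cluster_sum_def by (rule sum_abs)

lemma norm_cluster_sum_le_size:
  fixes f :: "real \<Rightarrow> 'b::real_normed_vector"
  assumes "\<And>y. norm (f y) \<le> b"
  shows "norm (cluster_sum f \<gamma> x) \<le> b * cluster_size \<gamma>"
proof -
  have "norm (cluster_sum f \<gamma> x) \<le> (\<Sum>u | alive \<gamma> u. norm (f (x + pos \<gamma> u)))"
    unfolding cluster_sum_def by (rule norm_sum)
  also have "\<dots> \<le> (\<Sum>u | alive \<gamma> u. b)" by (intro sum_mono assms)
  finally show ?thesis by (simp add: cluster_size_def mult.commute)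
qed

lemma measurable_genealogy_component [measurable (raw)]:
  assumes "g \<in> measurable M genealogy_space"
  shows "(\<lambda>w. g w u) \<in> measurable M brood_space"
  using assms unfolding genealogy_space_def
  by (rule measurable_compose) (rule measurable_component_singleton, simp)

lemma measurable_brood_size [measurable (raw)]:
  "b \<in> measurable M brood_space \<Longrightarrow> (\<lambda>w. fst (b w)) \<in> measurable M (count_space UNIV)"
  unfolding brood_space_def by measurable

lemma measurable_brood_displacement [measurable (raw)]:
  assumes "b \<in> measurable M brood_space"
  shows "(\<lambda>w. snd (b w) i) \<in> borel_measurable M"
proof -
  have "(\<lambda>w. snd (b w)) \<in> measurable M (Pi\<^sub>M UNIV (\<lambda>_. borel))"
    using assms unfolding brood_space_def by measurable
  then show ?thesis by (rule measurable_compose) (rule measurable_component_singleton, simp)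
qed

lemma measurable_alive [measurable (raw)]:
  assumes [measurable]: "g \<in> measurable M genealogy_space"
  shows "Measurable.pred M (\<lambda>w. alive (g w) u)"
  by (induction u) (simp_all, measurable)

lemma borel_measurable_pos [measurable (raw)]:
  assumes [measurable]: "g \<in> measurable M genealogy_space"
  shows "(\<lambda>w. pos (g w) u) \<in> borel_measurable M"
  by (induction u) (simp_all, measurable)

lemma measurable_subtree [measurable (raw)]:
  assumes [measurable]: "g \<in> measurable M genealogy_space"
  shows "(\<lambda>w. subtree i (g w)) \<in> measurable M genealogy_space"
proof -
  have "(\<lambda>w u. g w (u @ [i])) \<in> measurable M (Pi\<^sub>M UNIV (\<lambda>_. brood_space))"
    by (rule measurable_PiM_single')
      (auto intro: measurable_space[OF measurable_genealogy_component[OF assms]])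
  then show ?thesis by (simp add: subtree_def[abs_def] genealogy_space_def)
qed

lemma borel_measurable_cluster_sum [measurable (raw)]:
  fixes f :: "real \<Rightarrow> 'b::{real_normed_vector, second_countable_topology}"
  assumes [measurable]: "f \<in> borel_measurable borel" "g \<in> measurable M genealogy_space" "X \<in> borel_measurable M"
  shows "(\<lambda>w. cluster_sum f (g w) (X w)) \<in> borel_measurable M"
  unfolding cluster_sum_def by (rule borel_measurable_sum_random_set) measurable

lemma borel_measurable_cluster_sum_upto [measurable (raw)]:
  fixes f :: "real \<Rightarrow> 'b::{real_normed_vector, second_countable_topology}"
  assumes [measurable]: "f \<in> borel_measurable borel" "g \<in> measurable M genealogy_space" "X \<in> borel_measurable M"
  shows "(\<lambda>w. cluster_sum_upto n f (g w) (X w)) \<in> borel_measurable M"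
  unfolding cluster_sum_upto_def by (rule borel_measurable_sum_random_set) measurable

lemma borel_measurable_cluster_size [measurable (raw)]:
  assumes [measurable]: "g \<in> measurable M genealogy_space"
  shows "(\<lambda>w. real (cluster_size (g w))) \<in> borel_measurable M"
proof -
  have "(\<lambda>w. cluster_sum (\<lambda>_. 1 :: real) (g w) 0) \<in> borel_measurable M" by measurable
  then show ?thesis by (simp add: cluster_sum_def cluster_size_def)
qed

lemma measurable_genealogy:
  assumes "\<And>u. (\<lambda>w. g w u) \<in> measurable M brood_space"
  shows "g \<in> measurable M genealogy_space"
proof -
  have "(\<lambda>w u. g w u) \<in> measurable M (Pi\<^sub>M UNIV (\<lambda>_. brood_space))"
    using assms by (intro measurable_PiM_single') (auto intro: measurable_space)
  then show ?thesis by (simp add: genealogy_space_def)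
qed

text \<open>Reads \<open>subtree i\<close> as a function of the broods in \<open>K\<close> alone, as
  needed to pass from independent blocks of labels to independent subtrees.\<close>

lemma measurable_subtree_PiM:
  assumes "range (\<lambda>u. u @ [i]) \<subseteq> K"
  shows "subtree i \<in> measurable (PiM K (\<lambda>_. brood_space)) genealogy_space"
proof (rule measurable_genealogy)
  show "(\<lambda>w. subtree i w u) \<in> measurable (PiM K (\<lambda>_. brood_space)) brood_space" for u
    unfolding subtree_def by (rule measurable_component_singleton) (use assms in auto)
qed

lemma subtree_restrict:
  "range (\<lambda>u. u @ [i]) \<subseteq> K \<Longrightarrow> subtree i (restrict \<gamma> K) = subtree i \<gamma>"
  by (auto simp: subtree_def fun_eq_iff)

section \<open>The subcritical offspring intensity and the recursion for generating
  functions\<close>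

definition offspring_intensity :: "real \<Rightarrow> (real \<Rightarrow> real) \<Rightarrow> real measure" where
  "offspring_intensity m h = density lborel (\<lambda>y. ennreal (m * h y))"

locale branching_parameters =
  fixes m :: real and h :: "real \<Rightarrow> real"
  assumes m: "0 < m" "m < 1" and h: "prob_density h"
begin

abbreviation \<Lambda> :: "real measure" where "\<Lambda> \<equiv> offspring_intensity m h"

lemma h_measurable [measurable]: "h \<in> borel_measurable borel"
  and h_nonneg: "0 \<le> h x"
  and nn_integral_h: "(\<integral>\<^sup>+ x. ennreal (h x) \<partial>lborel) = 1"
  using h by (auto simp: prob_density_def)

lemma sets_\<Lambda> [simp, measurable_cong]: "sets \<Lambda> = sets borel"
  by (simp add: offspring_intensity_def)

lemma space_\<Lambda> [simp]: "space \<Lambda> = UNIV"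
  by (simp add: offspring_intensity_def)

lemma emeasure_\<Lambda>: "emeasure \<Lambda> UNIV = ennreal m"
proof -
  have "emeasure \<Lambda> UNIV = (\<integral>\<^sup>+ x. ennreal m * ennreal (h x) \<partial>lborel)"
    using m h_nonneg by (simp add: offspring_intensity_def emeasure_density ennreal_mult)
  also have "\<dots> = ennreal m" by (simp add: nn_integral_cmult nn_integral_h)
  finally show ?thesis .
qed

sublocale \<Lambda>: finite_measure \<Lambda>
  by (rule finite_measureI) (simp add: emeasure_\<Lambda>)

lemma measure_\<Lambda>: "measure \<Lambda> UNIV = m"
  using m by (simp add: measure_def emeasure_\<Lambda>)

text \<open>
  The threshold is chosen so that \<open>1 / m\<close> is a fixed point of \<open>q \<mapsto> exp (\<epsilon> + m * (q - 1))\<close>;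
  this keeps the generating functions of all truncated clusters below \<open>1 / m\<close>.
\<close>
definition \<epsilon> :: real where "\<epsilon> = ln (1 / m) - (1 - m)"

text \<open>This is \<open>ln m < m - 1\<close>, which is strict because equality holds only at
  \<open>m = 1\<close>.\<close>

lemma \<epsilon>_pos: "0 < \<epsilon>"
  using m ln_le_minus_one[of m] ln_eq_minus_one[of m] unfolding \<epsilon>_def
  by (fastforce simp: ln_div)

lemma exp_\<epsilon>: "exp (\<epsilon> + (1 - m)) = 1 / m"
  using m by (simp add: \<epsilon>_def)

text \<open>
  The law of a genealogy depends on how siblings are enumerated, which is unconstrained. The
  generating functions of truncated clusters do not, since they satisfy this recursion; hence all
  clusters share one generating functional.
\<close>
primrec gf_upto :: "nat \<Rightarrow> (real \<Rightarrow> real) \<Rightarrow> real \<Rightarrow> real" where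
  "gf_upto 0 f x = exp (f x)"
| "gf_upto (Suc n) f x = exp (f x + (LINT y|\<Lambda>. (gf_upto n f (x + y) - 1)))"

lemma borel_measurable_gf_upto [measurable]:
  "f \<in> borel_measurable borel \<Longrightarrow> gf_upto n f \<in> borel_measurable borel"
proof (induction n)
  case 0
  note [measurable] = 0
  have "gf_upto 0 f = (\<lambda>x. exp (f x))" by auto
  then show ?case by simp
next
  case (Suc n)
  note [measurable] = Suc.prems Suc.IH[OF Suc.prems]
  have "(\<lambda>x. LINT y|\<Lambda>. (gf_upto n f (x + y) - 1)) \<in> borel_measurable borel"
    by (rule \<Lambda>.borel_measurable_lebesgue_integral) measurable
  then show ?case by simp
qed

lemma gf_upto_nonneg: "0 \<le> gf_upto n f x"
  by (cases n) auto

lemma gf_upto_le: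
  assumes [measurable]: "f \<in> borel_measurable borel" and f: "\<And>y. f y \<le> \<epsilon>"
  shows "gf_upto n f x \<le> 1 / m"
proof (induction n arbitrary: x)
  case 0
  have "exp (f x) \<le> exp (\<epsilon> + (1 - m))" using f[of x] m by simp
  then show ?case by (simp add: exp_\<epsilon>)
next
  case (Suc n)
  have "(LINT y|\<Lambda>. (gf_upto n f (x + y) - 1)) \<le> (LINT y|\<Lambda>. (1 / m - 1))"
  proof (rule integral_mono)
    show "integrable \<Lambda> (\<lambda>y. gf_upto n f (x + y) - 1)"
      using Suc.IH gf_upto_nonneg
      by (intro \<Lambda>.integrable_const_bound[where B = "1 / m + 1"])
        (auto intro!: AE_I2 order_trans[OF abs_triangle_ineq4] simp: abs_of_nonneg)
  qed (use Suc.IH in auto)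
  also have "\<dots> = 1 - m"
    using m by (simp add: measure_\<Lambda> field_simps)
  finally have "gf_upto (Suc n) f x \<le> exp (\<epsilon> + (1 - m))"
    using f[of x] by simp
  then show ?case by (simp only: exp_\<epsilon>)
qed

end

section \<open>Independence inside a genealogy\<close>

lemma subtree_branching:
  assumes M: "prob_space M" and g: "branching_genealogy M m h g"
  shows "branching_genealogy M m h (\<lambda>w. subtree i (g w))"
proof -
  interpret prob_space M by fact
  have ind: "indep_vars (\<lambda>_. brood_space) (\<lambda>u w. g w u) UNIV"
    using g by (simp add: branching_genealogy_def)
  \<comment> \<open>Singleton blocks of labels reindex the independent family along the injection
    that appends \<open>[i]\<close>.\<close>
  have "indep_vars (\<lambda>u. PiM {u @ [i]} (\<lambda>_. brood_space)) (\<lambda>u w. restrict (\<lambda>v. g w v) {u @ [i]}) UNIV"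
    by (rule indep_vars_restrict[OF ind]) (auto simp: disjoint_family_on_def)
  then have "indep_vars (\<lambda>_. brood_space) (\<lambda>u w. (\<lambda>b. b (u @ [i])) (restrict (\<lambda>v. g w v) {u @ [i]})) UNIV"
    by (rule indep_vars_compose2) (rule measurable_component_singleton, simp)
  then have "indep_vars (\<lambda>_. brood_space) (\<lambda>u w. subtree i (g w) u) UNIV"
    by (simp add: subtree_def)
  then show ?thesis
    using g by (simp add: branching_genealogy_def subtree_def)
qed

lemma branching_genealogy_measurable:
  assumes M: "prob_space M" and g: "branching_genealogy M m h g"
  shows "g \<in> measurable M genealogy_space"
proof -
  interpret prob_space M by fact
  show ?thesis
    using g by (intro measurable_genealogy) (auto simp: branching_genealogy_def indep_vars_def)
qed

text \<open>Labels with different last entries form disjoint blocks, and \<open>subtree i\<close>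
  reads only the block of \<open>i\<close>.\<close>

lemma indep_vars_subtrees:
  assumes M: "prob_space M" and g: "branching_genealogy M m h g"
  shows "prob_space.indep_vars M (\<lambda>_. genealogy_space) (\<lambda>i w. subtree i (g w)) UNIV"
proof -
  interpret prob_space M by fact
  have ind: "indep_vars (\<lambda>_. brood_space) (\<lambda>u w. g w u) UNIV"
    using g by (simp add: branching_genealogy_def)
  let ?K = "\<lambda>i. range (\<lambda>u. u @ [i])"
  have "indep_vars (\<lambda>i. PiM (?K i) (\<lambda>_. brood_space)) (\<lambda>i w. restrict (\<lambda>v. g w v) (?K i)) UNIV"
    by (rule indep_vars_restrict[OF ind]) (auto simp: disjoint_family_on_def)
  then have "indep_vars (\<lambda>_. genealogy_space) (\<lambda>i w. subtree i (restrict (\<lambda>v. g w v) (?K i))) UNIV"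
    by (rule indep_vars_compose2) (rule measurable_subtree_PiM, simp)
  moreover have "subtree i (restrict (\<lambda>v. g w v) (?K i)) = subtree i (g w)" for i w
    by (rule subtree_restrict) simp
  ultimately show ?thesis by simp
qed

context branching_parameters
begin

text \<open>Separate the brood of the root from all others. For a fixed brood the subtrees of the
  children are independent branching genealogies, so the inner expectation is the product of
  \<open>gf_upto n\<close> over the positions of the children; the Poisson formula then evaluates
  the outer one. The induction is over all \<open>g\<close>, since the subtrees are different
  genealogies.\<close>

lemma nn_integral_exp_cluster_sum_upto:
  assumes M: "prob_space M" and g: "branching_genealogy M m h g"
    and f [measurable]: "f \<in> borel_measurable borel" and f_le: "\<And>y. f y \<le> \<epsilon>"
  shows "(\<integral>\<^sup>+ w. ennreal (exp (cluster_sum_upto n f (g w) x)) \<partial>M) = ennreal (gf_upto n f x)"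
  using g
proof (induction n arbitrary: g x)
  case 0
  interpret prob_space M by fact
  show ?case by (simp add: emeasure_space_1)
next
  case (Suc n)
  interpret prob_space M by fact
  note g = Suc.prems
  have [measurable]: "g \<in> measurable M genealogy_space"
    using M g by (rule branching_genealogy_measurable)
  have ind: "indep_vars (\<lambda>_. brood_space) (\<lambda>u w. g w u) UNIV"
    using g by (simp add: branching_genealogy_def)
  let ?A = "{[] :: nat list}" and ?B = "- {[] :: nat list}"
  let ?S = "PiM ?A (\<lambda>_. brood_space)" and ?T = "PiM ?B (\<lambda>_. brood_space)"
  let ?X = "\<lambda>w. restrict (\<lambda>u. g w u) ?A" and ?Y = "\<lambda>w. restrict (\<lambda>u. g w u) ?B"
  have indXY: "indep_var ?S ?X ?T ?Y"
    by (rule indep_var_restrict[OF ind]) auto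
  have B: "range (\<lambda>u. u @ [i]) \<subseteq> ?B" for i :: nat by auto
  have [measurable]: "subtree i \<in> measurable ?T genealogy_space" for i
    by (rule measurable_subtree_PiM[OF B])
  have [measurable]: "(\<lambda>a. a []) \<in> measurable ?S brood_space"
    by (rule measurable_component_singleton) simp
  define F where "F = (\<lambda>(a :: genealogy, b). ennreal (exp (\<Sum>i | i < fst (a []).
    cluster_sum_upto n f (subtree i b) (x + snd (a []) i))))"
  have F [measurable]: "F \<in> borel_measurable (?S \<Otimes>\<^sub>M ?T)"
  proof -
    have [measurable]: "(\<lambda>z. \<Sum>i | i < fst (fst z []). cluster_sum_upto n f (subtree i (snd z)) (x + snd (fst z []) i))
        \<in> borel_measurable (?S \<Otimes>\<^sub>M ?T)"
      by (rule borel_measurable_sum_random_set) measurable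
    show ?thesis unfolding F_def split_beta by measurable
  qed
  have "(\<integral>\<^sup>+ w. ennreal (exp (cluster_sum_upto (Suc n) f (g w) x)) \<partial>M)
      = (\<integral>\<^sup>+ w. ennreal (exp (f x)) * F (?X w, ?Y w) \<partial>M)"
    by (intro nn_integral_cong)
      (simp add: F_def cluster_sum_upto_Suc exp_add ennreal_mult subtree_restrict[OF B] lessThan_def)
  also have "\<dots> = ennreal (exp (f x)) * (\<integral>\<^sup>+ w. F (?X w, ?Y w) \<partial>M)"
    using indep_var_rv1[OF indXY] indep_var_rv2[OF indXY] by (intro nn_integral_cmult) measurable
  also have "(\<integral>\<^sup>+ w. F (?X w, ?Y w) \<partial>M) = (\<integral>\<^sup>+ w. (\<integral>\<^sup>+ w'. F (?X w, ?Y w') \<partial>M) \<partial>M)"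
  proof (rule nn_integral_independent_pair[OF indep_var_rv1[OF indXY] indep_var_rv2[OF indXY] _ F])
    fix A B assume AB: "A \<in> sets ?S" "B \<in> sets ?T"
    show "prob ((?X -` A \<inter> space M) \<inter> (?Y -` B \<inter> space M)) = prob (?X -` A \<inter> space M) * prob (?Y -` B \<inter> space M)"
      using indep_varD[OF indXY AB] by (simp add: vimage_def Int_def conj_ac)
  qed
  \<comment> \<open>The vacuous condition \<open>\<in> UNIV\<close> gives the product the shape of
    \<open>point_product\<close> with \<open>B = UNIV\<close>, a set of finite mass
    \<open>m\<close>.\<close>
  also have "\<dots> = (\<integral>\<^sup>+ w. (\<Prod>i | i \<in> {..<fst (g w [])} \<and> snd (g w []) i \<in> UNIV. ennreal (gf_upto n f (x + snd (g w []) i))) \<partial>M)"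
  proof (rule nn_integral_cong)
    fix w
    have "(\<integral>\<^sup>+ w'. F (?X w, ?Y w') \<partial>M)
        = (\<integral>\<^sup>+ w'. (\<Prod>i<fst (g w []). ennreal (exp (cluster_sum_upto n f (subtree i (g w')) (x + snd (g w []) i)))) \<partial>M)"
      by (intro nn_integral_cong) (simp add: F_def subtree_restrict[OF B] exp_sum prod_ennreal lessThan_def)
    also have "\<dots> = (\<Prod>i<fst (g w []). \<integral>\<^sup>+ w'. ennreal (exp (cluster_sum_upto n f (subtree i (g w')) (x + snd (g w []) i))) \<partial>M)"
    proof (rule indep_vars_nn_integral)
      have "indep_vars (\<lambda>_. genealogy_space) (\<lambda>i w. subtree i (g w)) {..<fst (g w [])}"
        by (rule indep_vars_subset[OF indep_vars_subtrees[OF M g]]) simp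
      then show "indep_vars (\<lambda>_. borel) (\<lambda>i w'. ennreal (exp (cluster_sum_upto n f (subtree i (g w')) (x + snd (g w []) i)))) {..<fst (g w [])}"
        by (rule indep_vars_compose2[where Y = "\<lambda>i \<gamma>. ennreal (exp (cluster_sum_upto n f \<gamma> (x + snd (g w []) i)))"]) measurable
    qed auto
    also have "\<dots> = (\<Prod>i<fst (g w []). ennreal (gf_upto n f (x + snd (g w []) i)))"
      by (intro prod.cong refl Suc.IH subtree_branching[OF M g])
    finally show "(\<integral>\<^sup>+ w'. F (?X w, ?Y w') \<partial>M)
        = (\<Prod>i | i \<in> {..<fst (g w [])} \<and> snd (g w []) i \<in> UNIV. ennreal (gf_upto n f (x + snd (g w []) i)))"
      by (simp add: lessThan_def)
  qed
  also have "\<dots> = ennreal (exp (LINT y|\<Lambda>. indicator UNIV y * (gf_upto n f (x + y) - 1)))"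
  proof (rule nn_integral_poisson_process_prod[OF M])
    show "poisson_process M (\<lambda>w. points {..<fst (g w [])} (snd (g w []))) \<Lambda>"
      using g by (simp add: branching_genealogy_def offspring_intensity_def)
    show "gf_upto n f (x + y) \<le> 1 / m" for y
      using f_le by (rule gf_upto_le[OF f])
  qed (auto simp: gf_upto_nonneg emeasure_\<Lambda>)
  finally show ?case by (simp add: exp_add ennreal_mult)
qed

text \<open>The exponential moments of the truncated sizes increase with the generation and stay
  below \<open>1 / m\<close>, so their supremum \<open>S\<close> is integrable. An infinite cluster
  has truncations of arbitrarily large size, which forces \<open>S w = \<infinity>\<close>, a null
  event.\<close>

lemma
  assumes M: "prob_space M" and g: "branching_genealogy M m h g"
  shows AE_finite_cluster: "AE w in M. finite {u. alive (g w) u}"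
    and integrable_exp_cluster_size: "integrable M (\<lambda>w. exp (\<epsilon> * cluster_size (g w)))"
proof -
  interpret prob_space M by fact
  have [measurable]: "g \<in> measurable M genealogy_space"
    using M g by (rule branching_genealogy_measurable)
  define A where "A n w = {u. alive (g w) u \<and> length u \<le> n}" for n w
  have fin_A: "finite (A n w)" for n w by (simp add: A_def finite_alive_upto)
  have exp_A: "exp (cluster_sum_upto n (\<lambda>_. \<epsilon>) (g w) 0) = exp (\<epsilon> * card (A n w))" for n w
    by (simp add: cluster_sum_upto_def A_def mult.commute)
  \<comment> \<open>The truncated cardinalities are used because \<open>cluster_size\<close> would
    be \<open>0\<close>, not infinite, on an infinite cluster.\<close>
  define S where "S w = (SUP n. ennreal (exp (\<epsilon> * card (A n w))))" for w
  have "(\<integral>\<^sup>+ w. S w \<partial>M) = (SUP n. \<integral>\<^sup>+ w. ennreal (exp (\<epsilon> * card (A n w))) \<partial>M)"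
    unfolding S_def
  proof (rule nn_integral_monotone_convergence_SUP)
    show "incseq (\<lambda>n w. ennreal (exp (\<epsilon> * card (A n w))))"
      using fin_A \<epsilon>_pos
      by (auto simp: incseq_def le_fun_def A_def finite_alive_upto intro!: ennreal_leI card_mono)
  qed (simp add: exp_A[symmetric])
  also have "\<dots> \<le> ennreal (1 / m)"
  proof (rule SUP_least)
    fix n
    have "(\<integral>\<^sup>+ w. ennreal (exp (\<epsilon> * card (A n w))) \<partial>M) = ennreal (gf_upto n (\<lambda>_. \<epsilon>) 0)"
      using nn_integral_exp_cluster_sum_upto[OF M g, of "\<lambda>_. \<epsilon>" n 0] by (simp add: exp_A)
    then show "(\<integral>\<^sup>+ w. ennreal (exp (\<epsilon> * card (A n w))) \<partial>M) \<le> ennreal (1 / m)"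
      using gf_upto_le[of "\<lambda>_. \<epsilon>" n 0] by (simp add: ennreal_leI)
  qed
  finally have S_le: "(\<integral>\<^sup>+ w. S w \<partial>M) \<le> ennreal (1 / m)" .
  have S_meas [measurable]: "S \<in> borel_measurable M"
    unfolding S_def exp_A[symmetric] by measurable
  have "(\<integral>\<^sup>+ w. S w \<partial>M) \<noteq> \<infinity>" using S_le by (auto simp: top_unique)
  then have "AE w in M. S w \<noteq> \<infinity>"
    by (rule nn_integral_noteq_infinite[OF S_meas])
  then show fin: "AE w in M. finite {u. alive (g w) u}"
  proof eventually_elim
    case (elim w)
    then obtain r where r: "S w = ennreal r" "0 \<le> r" by (cases "S w") auto
    show ?case
    proof (rule ccontr)
      assume inf: "infinite {u. alive (g w) u}"
      obtain k :: nat where k: "r / \<epsilon> < k" using reals_Archimedean2 by blast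
      obtain T where T: "finite T" "card T = k" "T \<subseteq> {u. alive (g w) u}"
        using infinite_arbitrarily_large[OF inf] by blast
      obtain n where n: "\<forall>u\<in>T. length u \<le> n"
        using finite_nat_set_iff_bounded_le[of "length ` T"] T(1) by auto
      have "k \<le> card (A n w)"
        using T n card_mono[OF fin_A, of T n w] by (auto simp: A_def)
      then have "\<epsilon> * k \<le> \<epsilon> * card (A n w)" using \<epsilon>_pos by simp
      moreover have "r < \<epsilon> * k" using k \<epsilon>_pos by (simp add: field_simps)
      ultimately have "r < exp (\<epsilon> * card (A n w))"
        using exp_ge_add_one_self[of "\<epsilon> * card (A n w)"] by linarith
      moreover have "ennreal (exp (\<epsilon> * card (A n w))) \<le> S w"
        unfolding S_def by (rule SUP_upper) simp
      ultimately show False using r by (simp add: ennreal_le_iff)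
    qed
  qed
  have "(\<integral>\<^sup>+ w. ennreal (exp (\<epsilon> * cluster_size (g w))) \<partial>M) \<le> (\<integral>\<^sup>+ w. S w \<partial>M)"
  proof (rule nn_integral_mono_AE)
    show "AE w in M. ennreal (exp (\<epsilon> * cluster_size (g w))) \<le> S w"
      using fin
    proof eventually_elim
      case (elim w)
      then obtain N where N: "\<forall>u. alive (g w) u \<longrightarrow> length u \<le> N"
        using finite_nat_set_iff_bounded_le[of "length ` {u. alive (g w) u}"] by auto
      then have "A N w = {u. alive (g w) u}" by (auto simp: A_def)
      then show ?case
        unfolding S_def cluster_size_def by (intro SUP_upper2[of N]) auto
    qed
  qed
  with S_le have "(\<integral>\<^sup>+ w. ennreal (exp (\<epsilon> * cluster_size (g w))) \<partial>M) < \<infinity>"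
    by (metis ennreal_less_top infinity_ennreal_def le_less_trans)
  then show "integrable M (\<lambda>w. exp (\<epsilon> * cluster_size (g w)))"
    by (intro integrableI_bounded) auto
qed

lemma exp_cluster_sum_le:
  assumes "\<And>y. \<bar>f y\<bar> \<le> \<epsilon>"
  shows "exp (cluster_sum f \<gamma> x) \<le> exp (\<epsilon> * cluster_size \<gamma>)"
  using norm_cluster_sum_le_size[of f \<epsilon> \<gamma> x] assms by auto

lemma integrable_exp_cluster_sum:
  assumes M: "prob_space M" and g: "branching_genealogy M m h g"
    and f [measurable]: "f \<in> borel_measurable borel" and f_le: "\<And>y. \<bar>f y\<bar> \<le> \<epsilon>"
  shows "integrable M (\<lambda>w. exp (cluster_sum f (g w) x))"
proof -
  have [measurable]: "g \<in> measurable M genealogy_space"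
    using M g by (rule branching_genealogy_measurable)
  show ?thesis
    by (rule Bochner_Integration.integrable_bound[OF integrable_exp_cluster_size[OF M g]])
      (use exp_cluster_sum_le[OF f_le] in auto)
qed

text \<open>On a finite cluster a truncated sum is at most \<open>\<epsilon>\<close> times the full
  size, so the integrable \<open>exp (\<epsilon> * cluster_size (g w))\<close> dominates all
  truncations.\<close>

lemma gf_upto_tendsto:
  assumes M: "prob_space M" and g: "branching_genealogy M m h g"
    and f [measurable]: "f \<in> borel_measurable borel" and f_le: "\<And>y. \<bar>f y\<bar> \<le> \<epsilon>"
  shows "(\<lambda>n. gf_upto n f x) \<longlonglongrightarrow> (LINT w|M. exp (cluster_sum f (g w) x))"
proof -
  interpret prob_space M by fact
  have [measurable]: "g \<in> measurable M genealogy_space"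
    using M g by (rule branching_genealogy_measurable)
  have f_le': "f y \<le> \<epsilon>" for y using f_le[of y] by simp
  have "(\<lambda>n. LINT w|M. exp (cluster_sum_upto n f (g w) x)) \<longlonglongrightarrow> (LINT w|M. exp (cluster_sum f (g w) x))"
  proof (rule integral_dominated_convergence[OF _ _ integrable_exp_cluster_size[OF M g]])
    show "AE w in M. (\<lambda>n. exp (cluster_sum_upto n f (g w) x)) \<longlonglongrightarrow> exp (cluster_sum f (g w) x)"
      using AE_finite_cluster[OF M g]
      by eventually_elim (intro tendsto_exp cluster_sum_upto_tendsto)
    show "AE w in M. norm (exp (cluster_sum_upto n f (g w) x)) \<le> exp (\<epsilon> * cluster_size (g w))" for n
      using AE_finite_cluster[OF M g]
    proof eventually_elim
      case (elim w)
      have "cluster_sum_upto n f (g w) x \<le> (\<Sum>u | alive (g w) u \<and> length u \<le> n. \<epsilon>)"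
        unfolding cluster_sum_upto_def by (intro sum_mono f_le')
      also have "\<dots> \<le> \<epsilon> * cluster_size (g w)"
        using \<epsilon>_pos elim unfolding cluster_size_def by (auto simp: mult.commute intro!: card_mono)
      finally show ?case by simp
    qed
  qed measurable
  moreover have "(LINT w|M. exp (cluster_sum_upto n f (g w) x)) = gf_upto n f x" for n
    by (subst integral_eq_nn_integral)
      (simp_all add: nn_integral_exp_cluster_sum_upto[OF M g f f_le'] gf_upto_nonneg)
  ultimately show ?thesis by simp
qed

text \<open>Let \<open>n\<close> tend to infinity on both sides of the recursion for
  \<open>gf_upto\<close>; the uniform bound \<open>1 / m\<close> is integrable because
  \<open>\<Lambda>\<close> is finite. Differentiating this equation yields the moments.\<close>

lemma exp_cluster_sum_fixpoint:
  assumes M: "prob_space M" and g: "branching_genealogy M m h g"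
    and f [measurable]: "f \<in> borel_measurable borel" and f_le: "\<And>y. \<bar>f y\<bar> \<le> \<epsilon>"
  shows "(LINT w|M. exp (cluster_sum f (g w) x))
    = exp (f x + (LINT y|\<Lambda>. ((LINT w|M. exp (cluster_sum f (g w) (x + y))) - 1)))"
proof -
  interpret prob_space M by fact
  have [measurable]: "g \<in> measurable M genealogy_space"
    using M g by (rule branching_genealogy_measurable)
  have f_le': "f y \<le> \<epsilon>" for y using f_le[of y] by simp
  note lim = gf_upto_tendsto[OF M g f f_le]
  have "(\<lambda>n. LINT y|\<Lambda>. (gf_upto n f (x + y) - 1)) \<longlonglongrightarrow> (LINT y|\<Lambda>. ((LINT w|M. exp (cluster_sum f (g w) (x + y))) - 1))"
  proof (rule integral_dominated_convergence[where w = "\<lambda>_. 1 / m + 1"])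
    show "AE y in \<Lambda>. norm (gf_upto n f (x + y) - 1) \<le> 1 / m + 1" for n
      using gf_upto_le[OF f f_le', of n] gf_upto_nonneg[of n f]
      by (intro AE_I2) (auto intro!: order_trans[OF abs_triangle_ineq4] simp: abs_of_nonneg)
    show "AE y in \<Lambda>. (\<lambda>n. gf_upto n f (x + y) - 1) \<longlonglongrightarrow> (LINT w|M. exp (cluster_sum f (g w) (x + y))) - 1"
      by (intro AE_I2 tendsto_intros lim)
  qed auto
  then have "(\<lambda>n. gf_upto (Suc n) f x) \<longlonglongrightarrow> exp (f x + (LINT y|\<Lambda>. ((LINT w|M. exp (cluster_sum f (g w) (x + y))) - 1)))"
    by (simp, intro tendsto_intros)
  with LIMSEQ_Suc[OF lim[of x]] show ?thesis by (rule LIMSEQ_unique)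
qed

end

section \<open>Differentiating exponential integrals\<close>

text \<open>Raise \<open>y \<le> exp y\<close> at \<open>y = a * x / k\<close> to the power
  \<open>k\<close>. It trades powers for a little exponential rate.\<close>

lemma power_le_exp:
  fixes a x :: real
  assumes "0 < a" "0 \<le> x"
  shows "x ^ k \<le> (real k / a) ^ k * exp (a * x)"
proof (cases "k = 0")
  case False
  have "a * x / k \<le> exp (a * x / k)"
    using exp_ge_add_one_self[of "a * x / k"] by linarith
  then have "(a * x / k) ^ k \<le> exp (a * x / k) ^ k"
    using assms by (intro power_mono) auto
  also have "\<dots> = exp (a * x)"
    using False by (simp flip: exp_of_nat_mult)
  finally have *: "(a * x / k) ^ k \<le> exp (a * x)" .
  have "x ^ k = (real k / a) ^ k * (a * x / k) ^ k"
    using assms False by (simp add: power_mult_distrib[symmetric])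
  also have "\<dots> \<le> (real k / a) ^ k * exp (a * x)"
    using assms * by (intro mult_left_mono) auto
  finally show ?thesis .
qed (use assms in simp)

text \<open>The factor in front of the exponential is the point: over an infinite measure it is what
  makes \<open>exp - 1\<close> integrable.\<close>

lemma abs_exp_minus_1_le: "\<bar>exp x - 1\<bar> \<le> \<bar>x\<bar> * exp \<bar>x\<bar>" for x :: real
proof (cases "x \<ge> 0")
  case True
  have "1 - x \<le> exp (- x)" using exp_ge_add_one_self[of "- x"] by simp
  then have "exp x * (1 - x) \<le> exp x * exp (- x)" by (intro mult_left_mono) auto
  then show ?thesis using True by (simp add: algebra_simps flip: exp_add)
next
  case False
  have "1 - exp x \<le> - x" using exp_ge_add_one_self[of x] by linarith
  also have "- x \<le> - x * exp (- x)"
    using False by (simp add: mult_le_cancel_left1)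
  finally show ?thesis using False by simp
qed

definition small :: "real \<Rightarrow> (nat \<Rightarrow> real) \<Rightarrow> bool" where
  "small \<delta> s \<longleftrightarrow> (\<forall>j<3. \<bar>s j\<bar> < \<delta>)"

lemma small_upd: "small \<delta> s \<Longrightarrow> \<bar>t\<bar> < \<delta> \<Longrightarrow> small \<delta> (s(j := t))"
  by (simp add: small_def)

lemma small_abs: "small \<delta> s \<Longrightarrow> j < 3 \<Longrightarrow> \<bar>s j\<bar> < \<delta>"
  by (simp add: small_def)

text \<open>Derivatives are local, and the formulas below are available only on the cube
  \<open>small \<delta>\<close>, outside of which exponential moments may be infinite.\<close>

lemma derivative_transfer_small:
  assumes s: "small \<delta> s" "j < 3" and eq: "\<And>s. small \<delta> s \<Longrightarrow> G s = K s"
    and G: "((\<lambda>t. G (s(j := t))) has_real_derivative d) (at (s j))"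
  shows "((\<lambda>t. K (s(j := t))) has_real_derivative d) (at (s j))"
proof (rule has_field_derivative_transform_within_open[OF G])
  show "open {- \<delta><..<\<delta>}" by simp
  show "s j \<in> {- \<delta><..<\<delta>}" using small_abs[OF s] by auto
  show "G (s(j := t)) = K (s(j := t))" if "t \<in> {- \<delta><..<\<delta>}" for t
    by (rule eq, rule small_upd[OF s(1)]) (use that in auto)
qed

lemma partial_deriv_small:
  assumes "small \<delta> s" "j < 3" "\<And>s. small \<delta> s \<Longrightarrow> H s = G s"
    and "((\<lambda>t. G (s(j := t))) has_real_derivative d) (at (s j))"
  shows "partial_deriv j H s = d"
  unfolding partial_deriv_def
  by (rule DERIV_imp_deriv, rule derivative_transfer_small[where G = G]) (use assms in auto)

text \<open>The measure may have infinite mass, as \<open>M \<Otimes>\<^sub>M lborel\<close> does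
  below. Hence the integrability assumption carries a factor \<open>W\<close>, and
  \<open>exp\<close> without a prefactor never occurs except as \<open>exp - 1\<close>.\<close>

locale exponential_family =
  fixes \<mu> :: "'a measure" and X :: "nat \<Rightarrow> 'a \<Rightarrow> real" and W :: "'a \<Rightarrow> real" and c :: real
  assumes X_measurable: "\<And>j. j < 3 \<Longrightarrow> X j \<in> borel_measurable \<mu>"
    and W_measurable [measurable]: "W \<in> borel_measurable \<mu>"
    and c_pos: "0 < c"
    and X_le_W: "\<And>j w. j < 3 \<Longrightarrow> w \<in> space \<mu> \<Longrightarrow> \<bar>X j w\<bar> \<le> W w"
    and integrable_W: "integrable \<mu> (\<lambda>w. W w * exp (c * W w))"
begin

definition lin :: "(nat \<Rightarrow> real) \<Rightarrow> 'a \<Rightarrow> real" where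
  "lin s w = (\<Sum>j<3. s j * X j w)"

lemma lin_measurable [measurable]: "lin s \<in> borel_measurable \<mu>"
  unfolding lin_def by (intro borel_measurable_sum borel_measurable_times X_measurable) auto

lemma W_nonneg: "w \<in> space \<mu> \<Longrightarrow> 0 \<le> W w"
  using X_le_W[of 0 w] by simp

lemma lin_upd: "j < 3 \<Longrightarrow> lin (s(j := t)) w = lin s w + (t - s j) * X j w"
proof -
  assume j: "j < 3"
  have "lin (s(j := t)) w = (\<Sum>i<3. s i * X i w + (if i = j then (t - s j) * X j w else 0))"
    unfolding lin_def by (intro sum.cong) (auto simp: algebra_simps)
  also have "\<dots> = lin s w + (t - s j) * X j w"
    using j by (simp add: sum.distrib lin_def)
  finally show ?thesis .
qed

text \<open>The radius \<open>c / 6\<close> leaves room: three coordinates use up at most half of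
  the rate \<open>c\<close>, and the other half absorbs the powers of \<open>W\<close> that
  differentiation produces.\<close>

lemma lin_bound:
  assumes "small (c / 6) s" "w \<in> space \<mu>"
  shows "\<bar>lin s w\<bar> \<le> c / 2 * W w"
proof -
  have "\<bar>lin s w\<bar> \<le> (\<Sum>j<3. \<bar>s j * X j w\<bar>)" unfolding lin_def by (rule sum_abs)
  also have "\<dots> \<le> (\<Sum>j<(3::nat). c / 6 * W w)"
    unfolding abs_mult
    using small_abs[OF assms(1)] X_le_W[OF _ assms(2)] c_pos
    by (intro sum_mono mult_mono) (auto intro: less_imp_le)
  finally show ?thesis by simp
qed

text \<open>A majorant of \<open>A * W ^ Suc k * exp (c / 2 * W)\<close>: one factor
  \<open>W\<close> is kept for integrability, and the other \<open>k\<close> are absorbed by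
  \<open>power_le_exp\<close> at the rate \<open>c / 2\<close>.\<close>

definition dom :: "real \<Rightarrow> nat \<Rightarrow> 'a \<Rightarrow> real" where
  "dom A k w = A * (real k / (c / 2)) ^ k * (W w * exp (c * W w))"

lemma integrable_dom: "integrable \<mu> (dom A k)"
  unfolding dom_def[abs_def] by (intro integrable_mult_right integrable_W)

lemma exp_lin_bound:
  assumes s: "small (c / 6) s" and w: "w \<in> space \<mu>" and Y: "\<bar>y\<bar> \<le> A * W w ^ Suc k"
  shows "\<bar>y * exp (lin s w)\<bar> \<le> dom A k w"
proof (cases "A \<ge> 0")
  case True
  have W: "0 \<le> W w" by (rule W_nonneg[OF w])
  have "\<bar>y * exp (lin s w)\<bar> \<le> (A * W w ^ Suc k) * exp (c / 2 * W w)"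
    unfolding abs_mult
    using lin_bound[OF s w] Y by (intro mult_mono) auto
  also have "\<dots> = A * W w * W w ^ k * exp (c / 2 * W w)" by simp
  also have "\<dots> \<le> A * W w * ((real k / (c / 2)) ^ k * exp (c / 2 * W w)) * exp (c / 2 * W w)"
    using W True c_pos by (intro mult_right_mono mult_left_mono power_le_exp) auto
  also have "\<dots> = dom A k w"
    by (simp add: dom_def mult_ac flip: exp_add)
  finally show ?thesis .
next
  case False
  \<comment> \<open>A negative \<open>A\<close> is possible only where \<open>y\<close> and
    \<open>W w\<close> both vanish, and there both sides are \<open>0\<close>.\<close>
  then have "A * W w ^ Suc k \<le> 0" using W_nonneg[OF w] by (intro mult_nonpos_nonneg) auto
  then have "y = 0" "A * W w ^ Suc k = 0" using Y abs_ge_zero[of y] by linarith+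
  then have "W w = 0" using False by auto
  then show ?thesis using \<open>y = 0\<close> by (simp add: dom_def)
qed

lemma integrable_exp_lin:
  assumes s: "small (c / 6) s" and Ym [measurable]: "Y \<in> borel_measurable \<mu>"
    and Y: "\<And>w. w \<in> space \<mu> \<Longrightarrow> \<bar>Y w\<bar> \<le> A * W w ^ Suc k"
  shows "integrable \<mu> (\<lambda>w. Y w * exp (lin s w))"
  by (rule Bochner_Integration.integrable_bound[OF integrable_dom[of A k]])
    (use exp_lin_bound[OF s _ Y] in \<open>auto intro!: AE_I2 order_trans[OF _ abs_ge_self]\<close>)

lemma integrable_exp_lin_minus_1:
  assumes s: "small (c / 6) s"
  shows "integrable \<mu> (\<lambda>w. exp (lin s w) - 1)"
proof (rule Bochner_Integration.integrable_bound)
  show "integrable \<mu> (\<lambda>w. c / 2 * (W w * exp (c * W w)))"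
    by (intro integrable_mult_right integrable_W)
  show "AE w in \<mu>. norm (exp (lin s w) - 1) \<le> norm (c / 2 * (W w * exp (c * W w)))"
  proof (rule AE_I2)
    fix w assume w: "w \<in> space \<mu>"
    have "\<bar>exp (lin s w) - 1\<bar> \<le> (c / 2 * W w) * exp (c * W w)"
    proof (rule order_trans[OF abs_exp_minus_1_le], rule mult_mono)
      have "\<bar>lin s w\<bar> \<le> c * W w"
        using lin_bound[OF s w] W_nonneg[OF w] c_pos
        by (smt (verit) field_sum_of_halves mult_nonneg_nonneg mult_right_mono)
      then show "exp \<bar>lin s w\<bar> \<le> exp (c * W w)" by simp
    qed (use lin_bound[OF s w] W_nonneg[OF w] c_pos in auto)
    then show "norm (exp (lin s w) - 1) \<le> norm (c / 2 * (W w * exp (c * W w)))"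
      by simp
  qed
qed simp

text \<open>Each derivative multiplies the prefactor by one more variable and raises its order in
  \<open>W\<close> by one. A prefactor of any positive order is allowed, so the rule can be
  iterated.\<close>

lemma has_derivative_exp_lin:
  assumes s: "small (c / 6) s" and j: "j < 3" and Ym [measurable]: "Y \<in> borel_measurable \<mu>"
    and Y: "\<And>w. w \<in> space \<mu> \<Longrightarrow> \<bar>Y w\<bar> \<le> A * W w ^ Suc k"
  shows "((\<lambda>t. LINT w|\<mu>. Y w * exp (lin (s(j := t)) w)) has_real_derivative
    (LINT w|\<mu>. Y w * X j w * exp (lin s w))) (at (s j))"
proof -
  note [measurable] = X_measurable[OF j]
  have YX: "\<bar>Y w * X j w\<bar> \<le> A * W w ^ Suc (Suc k)" if "w \<in> space \<mu>" for w
    using mult_mono[OF Y[OF that] X_le_W[OF j that]] W_nonneg[OF that] Y[OF that]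
    by (simp add: abs_mult mult_ac)
  have "((\<lambda>t. LINT w|\<mu>. Y w * exp (lin (s(j := t)) w)) has_real_derivative
    (LINT w|\<mu>. Y w * X j w * exp (lin (s(j := s j)) w))) (at (s j))"
  proof (rule has_real_derivative_integral[where a = "- (c / 6)" and b = "c / 6" and D = "dom A (Suc k)"])
    show "s j \<in> {- (c / 6)<..<c / 6}" using small_abs[OF s j] by auto
    fix t assume t: "t \<in> {- (c / 6)<..<c / 6}"
    then have s': "small (c / 6) (s(j := t))" by (intro small_upd[OF s]) auto
    show "integrable \<mu> (\<lambda>w. Y w * exp (lin (s(j := t)) w))"
      using s' Ym Y by (rule integrable_exp_lin)
    show "((\<lambda>t. Y w * exp (lin (s(j := t)) w)) has_real_derivative Y w * X j w * exp (lin (s(j := t)) w)) (at t)" for w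
      unfolding lin_upd[OF j] by (auto intro!: derivative_eq_intros)
    show "\<bar>Y w * X j w * exp (lin (s(j := t)) w)\<bar> \<le> dom A (Suc k) w" if "w \<in> space \<mu>" for w
      by (rule exp_lin_bound[OF s' that YX[OF that]])
  qed (use integrable_dom in auto)
  then show ?thesis by simp
qed

text \<open>The start of the iteration: the prefactor \<open>1\<close> is not controlled by a
  positive power of \<open>W\<close>, so the constant has to be subtracted before
  integrating.\<close>

lemma has_derivative_exp_lin_minus_1:
  assumes s: "small (c / 6) s" and j: "j < 3"
  shows "((\<lambda>t. LINT w|\<mu>. exp (lin (s(j := t)) w) - 1) has_real_derivative
    (LINT w|\<mu>. X j w * exp (lin s w))) (at (s j))"
proof -
  note [measurable] = X_measurable[OF j]
  have "((\<lambda>t. LINT w|\<mu>. exp (lin (s(j := t)) w) - 1) has_real_derivative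
    (LINT w|\<mu>. X j w * exp (lin (s(j := s j)) w))) (at (s j))"
  proof (rule has_real_derivative_integral[where a = "- (c / 6)" and b = "c / 6" and D = "dom 1 0"])
    show "s j \<in> {- (c / 6)<..<c / 6}" using small_abs[OF s j] by auto
    fix t assume t: "t \<in> {- (c / 6)<..<c / 6}"
    then have s': "small (c / 6) (s(j := t))" by (intro small_upd[OF s]) auto
    show "integrable \<mu> (\<lambda>w. exp (lin (s(j := t)) w) - 1)"
      using s' by (rule integrable_exp_lin_minus_1)
    show "((\<lambda>t. exp (lin (s(j := t)) w) - 1) has_real_derivative X j w * exp (lin (s(j := t)) w)) (at t)" for w
      unfolding lin_upd[OF j] by (auto intro!: derivative_eq_intros)
    show "\<bar>X j w * exp (lin (s(j := t)) w)\<bar> \<le> dom 1 0 w" if "w \<in> space \<mu>" for w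
      by (rule exp_lin_bound[OF s' that]) (use X_le_W[OF j that] in simp)
  qed (use integrable_dom in auto)
  then show ?thesis by simp
qed

lemma X_bound1: "j < 3 \<Longrightarrow> w \<in> space \<mu> \<Longrightarrow> \<bar>X j w\<bar> \<le> 1 * W w ^ Suc 0"
  using X_le_W by simp

lemma X_bound2: "j < 3 \<Longrightarrow> k < 3 \<Longrightarrow> w \<in> space \<mu> \<Longrightarrow> \<bar>X j w * X k w\<bar> \<le> 1 * W w ^ Suc 1"
  using mult_mono[OF X_le_W[of j w] X_le_W[of k w]] W_nonneg[of w] by (simp add: abs_mult)

lemma has_derivative_exp_lin_1:
  assumes "small (c / 6) s" "j < 3" "k < 3"
  shows "((\<lambda>t. LINT w|\<mu>. X k w * exp (lin (s(j := t)) w)) has_real_derivative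
    (LINT w|\<mu>. X k w * X j w * exp (lin s w))) (at (s j))"
  using assms(1,2)
  by (rule has_derivative_exp_lin[OF _ _ _ X_bound1]) (use X_measurable assms in auto)

lemma has_derivative_exp_lin_2:
  assumes "small (c / 6) s" "j < 3" "k < 3" "l < 3"
  shows "((\<lambda>t. LINT w|\<mu>. X k w * X l w * exp (lin (s(j := t)) w)) has_real_derivative
    (LINT w|\<mu>. X k w * X l w * X j w * exp (lin s w))) (at (s j))"
  using assms(1,2)
  by (rule has_derivative_exp_lin[OF _ _ _ X_bound2]) (use X_measurable assms in auto)

lemma small_0: "small (c / 6) (\<lambda>_. 0)"
  using c_pos by (simp add: small_def)

lemma lin_0: "lin (\<lambda>_. 0) w = 0"
  by (simp add: lin_def)

text \<open>No logarithm is left in \<open>H\<close>, so its third mixed derivative at the origin is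
  a plain third moment without correction terms.\<close>

lemma mixed_partial_3:
  assumes H: "\<And>s. small (c / 6) s \<Longrightarrow> H s = a * (LINT w|\<mu>. exp (lin s w) - 1)"
  shows "mixed_partial 3 H (\<lambda>_. 0) = a * (LINT w|\<mu>. (\<Prod>j<3. X j w))"
proof -
  \<comment> \<open>\<open>mixed_partial\<close> differentiates by the last coordinate first. Each
    formula is shown on the whole cube because the next derivative needs it in a
    neighbourhood.\<close>
  have 1: "partial_deriv 2 H s = a * (LINT w|\<mu>. X 2 w * exp (lin s w))" if s: "small (c / 6) s" for s
    by (rule partial_deriv_small[OF s _ H]) (auto intro!: DERIV_cmult has_derivative_exp_lin_minus_1 s)
  have 2: "partial_deriv 1 (partial_deriv 2 H) s = a * (LINT w|\<mu>. X 2 w * X 1 w * exp (lin s w))"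
    if s: "small (c / 6) s" for s
    by (rule partial_deriv_small[OF s _ 1]) (auto intro!: DERIV_cmult has_derivative_exp_lin_1 s)
  have 3: "partial_deriv 0 (partial_deriv 1 (partial_deriv 2 H)) s = a * (LINT w|\<mu>. X 2 w * X 1 w * X 0 w * exp (lin s w))"
    if s: "small (c / 6) s" for s
    by (rule partial_deriv_small[OF s _ 2]) (auto intro!: DERIV_cmult has_derivative_exp_lin_2 s)
  have "mixed_partial 3 H = partial_deriv 0 (partial_deriv 1 (partial_deriv 2 H))"
    by (simp add: numeral_3_eq_3 numeral_2_eq_2)
  then show ?thesis
    using 3[OF small_0] by (simp add: lin_0 numeral_3_eq_3 lessThan_Suc mult_ac numeral_2_eq_2)
qed

end

text \<open>The passage from cumulants to moments. Write the relation as \<open>F = exp G\<close> on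
  the cube. The first derivative gives \<open>P1 i = F * (a i + Q1 i)\<close>; differentiating this
  product twice more gives the higher identities, where the linear part of \<open>G\<close> no
  longer contributes to its derivatives. Both sides of each step are derivatives of the same
  function, so uniqueness of derivatives equates them.\<close>

lemma moments_of_exponential_relation:
  fixes a :: "nat \<Rightarrow> real"
  assumes M: "prob_space M" and P: "exponential_family M X W c" and Q: "exponential_family \<mu> Y V c"
    and rel: "\<And>s. small (c / 6) s \<Longrightarrow>
      1 + (LINT w|M. exp (\<Sum>j<3. s j * X j w) - 1)
        = exp ((\<Sum>j<3. s j * a j) + (LINT w|\<mu>. exp (\<Sum>j<3. s j * Y j w) - 1))"
  shows "i < 3 \<Longrightarrow> (LINT w|M. X i w) = a i + (LINT w|\<mu>. Y i w)" (is "_ \<Longrightarrow> ?first")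
    and "i < 3 \<Longrightarrow> j < 3 \<Longrightarrow> (LINT w|M. X i w * X j w)
      = (LINT w|M. X i w) * (LINT w|M. X j w) + (LINT w|\<mu>. Y i w * Y j w)" (is "_ \<Longrightarrow> _ \<Longrightarrow> ?second")
    and "i < 3 \<Longrightarrow> j < 3 \<Longrightarrow> k < 3 \<Longrightarrow> (LINT w|M. X i w * X j w * X k w)
      = (LINT w|M. X i w) * (LINT w|M. X j w) * (LINT w|M. X k w)
        + (LINT w|M. X i w) * (LINT w|\<mu>. Y j w * Y k w)
        + (LINT w|M. X j w) * (LINT w|\<mu>. Y i w * Y k w)
        + (LINT w|M. X k w) * (LINT w|\<mu>. Y i w * Y j w)
        + (LINT w|\<mu>. Y i w * Y j w * Y k w)" (is "_ \<Longrightarrow> _ \<Longrightarrow> _ \<Longrightarrow> ?third")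
proof -
  interpret M: prob_space M by fact
  interpret P: exponential_family M X W c by fact
  interpret Q: exponential_family \<mu> Y V c by fact
  define F where "F s = 1 + (LINT w|M. exp (P.lin s w) - 1)" for s
  define G where "G s = (\<Sum>j<3. s j * a j) + (LINT w|\<mu>. exp (Q.lin s w) - 1)" for s
  have FG: "F s = exp (G s)" if "small (c / 6) s" for s
    using rel[OF that] by (simp add: F_def G_def P.lin_def Q.lin_def)
  define P1 where "P1 i s = (LINT w|M. X i w * exp (P.lin s w))" for i s
  define P2 where "P2 i j s = (LINT w|M. X i w * X j w * exp (P.lin s w))" for i j s
  define P3 where "P3 i j k s = (LINT w|M. X i w * X j w * X k w * exp (P.lin s w))" for i j k s
  define Q1 where "Q1 i s = (LINT w|\<mu>. Y i w * exp (Q.lin s w))" for i s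
  define Q2 where "Q2 i j s = (LINT w|\<mu>. Y i w * Y j w * exp (Q.lin s w))" for i j s
  define Q3 where "Q3 i j k s = (LINT w|\<mu>. Y i w * Y j w * Y k w * exp (Q.lin s w))" for i j k s
  have dF: "((\<lambda>t. F (s(i := t))) has_real_derivative P1 i s) (at (s i))"
    if "small (c / 6) s" "i < 3" for s i
    unfolding F_def P1_def using P.has_derivative_exp_lin_minus_1[OF that] by (auto intro!: derivative_eq_intros)
  have dP1: "((\<lambda>t. P1 i (s(j := t))) has_real_derivative P2 i j s) (at (s j))"
    if "small (c / 6) s" "i < 3" "j < 3" for s i j
    unfolding P1_def P2_def using that by (intro P.has_derivative_exp_lin_1)
  have dP2: "((\<lambda>t. P2 i j (s(k := t))) has_real_derivative P3 i j k s) (at (s k))"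
    if "small (c / 6) s" "i < 3" "j < 3" "k < 3" for s i j k
    unfolding P2_def P3_def using that by (intro P.has_derivative_exp_lin_2)
  have dG: "((\<lambda>t. G (s(i := t))) has_real_derivative a i + Q1 i s) (at (s i))"
    if "small (c / 6) s" "i < 3" for s i
  proof -
    have "(\<Sum>j<3. (s(i := t)) j * a j) = (\<Sum>j<3. s j * a j) + (t - s i) * a i" for t
    proof -
      have "(\<Sum>j<3. (s(i := t)) j * a j) = (\<Sum>j<3. s j * a j + (if j = i then (t - s i) * a i else 0))"
        by (intro sum.cong) (auto simp: algebra_simps)
      then show ?thesis using that by (simp add: sum.distrib)
    qed
    then show ?thesis
      unfolding G_def Q1_def using Q.has_derivative_exp_lin_minus_1[OF that]
      by (auto intro!: derivative_eq_intros)
  qed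
  have dQ1: "((\<lambda>t. Q1 i (s(j := t))) has_real_derivative Q2 i j s) (at (s j))"
    if "small (c / 6) s" "i < 3" "j < 3" for s i j
    unfolding Q1_def Q2_def using that by (intro Q.has_derivative_exp_lin_1)
  have dQ2: "((\<lambda>t. Q2 i j (s(k := t))) has_real_derivative Q3 i j k s) (at (s k))"
    if "small (c / 6) s" "i < 3" "j < 3" "k < 3" for s i j k
    unfolding Q2_def Q3_def using that by (intro Q.has_derivative_exp_lin_2)
  have 1: "P1 i s = F s * (a i + Q1 i s)" if s: "small (c / 6) s" and i: "i < 3" for s i
  proof (rule DERIV_unique)
    show "((\<lambda>t. F (s(i := t))) has_real_derivative P1 i s) (at (s i))" by (rule dF[OF s i])
    show "((\<lambda>t. F (s(i := t))) has_real_derivative F s * (a i + Q1 i s)) (at (s i))"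
    proof (rule derivative_transfer_small[OF s i, where G = "\<lambda>s. exp (G s)"])
      show "((\<lambda>t. exp (G (s(i := t)))) has_real_derivative F s * (a i + Q1 i s)) (at (s i))"
        using dG[OF s i] by (auto intro!: derivative_eq_intros simp: FG[OF s])
    qed (simp add: FG)
  qed
  have 2: "P2 i j s = P1 j s * (a i + Q1 i s) + F s * Q2 i j s"
    if s: "small (c / 6) s" and i: "i < 3" and j: "j < 3" for s i j
  proof (rule DERIV_unique)
    show "((\<lambda>t. P1 i (s(j := t))) has_real_derivative P2 i j s) (at (s j))" by (rule dP1[OF s i j])
    show "((\<lambda>t. P1 i (s(j := t))) has_real_derivative P1 j s * (a i + Q1 i s) + F s * Q2 i j s) (at (s j))"
    proof (rule derivative_transfer_small[OF s j, where G = "\<lambda>s. F s * (a i + Q1 i s)"])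
      show "((\<lambda>t. F (s(j := t)) * (a i + Q1 i (s(j := t)))) has_real_derivative
          P1 j s * (a i + Q1 i s) + F s * Q2 i j s) (at (s j))"
        using dF[OF s j] dQ1[OF s i j] by (auto intro!: derivative_eq_intros)
    qed (simp add: 1 i)
  qed
  have 3: "P3 i j k s = P2 j k s * (a i + Q1 i s) + P1 j s * Q2 i k s + P1 k s * Q2 i j s + F s * Q3 i j k s"
    if s: "small (c / 6) s" and i: "i < 3" and j: "j < 3" and k: "k < 3" for s i j k
  proof (rule DERIV_unique)
    show "((\<lambda>t. P2 i j (s(k := t))) has_real_derivative P3 i j k s) (at (s k))" by (rule dP2[OF s i j k])
    show "((\<lambda>t. P2 i j (s(k := t))) has_real_derivative
        P2 j k s * (a i + Q1 i s) + P1 j s * Q2 i k s + P1 k s * Q2 i j s + F s * Q3 i j k s) (at (s k))"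
    proof (rule derivative_transfer_small[OF s k, where G = "\<lambda>s. P1 j s * (a i + Q1 i s) + F s * Q2 i j s"])
      show "((\<lambda>t. P1 j (s(k := t)) * (a i + Q1 i (s(k := t))) + F (s(k := t)) * Q2 i j (s(k := t))) has_real_derivative
          P2 j k s * (a i + Q1 i s) + P1 j s * Q2 i k s + P1 k s * Q2 i j s + F s * Q3 i j k s) (at (s k))"
        using dF[OF s k] dP1[OF s j k] dQ1[OF s i k] dQ2[OF s i j k]
        by (auto intro!: derivative_eq_intros)
    qed (simp add: 2 i j)
  qed
  let ?z = "\<lambda>_ :: nat. 0 :: real"
  \<comment> \<open>At the origin the first identity replaces \<open>a i + Q1 i\<close> by the first
    moment of \<open>X i\<close>, which removes \<open>a\<close> from the second and third
    identities.\<close>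
  have F0: "F ?z = 1" by (simp add: F_def P.lin_0)
  have E1: "a i + Q1 i ?z = P1 i ?z" if "i < 3" for i using 1[OF P.small_0 that] F0 by simp
  note E2 = 2[OF P.small_0]
  have S: "Q2 i j ?z = Q2 j i ?z" for i j by (simp add: Q2_def mult_ac)
  show "i < 3 \<Longrightarrow> ?first"
    using E1[of i] by (simp add: P1_def Q1_def P.lin_0 Q.lin_0)
  show "i < 3 \<Longrightarrow> j < 3 \<Longrightarrow> ?second"
    using E2[of i j] E1[of i] F0 by (simp add: P1_def P2_def Q2_def P.lin_0 Q.lin_0 mult_ac)
  show "i < 3 \<Longrightarrow> j < 3 \<Longrightarrow> k < 3 \<Longrightarrow> ?third"
    using 3[OF P.small_0, of i j k] E1[of i] E1[of j] E2[of j k] F0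
    by (simp add: P1_def P2_def P3_def Q2_def Q3_def P.lin_0 Q.lin_0 algebra_simps)
qed

section \<open>Moments of a cluster\<close>

text \<open>Here \<open>R\<close> and \<open>C\<close> are the admissible real and complex
  functions. Splitting into real and imaginary part is assumed for the first argument only; the two
  symmetries bring each of the other arguments there in turn.\<close>

lemma trilinear_zero_complex:
  fixes T :: "(real \<Rightarrow> complex) \<Rightarrow> (real \<Rightarrow> complex) \<Rightarrow> (real \<Rightarrow> complex) \<Rightarrow> complex"
  assumes real: "\<And>a b c. R a \<Longrightarrow> R b \<Longrightarrow> R c \<Longrightarrow>
      T (\<lambda>x. of_real (a x)) (\<lambda>x. of_real (b x)) (\<lambda>x. of_real (c x)) = 0"
    and split: "\<And>f f' f''. C f \<Longrightarrow> C f' \<Longrightarrow> C f'' \<Longrightarrow>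
      T f f' f'' = T (\<lambda>x. of_real (Re (f x))) f' f'' + \<i> * T (\<lambda>x. of_real (Im (f x))) f' f''"
    and sym: "\<And>f f' f''. T f f' f'' = T f' f f''" "\<And>f f' f''. T f f' f'' = T f'' f' f"
    and RC: "\<And>a. R a \<Longrightarrow> C (\<lambda>x. of_real (a x))"
    and Re_Im: "\<And>f. C f \<Longrightarrow> R (\<lambda>x. Re (f x))" "\<And>f. C f \<Longrightarrow> R (\<lambda>x. Im (f x))"
    and C: "C f" "C f'" "C f''"
  shows "T f f' f'' = 0"
proof -
  have 1: "T f (\<lambda>x. of_real (b x)) (\<lambda>x. of_real (c x)) = 0" if "C f" "R b" "R c" for f b c
    using that by (subst split) (simp_all add: RC real Re_Im)
  have 2: "T f f' (\<lambda>x. of_real (c x)) = 0" if "C f" "C f'" "R c" for f f' c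
    using that by (subst sym(1), subst split) (simp_all add: RC 1 Re_Im sym(1)[of _ f])
  show ?thesis
    using C by (subst sym(2), subst split) (simp_all add: RC 2 Re_Im sym(2)[of _ f'])
qed

lemma cluster_sum_of_real: "cluster_sum (\<lambda>x. of_real (f x)) \<gamma> y = of_real (cluster_sum f \<gamma> y)"
  by (simp add: cluster_sum_def)

lemma cluster_sum_Re_Im:
  "cluster_sum f \<gamma> y = cluster_sum (\<lambda>x. of_real (Re (f x))) \<gamma> y + \<i> * cluster_sum (\<lambda>x. of_real (Im (f x))) \<gamma> y"
proof -
  have "(\<Sum>u | alive \<gamma> u. f (y + pos \<gamma> u))
      = (\<Sum>u | alive \<gamma> u. of_real (Re (f (y + pos \<gamma> u))) + \<i> * of_real (Im (f (y + pos \<gamma> u))))"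
    by (intro sum.cong refl complex_eq)
  then show ?thesis by (simp add: cluster_sum_def sum.distrib sum_distrib_left)
qed

lemma cluster_sum_linear:
  fixes f :: "nat \<Rightarrow> real \<Rightarrow> real"
  shows "cluster_sum (\<lambda>x. \<Sum>j<n. s j * f j x) \<gamma> y = (\<Sum>j<n. s j * cluster_sum (f j) \<gamma> y)"
  unfolding cluster_sum_def sum_distrib_left by (rule sum.swap)

definition bounded_measurable :: "(real \<Rightarrow> 'b::{real_normed_vector}) \<Rightarrow> bool" where
  "bounded_measurable f \<longleftrightarrow> f \<in> borel_measurable borel \<and> bounded (range f)"

lemma bounded_measurable_obtain:
  assumes "bounded_measurable f"
  obtains b where "0 < b" "\<And>x. norm (f x) \<le> b"
  using assms unfolding bounded_measurable_def bounded_pos by auto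

lemma bounded_measurable_of_real:
  "bounded_measurable a \<Longrightarrow> bounded_measurable (\<lambda>x. of_real (a x) :: complex)"
  by (auto simp: bounded_measurable_def bounded_iff)

lemma bounded_measurable_Re: "bounded_measurable f \<Longrightarrow> bounded_measurable (\<lambda>x. Re (f x))"
  unfolding bounded_measurable_def bounded_iff by (auto intro: order_trans[OF abs_Re_le_cmod])

lemma bounded_measurable_Im: "bounded_measurable f \<Longrightarrow> bounded_measurable (\<lambda>x. Im (f x))"
  unfolding bounded_measurable_def bounded_iff by (auto intro: order_trans[OF abs_Im_le_cmod])

lemma (in pair_sigma_finite) integral_snd':
  fixes f :: "_ \<Rightarrow> _::{banach, second_countable_topology}"
  assumes "integrable (M1 \<Otimes>\<^sub>M M2) f"
  shows "(LINT y|M2. (LINT x|M1. f (x, y))) = integral\<^sup>L (M1 \<Otimes>\<^sub>M M2) f"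
  using integral_snd[of "\<lambda>x y. f (x, y)"] assms by simp

locale branching_cluster = branching_parameters m h + prob_space M
  for m h and M :: "'w measure" +
  fixes g :: "'w \<Rightarrow> genealogy"
  assumes g: "branching_genealogy M m h g"
begin

lemma g_measurable [measurable]: "g \<in> measurable M genealogy_space"
  by (rule branching_genealogy_measurable[OF prob_space_axioms g])

abbreviation Z :: "'w \<Rightarrow> real" where "Z w \<equiv> real (cluster_size (g w))"

text \<open>The spare rate \<open>\<epsilon> - a\<close> absorbs the power.\<close>

lemma integrable_Z_power_exp:
  assumes "a < \<epsilon>"
  shows "integrable M (\<lambda>w. Z w ^ k * exp (a * Z w))"
proof (rule Bochner_Integration.integrable_bound)
  show "integrable M (\<lambda>w. (real k / (\<epsilon> - a)) ^ k * exp (\<epsilon> * Z w))"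
    by (intro integrable_mult_right integrable_exp_cluster_size[OF prob_space_axioms g])
  show "AE w in M. norm (Z w ^ k * exp (a * Z w)) \<le> norm ((real k / (\<epsilon> - a)) ^ k * exp (\<epsilon> * Z w))"
  proof (rule AE_I2)
    fix w
    have "Z w ^ k * exp (a * Z w) \<le> (real k / (\<epsilon> - a)) ^ k * exp ((\<epsilon> - a) * Z w) * exp (a * Z w)"
      using assms by (intro mult_right_mono power_le_exp) auto
    also have "\<dots> = (real k / (\<epsilon> - a)) ^ k * exp (\<epsilon> * Z w)"
      by (simp add: algebra_simps flip: exp_add)
    finally show "norm (Z w ^ k * exp (a * Z w)) \<le> norm ((real k / (\<epsilon> - a)) ^ k * exp (\<epsilon> * Z w))"
      using assms by simp
  qed
qed measurable

lemma integrable_Z_power: "integrable M (\<lambda>w. Z w ^ k)"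
  using integrable_Z_power_exp[of 0 k] \<epsilon>_pos by simp

lemma pair_sigma_finite_M:
  assumes "sigma_finite_measure L"
  shows "pair_sigma_finite M L"
  using assms sigma_finite_measure_axioms by (simp add: pair_sigma_finite_def)

text \<open>The second factor has finite mass \<open>m\<close>, so a bound that does not depend on
  \<open>y\<close> suffices, unlike over \<open>lborel\<close>.\<close>

lemma integrable_pair_\<Lambda>:
  fixes F :: "'w \<times> real \<Rightarrow> 'b::{banach, second_countable_topology}"
  assumes u: "integrable M u" and F [measurable]: "F \<in> borel_measurable (M \<Otimes>\<^sub>M \<Lambda>)"
    and le: "\<And>w y. norm (F (w, y)) \<le> u w"
  shows "integrable (M \<Otimes>\<^sub>M \<Lambda>) F"
proof (rule integrableI_bounded)
  have "(\<integral>\<^sup>+ z. norm (F z) \<partial>(M \<Otimes>\<^sub>M \<Lambda>)) = (\<integral>\<^sup>+ w. (\<integral>\<^sup>+ y. norm (F (w, y)) \<partial>\<Lambda>) \<partial>M)"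
    by (rule \<Lambda>.nn_integral_fst[symmetric]) measurable
  also have "\<dots> \<le> (\<integral>\<^sup>+ w. (\<integral>\<^sup>+ y. ennreal (u w) \<partial>\<Lambda>) \<partial>M)"
    by (intro nn_integral_mono ennreal_leI le)
  also have "\<dots> = ennreal m * (\<integral>\<^sup>+ w. ennreal (u w) \<partial>M)"
    using u by (simp add: emeasure_\<Lambda> mult.commute nn_integral_cmult)
  also have "\<dots> < \<infinity>"
  proof -
    have "0 \<le> u w" for w using le[of w] norm_ge_zero order_trans by blast
    then have "(\<integral>\<^sup>+ w. ennreal (u w) \<partial>M) = ennreal (LINT w|M. u w)"
      by (intro nn_integral_eq_integral u) auto
    then show ?thesis by (simp add: ennreal_mult_less_top)
  qed
  finally show "(\<integral>\<^sup>+ z. norm (F z) \<partial>(M \<Otimes>\<^sub>M \<Lambda>)) < \<infinity>" .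
qed fact

text \<open>A pair \<open>(w, y)\<close> stands for the cluster of \<open>w\<close> rooted at
  \<open>y\<close>. The position \<open>y\<close> is integrated against \<open>\<Lambda>\<close> for
  a child of the root, and against \<open>lborel\<close> for an immigrant.\<close>

abbreviation S :: "(real \<Rightarrow> 'b) \<Rightarrow> 'w \<times> real \<Rightarrow> 'b::{real_normed_vector, second_countable_topology}" where
  "S f z \<equiv> cluster_sum f (g (fst z)) (snd z)"

abbreviation S0 :: "(real \<Rightarrow> 'b) \<Rightarrow> 'w \<Rightarrow> 'b::{real_normed_vector, second_countable_topology}" where
  "S0 f w \<equiv> cluster_sum f (g w) 0"

lemma
  fixes f :: "nat \<Rightarrow> real \<Rightarrow> real"
  assumes f: "\<And>j. j < 3 \<Longrightarrow> bounded_measurable (f j)"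
  shows first_moment_real: "i < 3 \<Longrightarrow> (LINT w|M. S0 (f i) w) = f i 0 + (LINT z|(M \<Otimes>\<^sub>M \<Lambda>). S (f i) z)" (is "_ \<Longrightarrow> ?first")
    and second_moment_real: "i < 3 \<Longrightarrow> j < 3 \<Longrightarrow> (LINT w|M. S0 (f i) w * S0 (f j) w)
      = (LINT w|M. S0 (f i) w) * (LINT w|M. S0 (f j) w) + (LINT z|(M \<Otimes>\<^sub>M \<Lambda>). S (f i) z * S (f j) z)" (is "_ \<Longrightarrow> _ \<Longrightarrow> ?second")
    and third_moment_real: "i < 3 \<Longrightarrow> j < 3 \<Longrightarrow> k < 3 \<Longrightarrow> (LINT w|M. S0 (f i) w * S0 (f j) w * S0 (f k) w)
      = (LINT w|M. S0 (f i) w) * (LINT w|M. S0 (f j) w) * (LINT w|M. S0 (f k) w)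
        + (LINT w|M. S0 (f i) w) * (LINT z|(M \<Otimes>\<^sub>M \<Lambda>). S (f j) z * S (f k) z)
        + (LINT w|M. S0 (f j) w) * (LINT z|(M \<Otimes>\<^sub>M \<Lambda>). S (f i) z * S (f k) z)
        + (LINT w|M. S0 (f k) w) * (LINT z|(M \<Otimes>\<^sub>M \<Lambda>). S (f i) z * S (f j) z)
        + (LINT z|(M \<Otimes>\<^sub>M \<Lambda>). S (f i) z * S (f j) z * S (f k) z)" (is "_ \<Longrightarrow> _ \<Longrightarrow> _ \<Longrightarrow> ?third")
proof -
  have fm [measurable]: "f j \<in> borel_measurable borel" if "j < 3" for j
    using f[OF that] by (simp add: bounded_measurable_def)
  have "\<exists>b. 0 < b \<and> (\<forall>x. \<bar>f j x\<bar> \<le> b)" if "j < 3" for j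
    using bounded_measurable_obtain[OF f[OF that]] by (metis real_norm_def)
  then obtain b' where b': "\<And>j. j < 3 \<Longrightarrow> 0 < b' j" "\<And>j x. j < 3 \<Longrightarrow> \<bar>f j x\<bar> \<le> b' j" by metis
  define b where "b = (\<Sum>j<(3::nat). b' j)"
  have b'_le: "b' j \<le> b" if "j < 3" for j
    unfolding b_def using that b'(1) by (intro member_le_sum) (auto intro: less_imp_le)
  have b: "0 < b" "\<bar>f j x\<bar> \<le> b" if "j < 3" for j x
    using b'_le[OF that] b'(1)[OF that] b'(2)[OF that, of x] by auto
  have b0: "0 < b" using b(1)[of 0] by simp
  \<comment> \<open>Then \<open>c * (b * Z w)\<close> is \<open>\<epsilon> / 2 * Z w\<close>,
    strictly below the integrable rate \<open>\<epsilon>\<close>; the gap pays for the factor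
    \<open>b * Z w\<close>. For small \<open>s\<close> the combined function is bounded by
    \<open>3 * (c / 6) * b = \<epsilon> / 4\<close>, within reach of the fixed-point
    equation.\<close>
  define c where "c = \<epsilon> / (2 * b)"
  have c: "0 < c" "c * b = \<epsilon> / 2" using \<epsilon>_pos b0 by (auto simp: c_def)
  have u: "integrable M (\<lambda>w. b * Z w * exp (c * (b * Z w)))"
  proof -
    have "integrable M (\<lambda>w. b * (Z w ^ 1 * exp (\<epsilon> / 2 * Z w)))"
      using \<epsilon>_pos by (intro integrable_mult_right integrable_Z_power_exp) auto
    then show ?thesis by (simp add: mult.assoc[symmetric] c(2))
  qed
  have le: "\<bar>cluster_sum (f j) (g w) y\<bar> \<le> b * Z w" if "j < 3" for j w y
    using norm_cluster_sum_le_size[of "f j" b] b(2)[OF that] by simp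
  have P: "exponential_family M (\<lambda>j. S0 (f j)) (\<lambda>w. b * Z w) c"
    by unfold_locales (use fm c u le in auto)
  have Q: "exponential_family (M \<Otimes>\<^sub>M \<Lambda>) (\<lambda>j. S (f j)) (\<lambda>z. b * Z (fst z)) c"
  proof
    show "integrable (M \<Otimes>\<^sub>M \<Lambda>) (\<lambda>z. b * Z (fst z) * exp (c * (b * Z (fst z))))"
      by (rule integrable_pair_\<Lambda>[OF u]) (use b0 in auto)
  qed (use fm c le in auto)
  interpret P: exponential_family M "\<lambda>j. S0 (f j)" "\<lambda>w. b * Z w" c by (rule P)
  interpret Q: exponential_family "M \<Otimes>\<^sub>M \<Lambda>" "\<lambda>j. S (f j)" "\<lambda>z. b * Z (fst z)" c by (rule Q)
  interpret pair_sigma_finite M \<Lambda> by (rule pair_sigma_finite_M) unfold_locales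
  have rel: "1 + (LINT w|M. exp (\<Sum>j<3. s j * S0 (f j) w) - 1)
        = exp ((\<Sum>j<3. s j * f j 0) + (LINT z|(M \<Otimes>\<^sub>M \<Lambda>). exp (\<Sum>j<3. s j * S (f j) z) - 1))"
    if s: "small (c / 6) s" for s
  proof -
    let ?f = "\<lambda>x. \<Sum>j<3. s j * f j x"
    have [measurable]: "?f \<in> borel_measurable borel"
      by (intro borel_measurable_sum borel_measurable_times fm) auto
    have f_le: "\<bar>?f x\<bar> \<le> \<epsilon>" for x
    proof -
      have "\<bar>?f x\<bar> \<le> (\<Sum>j<(3::nat). c / 6 * b)"
        by (rule order_trans[OF sum_abs], unfold abs_mult, intro sum_mono mult_mono)
          (use small_abs[OF s] b c in \<open>auto intro: less_imp_le\<close>)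
      then show ?thesis using c \<epsilon>_pos by simp
    qed
    have int: "integrable M (\<lambda>w. exp (cluster_sum ?f (g w) x))" for x
      by (rule integrable_exp_cluster_sum[OF prob_space_axioms g _ f_le]) measurable
    have "1 + (LINT w|M. exp (S0 ?f w) - 1) = (LINT w|M. exp (S0 ?f w))"
      using int by (simp add: prob_space)
    also have "\<dots> = exp (?f 0 + (LINT y|\<Lambda>. ((LINT w|M. exp (cluster_sum ?f (g w) (0 + y))) - 1)))"
      by (rule exp_cluster_sum_fixpoint[OF prob_space_axioms g _ f_le]) measurable
    also have "(LINT y|\<Lambda>. ((LINT w|M. exp (cluster_sum ?f (g w) (0 + y))) - 1))
        = (LINT y|\<Lambda>. (LINT w|M. exp (cluster_sum ?f (g w) y) - 1))"
      using int by (simp add: prob_space)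
    also have "\<dots> = (LINT z|(M \<Otimes>\<^sub>M \<Lambda>). exp (S ?f z) - 1)"
      using integral_snd'[OF Q.integrable_exp_lin_minus_1[OF s], unfolded Q.lin_def]
      by (simp add: cluster_sum_linear split_beta)
    finally show ?thesis by (simp add: cluster_sum_linear)
  qed
  note rels = moments_of_exponential_relation[OF prob_space_axioms P Q rel]
  show "i < 3 \<Longrightarrow> ?first" by (rule rels(1))
  show "i < 3 \<Longrightarrow> j < 3 \<Longrightarrow> ?second" by (rule rels(2))
  show "i < 3 \<Longrightarrow> j < 3 \<Longrightarrow> k < 3 \<Longrightarrow> ?third" by (rule rels(3))
qed

lemma
  fixes f :: "real \<Rightarrow> complex"
  assumes f: "bounded_measurable f"
  shows S_measurable: "S f \<in> borel_measurable (M \<Otimes>\<^sub>M \<Lambda>)"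
    and S0_measurable: "S0 f \<in> borel_measurable M"
proof -
  have [measurable]: "f \<in> borel_measurable borel" using f by (simp add: bounded_measurable_def)
  show "S f \<in> borel_measurable (M \<Otimes>\<^sub>M \<Lambda>)" "S0 f \<in> borel_measurable M" by measurable
qed

lemma integrable_S_prod:
  fixes f f' f'' :: "real \<Rightarrow> complex"
  assumes "bounded_measurable f" "bounded_measurable f'" "bounded_measurable f''"
  shows "integrable (M \<Otimes>\<^sub>M \<Lambda>) (\<lambda>z. S f z)" (is ?i1)
    and "integrable (M \<Otimes>\<^sub>M \<Lambda>) (\<lambda>z. S f z * S f' z)" (is ?i2)
    and "integrable (M \<Otimes>\<^sub>M \<Lambda>) (\<lambda>z. S f z * S f' z * S f'' z)" (is ?i3)
    and "integrable M (S0 f)" (is ?i4)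
    and "integrable M (\<lambda>w. S0 f w * S0 f' w)" (is ?i5)
    and "integrable M (\<lambda>w. S0 f w * S0 f' w * S0 f'' w)" (is ?i6)
proof -
  note [measurable] = assms[THEN S_measurable] assms[THEN S0_measurable]
  obtain b where b: "0 < b" "\<And>x. norm (f x) \<le> b" using bounded_measurable_obtain[OF assms(1)] by blast
  obtain b' where b': "0 < b'" "\<And>x. norm (f' x) \<le> b'" using bounded_measurable_obtain[OF assms(2)] by blast
  obtain b'' where b'': "0 < b''" "\<And>x. norm (f'' x) \<le> b''" using bounded_measurable_obtain[OF assms(3)] by blast
  have 1: "norm (cluster_sum f (g w) y) \<le> b * Z w ^ 1" for w y
    using norm_cluster_sum_le_size[of f, OF b(2)] by simp
  have 2: "norm (cluster_sum f (g w) y * cluster_sum f' (g w) y) \<le> b * b' * Z w ^ 2" for w y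
    using mult_mono[OF 1[of w y] norm_cluster_sum_le_size[of f' _ "g w" y, OF b'(2)]] b(1)
    by (simp add: norm_mult power2_eq_square mult_ac)
  have 3: "norm (cluster_sum f (g w) y * cluster_sum f' (g w) y * cluster_sum f'' (g w) y) \<le> b * b' * b'' * Z w ^ 3" for w y
    using mult_mono[OF 2[of w y] norm_cluster_sum_le_size[of f'' _ "g w" y, OF b''(2)]] b(1) b'(1)
    by (simp add: norm_mult power3_eq_cube power2_eq_square mult_ac)
  have u: "integrable M (\<lambda>w. a * Z w ^ k)" for a k
    by (intro integrable_mult_right integrable_Z_power)
  show ?i1
    by (rule integrable_pair_\<Lambda>[OF u[of b 1]]) (use 1 in auto)
  show ?i2
    by (rule integrable_pair_\<Lambda>[OF u[of "b * b'" 2]]) (use 2 in auto)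
  show ?i3
    by (rule integrable_pair_\<Lambda>[OF u[of "b * b' * b''" 3]]) (use 3 in auto)
  show ?i4
    by (rule Bochner_Integration.integrable_bound[OF u[of b 1]]) (use 1 in \<open>auto intro!: AE_I2 order_trans[OF _ abs_ge_self]\<close>)
  show ?i5
    by (rule Bochner_Integration.integrable_bound[OF u[of "b * b'" 2]]) (use 2 in \<open>auto intro!: AE_I2 order_trans[OF _ abs_ge_self]\<close>)
  show ?i6
    by (rule Bochner_Integration.integrable_bound[OF u[of "b * b' * b''" 3]]) (use 3 in \<open>auto intro!: AE_I2 order_trans[OF _ abs_ge_self]\<close>)
qed

definition E1 :: "(real \<Rightarrow> complex) \<Rightarrow> complex" where
  "E1 f = (LINT w|M. S0 f w)"

definition E2 :: "(real \<Rightarrow> complex) \<Rightarrow> (real \<Rightarrow> complex) \<Rightarrow> complex" where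
  "E2 f f' = (LINT w|M. S0 f w * S0 f' w)"

definition E3 :: "(real \<Rightarrow> complex) \<Rightarrow> (real \<Rightarrow> complex) \<Rightarrow> (real \<Rightarrow> complex) \<Rightarrow> complex" where
  "E3 f f' f'' = (LINT w|M. S0 f w * S0 f' w * S0 f'' w)"

text \<open>The fixed-point equation exhibits \<open>f 0 + L1 f\<close>, \<open>L2\<close> and
  \<open>L3\<close> as the first three joint cumulants of the cluster sums \<open>S0\<close>,
  extended to complex functions.\<close>

definition L1 :: "(real \<Rightarrow> complex) \<Rightarrow> complex" where
  "L1 f = (LINT z|(M \<Otimes>\<^sub>M \<Lambda>). S f z)"

definition L2 :: "(real \<Rightarrow> complex) \<Rightarrow> (real \<Rightarrow> complex) \<Rightarrow> complex" where
  "L2 f f' = (LINT z|(M \<Otimes>\<^sub>M \<Lambda>). S f z * S f' z)"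

definition L3 :: "(real \<Rightarrow> complex) \<Rightarrow> (real \<Rightarrow> complex) \<Rightarrow> (real \<Rightarrow> complex) \<Rightarrow> complex" where
  "L3 f f' f'' = (LINT z|(M \<Otimes>\<^sub>M \<Lambda>). S f z * S f' z * S f'' z)"

lemmas moment_defs = E1_def E2_def E3_def L1_def L2_def L3_def

lemma moments_sym:
  "E2 f f' = E2 f' f" "L2 f f' = L2 f' f" "E3 f f' f'' = E3 f' f f''" "E3 f f' f'' = E3 f'' f' f"
  "L3 f f' f'' = L3 f' f f''" "L3 f f' f'' = L3 f'' f' f"
  by (simp_all add: moment_defs mult_ac)

lemma moments_split:
  assumes f: "bounded_measurable f" and f'_f'': "bounded_measurable f'" "bounded_measurable f''"
  defines "f1 \<equiv> \<lambda>x. of_real (Re (f x))" and "f2 \<equiv> \<lambda>x. of_real (Im (f x))"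
  shows "E1 f = E1 f1 + \<i> * E1 f2" "E2 f f' = E2 f1 f' + \<i> * E2 f2 f'"
    "E3 f f' f'' = E3 f1 f' f'' + \<i> * E3 f2 f' f''"
    "L1 f = L1 f1 + \<i> * L1 f2" "L2 f f' = L2 f1 f' + \<i> * L2 f2 f'"
    "L3 f f' f'' = L3 f1 f' f'' + \<i> * L3 f2 f' f''"
  unfolding moment_defs cluster_sum_Re_Im[of f] f1_def[symmetric] f2_def[symmetric] distrib_right mult.assoc
  using integrable_S_prod[OF bounded_measurable_of_real[OF bounded_measurable_Re[OF f]] f'_f'', folded f1_def]
    integrable_S_prod[OF bounded_measurable_of_real[OF bounded_measurable_Im[OF f]] f'_f'', folded f2_def]
  by (simp_all add: mult.assoc)

lemma moments_of_real:
  defines "c \<equiv> \<lambda>(a :: real \<Rightarrow> real) x. complex_of_real (a x)"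
  shows "E1 (c a0) = of_real (LINT w|M. S0 a0 w)"
    "E2 (c a0) (c a1) = of_real (LINT w|M. S0 a0 w * S0 a1 w)"
    "E3 (c a0) (c a1) (c a2) = of_real (LINT w|M. S0 a0 w * S0 a1 w * S0 a2 w)"
    "L1 (c a0) = of_real (LINT z|(M \<Otimes>\<^sub>M \<Lambda>). S a0 z)"
    "L2 (c a0) (c a1) = of_real (LINT z|(M \<Otimes>\<^sub>M \<Lambda>). S a0 z * S a1 z)"
    "L3 (c a0) (c a1) (c a2) = of_real (LINT z|(M \<Otimes>\<^sub>M \<Lambda>). S a0 z * S a1 z * S a2 z)"
  unfolding moment_defs c_def cluster_sum_of_real of_real_mult[symmetric] integral_complex_of_real
  by (rule refl)+

lemma first_moment:
  assumes "bounded_measurable f"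
  shows "E1 f = f 0 + L1 f"
proof -
  have "E1 (\<lambda>x. of_real (a x)) = of_real (a 0) + L1 (\<lambda>x. of_real (a x))" if "bounded_measurable a" for a
    using first_moment_real[of "\<lambda>_. a" 0] that unfolding moments_of_real by simp
  then show ?thesis
    using assms moments_split(1,4)[OF assms assms assms] complex_eq[of "f 0"]
    by (simp add: bounded_measurable_Re bounded_measurable_Im algebra_simps)
qed

text \<open>For real functions this is the differentiated fixed-point equation. The difference
  \<open>T\<close> of the two sides is symmetric and splits in each argument, so it vanishes for
  complex functions as well.\<close>

lemma third_moment:
  assumes "bounded_measurable f" "bounded_measurable f'" "bounded_measurable f''"
  shows "E3 f f' f'' = E1 f * E1 f' * E1 f'' + E1 f * L2 f' f'' + E1 f' * L2 f f'' + E1 f'' * L2 f f' + L3 f f' f''"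
proof -
  define T where "T f f' f'' = E3 f f' f''
    - (E1 f * E1 f' * E1 f'' + E1 f * L2 f' f'' + E1 f' * L2 f f'' + E1 f'' * L2 f f' + L3 f f' f'')" for f f' f''
  have "T f f' f'' = 0"
  proof (rule trilinear_zero_complex[where T = T and R = bounded_measurable and C = bounded_measurable])
    fix a b c :: "real \<Rightarrow> real"
    assume abc: "bounded_measurable a" "bounded_measurable b" "bounded_measurable c"
    define F where "F j = (if j = 0 then a else if j = 1 then b else c)" for j :: nat
    have "bounded_measurable (F j)" for j using abc by (simp add: F_def)
    from third_moment_real[of F 0 1 2, OF this] show "T (\<lambda>x. of_real (a x)) (\<lambda>x. of_real (b x)) (\<lambda>x. of_real (c x)) = 0"
      unfolding T_def moments_of_real by (simp add: F_def)
  next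
    fix f f' f'' :: "real \<Rightarrow> complex"
    assume *: "bounded_measurable f" "bounded_measurable f'" "bounded_measurable f''"
    show "T f f' f'' = T (\<lambda>x. of_real (Re (f x))) f' f'' + \<i> * T (\<lambda>x. of_real (Im (f x))) f' f''"
      unfolding T_def moments_split[OF *] moments_split(5)[OF *(1,3,3)] by (simp add: algebra_simps)
  next
    fix f f' f''
    show "T f f' f'' = T f' f f''"
      by (simp add: T_def moments_sym(2)[of f f'] moments_sym(3,5)[of f f'] mult_ac)
    show "T f f' f'' = T f'' f' f"
      by (simp add: T_def moments_sym(2)[of f f''] moments_sym(2)[of f f'] moments_sym(2)[of f' f''] moments_sym(4,6)[of f f'] mult_ac)
  qed (use assms bounded_measurable_of_real bounded_measurable_Re bounded_measurable_Im in auto)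
  then show ?thesis by (simp add: T_def)
qed

text \<open>The bilinear case by hand: complexify the first argument, then use symmetry for the
  second.\<close>

lemma second_moment:
  assumes "bounded_measurable f" "bounded_measurable f'"
  shows "E2 f f' = E1 f * E1 f' + L2 f f'"
proof -
  have 1: "E2 (\<lambda>x. of_real (a x)) (\<lambda>x. of_real (b x)) = E1 (\<lambda>x. of_real (a x)) * E1 (\<lambda>x. of_real (b x)) + L2 (\<lambda>x. of_real (a x)) (\<lambda>x. of_real (b x))"
    if ab: "bounded_measurable a" "bounded_measurable b" for a b
  proof -
    define F where "F j = (if j = 0 then a else b)" for j :: nat
    have "bounded_measurable (F j)" for j using ab by (simp add: F_def)
    from second_moment_real[of F 0 1, OF this] show ?thesis
      unfolding moments_of_real by (simp add: F_def)
  qed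
  have 2: "E2 f (\<lambda>x. of_real (b x)) = E1 f * E1 (\<lambda>x. of_real (b x)) + L2 f (\<lambda>x. of_real (b x))"
    if fb: "bounded_measurable f" "bounded_measurable b" for f b
    using fb moments_split[OF fb(1) bounded_measurable_of_real[OF fb(2)] bounded_measurable_of_real[OF fb(2)]]
    by (simp add: 1 bounded_measurable_Re bounded_measurable_Im algebra_simps)
  show ?thesis
    using assms moments_split[OF assms(2,1,1)]
    unfolding moments_sym(1,2)[of f f']
    by (simp add: 2 moments_sym(1,2)[of _ f] bounded_measurable_Re bounded_measurable_Im algebra_simps)
qed

end

section \<open>Fourier transforms of the cluster moments\<close>

definition wave :: "real \<Rightarrow> real \<Rightarrow> complex" where
  "wave \<omega> y = exp (- (\<i> * of_real (\<omega> * y)))"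

lemma wave_measurable [measurable]: "wave \<omega> \<in> borel_measurable borel"
  unfolding wave_def[abs_def] by measurable

lemma norm_wave [simp]: "norm (wave \<omega> y) = 1"
  by (simp add: wave_def norm_exp_eq_Re)

lemma bounded_measurable_wave: "bounded_measurable (wave \<omega>)"
  by (auto simp: bounded_measurable_def bounded_iff)

lemma wave_0 [simp]: "wave \<omega> 0 = 1" "wave 0 y = 1"
  by (simp_all add: wave_def)

lemma wave_add: "wave \<omega> (x + y) = wave \<omega> x * wave \<omega> y"
  by (simp add: wave_def distrib_left flip: exp_add)

lemma wave_mult: "wave \<omega> y * wave \<omega>' y = wave (\<omega> + \<omega>') y"
  by (simp add: wave_def algebra_simps flip: exp_add)

text \<open>Moving the root only multiplies by a scalar, so root position and genealogy separate
  under the integral.\<close>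

lemma cluster_sum_wave: "cluster_sum (wave \<omega>) \<gamma> y = wave \<omega> y * cluster_sum (wave \<omega>) \<gamma> 0"
  by (simp add: cluster_sum_def wave_add sum_distrib_left)

context branching_parameters
begin

lemma integral_h: "(LINT x|lborel. h x) = 1"
  by (subst integral_eq_nn_integral) (simp_all add: h_nonneg nn_integral_h)

lemma norm_fourier_le: "norm (fourier h \<omega>) \<le> 1"
proof -
  have "norm (fourier h \<omega>) \<le> (LINT t|lborel. norm (wave \<omega> t * of_real (h t)))"
    unfolding fourier_def wave_def[symmetric] by (rule integral_norm_bound)
  also have "\<dots> = 1" by (simp add: norm_mult h_nonneg integral_h)
  finally show ?thesis .
qed

lemma norm_Phi_less: "norm (Phi m h \<omega>) < 1"
proof -
  have "norm (Phi m h \<omega>) \<le> m * 1"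
    unfolding Phi_def norm_mult using m norm_fourier_le by (intro mult_mono) auto
  then show ?thesis using m by simp
qed

lemma Phi_neq_1: "1 - Phi m h \<omega> \<noteq> 0"
  using norm_Phi_less[of \<omega>] by auto

lemma fourier_h_0: "fourier h 0 = 1"
  using integral_h by (simp add: fourier_def)

lemma integral_wave_\<Lambda>: "(LINT y|\<Lambda>. wave \<omega> y) = Phi m h \<omega>"
proof -
  have "(LINT y|\<Lambda>. wave \<omega> y) = (LINT y|lborel. (m * h y) *\<^sub>R wave \<omega> y)"
    unfolding offspring_intensity_def using m h_nonneg by (intro integral_density) auto
  also have "\<dots> = (LINT y|lborel. of_real m * (wave \<omega> y * of_real (h y)))"
    by (simp add: scaleR_conv_of_real mult_ac)
  also have "\<dots> = Phi m h \<omega>"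
    by (simp add: Phi_def fourier_def wave_def)
  finally show ?thesis .
qed

lemma Rfun_mult: "Rfun m h \<omega> * (1 - Phi m h \<omega>) = 1"
  using Phi_neq_1[of \<omega>] by (simp add: Rfun_def)

end

context branching_cluster
begin

lemma integral_wave_times:
  fixes F :: "'w \<Rightarrow> complex"
  assumes F: "integrable M F"
  shows "(LINT z|(M \<Otimes>\<^sub>M \<Lambda>). wave \<omega> (snd z) * F (fst z)) = Phi m h \<omega> * (LINT w|M. F w)"
proof -
  note [measurable] = borel_measurable_integrable[OF F]
  interpret pair_sigma_finite M \<Lambda> by (rule pair_sigma_finite_M) unfold_locales
  have "integrable (M \<Otimes>\<^sub>M \<Lambda>) (\<lambda>z. wave \<omega> (snd z) * F (fst z))"
    by (rule integrable_pair_\<Lambda>[OF integrable_norm[OF F]]) (auto simp: norm_mult)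
  from integral_fst'[OF this] show ?thesis
    by (simp add: integral_wave_\<Lambda>)
qed

text \<open>In a product of wave sums the scalars of the root position multiply to the wave of the
  total frequency, whose integral against \<open>\<Lambda>\<close> is \<open>Phi\<close>.\<close>

lemma L_wave:
  "L1 (wave \<omega>) = Phi m h \<omega> * E1 (wave \<omega>)"
  "L2 (wave \<omega>) (wave \<omega>') = Phi m h (\<omega> + \<omega>') * E2 (wave \<omega>) (wave \<omega>')"
  "L3 (wave \<omega>) (wave \<omega>') (wave \<omega>'') = Phi m h (\<omega> + \<omega>' + \<omega>'') * E3 (wave \<omega>) (wave \<omega>') (wave \<omega>'')"
proof -
  note int = integrable_S_prod[OF bounded_measurable_wave bounded_measurable_wave bounded_measurable_wave]
  have 1: "S (wave \<omega>) z = wave \<omega> (snd z) * S0 (wave \<omega>) (fst z)" for z \<omega>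
    by (rule cluster_sum_wave)
  show "L1 (wave \<omega>) = Phi m h \<omega> * E1 (wave \<omega>)"
    unfolding moment_defs by (subst 1) (rule integral_wave_times[OF int(4)])
  have "S (wave \<omega>) z * S (wave \<omega>') z = wave (\<omega> + \<omega>') (snd z) * (S0 (wave \<omega>) (fst z) * S0 (wave \<omega>') (fst z))" for z
    by (simp add: cluster_sum_wave[of _ _ "snd z"] flip: wave_mult)
  then show "L2 (wave \<omega>) (wave \<omega>') = Phi m h (\<omega> + \<omega>') * E2 (wave \<omega>) (wave \<omega>')"
    unfolding moment_defs by (simp only: integral_wave_times[OF int(5)])
  have "S (wave \<omega>) z * S (wave \<omega>') z * S (wave \<omega>'') z
      = wave (\<omega> + \<omega>' + \<omega>'') (snd z) * (S0 (wave \<omega>) (fst z) * S0 (wave \<omega>') (fst z) * S0 (wave \<omega>'') (fst z))" for z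
    by (simp add: cluster_sum_wave[of _ _ "snd z"] flip: wave_mult)
  then show "L3 (wave \<omega>) (wave \<omega>') (wave \<omega>'') = Phi m h (\<omega> + \<omega>' + \<omega>'') * E3 (wave \<omega>) (wave \<omega>') (wave \<omega>'')"
    unfolding moment_defs by (simp only: integral_wave_times[OF int(6)])
qed

text \<open>Solves \<open>E1 = 1 + Phi * E1\<close>; the constant is the wave at the root.\<close>

lemma E1_wave: "E1 (wave \<omega>) = Rfun m h \<omega>"
proof -
  have "E1 (wave \<omega>) * (1 - Phi m h \<omega>) = 1"
    using first_moment[OF bounded_measurable_wave, of \<omega>] by (simp add: L_wave algebra_simps)
  then show ?thesis using Phi_neq_1[of \<omega>] by (simp add: Rfun_def field_simps)
qed

text \<open>The second-moment identity gives \<open>E2 = E1 * E1 * R (\<omega> + \<omega>')\<close>,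
  and \<open>L2\<close> is \<open>E2 - E1 * E1\<close>.\<close>

lemma L2_wave:
  "L2 (wave \<omega>) (wave \<omega>') = Rfun m h \<omega> * Rfun m h \<omega>' * (Rfun m h (\<omega> + \<omega>') - 1)"
proof -
  have E2: "E2 (wave \<omega>) (wave \<omega>') * (1 - Phi m h (\<omega> + \<omega>')) = Rfun m h \<omega> * Rfun m h \<omega>'"
    using second_moment[OF bounded_measurable_wave bounded_measurable_wave, of \<omega> \<omega>']
    by (simp add: L_wave E1_wave algebra_simps)
  have "E2 (wave \<omega>) (wave \<omega>') = E2 (wave \<omega>) (wave \<omega>') * (1 - Phi m h (\<omega> + \<omega>')) * Rfun m h (\<omega> + \<omega>')"
    using Rfun_mult[of "\<omega> + \<omega>'"] by (simp add: mult_ac)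
  then have "E2 (wave \<omega>) (wave \<omega>') = Rfun m h \<omega> * Rfun m h \<omega>' * Rfun m h (\<omega> + \<omega>')"
    unfolding E2 .
  then show ?thesis
    using second_moment[OF bounded_measurable_wave bounded_measurable_wave, of \<omega> \<omega>']
    by (simp add: E1_wave algebra_simps)
qed

text \<open>At total frequency zero \<open>Phi\<close> equals \<open>m\<close>, because
  \<open>h\<close> has integral one; this produces the divisor \<open>1 - m\<close>. Inside the
  bracket the means contribute \<open>1\<close> and each pair its \<open>Rfun\<close> value minus
  one, hence the \<open>- 2\<close>.\<close>

lemma E3_wave:
  assumes "\<omega> + \<omega>' + \<omega>'' = 0"
  shows "E3 (wave \<omega>) (wave \<omega>') (wave \<omega>'') = Rfun m h \<omega> * Rfun m h \<omega>' * Rfun m h \<omega>''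
    * (Rfun m h (\<omega> + \<omega>') + Rfun m h (\<omega> + \<omega>'') + Rfun m h (\<omega>' + \<omega>'') - 2) / of_real (1 - m)"
proof -
  have "Phi m h (\<omega> + \<omega>' + \<omega>'') = of_real m"
    unfolding assms by (simp add: Phi_def fourier_h_0)
  then have "E3 (wave \<omega>) (wave \<omega>') (wave \<omega>'') * (1 - of_real m) = Rfun m h \<omega> * Rfun m h \<omega>' * Rfun m h \<omega>''
    * (Rfun m h (\<omega> + \<omega>') + Rfun m h (\<omega> + \<omega>'') + Rfun m h (\<omega>' + \<omega>'') - 2)"
    using third_moment[OF bounded_measurable_wave bounded_measurable_wave bounded_measurable_wave, of \<omega> \<omega>' \<omega>'']
    by (simp add: L_wave(3) L2_wave E1_wave algebra_simps)
  moreover have "1 - of_real m \<noteq> (0 :: complex)"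
    using m by (metis eq_iff_diff_eq_0 less_irrefl of_real_1 of_real_eq_iff)
  ultimately show ?thesis by (simp add: field_simps)
qed

end

lemma fourier_uminus: "fourier h (- \<omega>) = cnj (fourier h \<omega>)"
proof -
  have "exp (- (\<i> * of_real (- \<omega> * t))) * of_real (h t) = cnj (exp (- (\<i> * of_real (\<omega> * t))) * of_real (h t))" for t
    by (simp add: exp_cnj)
  then show ?thesis unfolding fourier_def by (simp only: Bochner_Integration.integral_cnj)
qed

context branching_parameters
begin

text \<open>Since \<open>h\<close> is real, \<open>1 - p (- \<omega>)\<close> is the conjugate of
  \<open>1 - p \<omega>\<close>. The denominators \<open>1 - p \<omega>\<close> of the product and
  \<open>1 - p (- \<omega>)\<close> of the bracket therefore pair up to squared absolute
  values.\<close>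

lemma bispectrum_rational_form:
  fixes \<omega>1 \<omega>2 :: real
  defines "\<omega>3 \<equiv> - \<omega>1 - \<omega>2" and "R \<equiv> Rfun m h"
  shows "R \<omega>1 * R \<omega>2 * R \<omega>3 * (R (- \<omega>1) + R (- \<omega>2) + R (- \<omega>3) - 2)
      = (1 - (of_real m)\<^sup>2 * Qfun m h \<omega>1 \<omega>2) / of_real (denom m h \<omega>1 \<omega>2)"
    and "0 < denom m h \<omega>1 \<omega>2"
proof -
  define p where "p \<omega> = Phi m h \<omega>" for \<omega>
  have p: "1 - p \<omega> \<noteq> 0" for \<omega> unfolding p_def by (rule Phi_neq_1)
  have cnj: "1 - p (- \<omega>) = cnj (1 - p \<omega>)" for \<omega>
    by (simp add: p_def Phi_def fourier_uminus)
  have sq: "of_real ((cmod (1 - p \<omega>))\<^sup>2) = (1 - p \<omega>) * (1 - p (- \<omega>))" for \<omega>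
    unfolding cnj by (simp only: complex_norm_square)
  have den: "denom m h \<omega>1 \<omega>2 = (cmod (1 - p \<omega>1))\<^sup>2 * (cmod (1 - p \<omega>2))\<^sup>2 * (cmod (1 - p \<omega>3))\<^sup>2"
    by (simp add: denom_def p_def Phi_def \<omega>3_def)
  show "0 < denom m h \<omega>1 \<omega>2"
    unfolding den using p by simp
  have den': "of_real (denom m h \<omega>1 \<omega>2) = (1 - p \<omega>1) * (1 - p \<omega>2) * (1 - p \<omega>3) * ((1 - p (- \<omega>1)) * (1 - p (- \<omega>2)) * (1 - p (- \<omega>3)))"
    unfolding den of_real_mult sq by (simp only: mult_ac)
  have Q: "(of_real m)\<^sup>2 * Qfun m h \<omega>1 \<omega>2 = p (- \<omega>1) * p (- \<omega>2) + p (- \<omega>3) * (p (- \<omega>1) + p (- \<omega>2) - 2 * p (- \<omega>1) * p (- \<omega>2))"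
    by (simp add: Qfun_def p_def Phi_def \<omega>3_def power2_eq_square algebra_simps)
  \<comment> \<open>The six numbers may be treated as unrelated. Over a common denominator the
    bracket has the numerator \<open>1 - e2 + 2 * e3\<close> in the elementary symmetric polynomials
    of \<open>a'\<close>, \<open>b'\<close>, \<open>c'\<close>; the linear terms cancel because of
    the \<open>- 2\<close>.\<close>
  have id: "1 / (1 - a) * (1 / (1 - b)) * (1 / (1 - c)) * (1 / (1 - a') + 1 / (1 - b') + 1 / (1 - c') - 2)
      = (1 - (a' * b' + c' * (a' + b' - 2 * a' * b'))) / ((1 - a) * (1 - b) * (1 - c) * ((1 - a') * (1 - b') * (1 - c')))"
    if "1 - a \<noteq> 0" "1 - b \<noteq> 0" "1 - c \<noteq> 0" "1 - a' \<noteq> 0" "1 - b' \<noteq> 0" "1 - c' \<noteq> 0" for a b c a' b' c' :: complex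
  proof -
    have "1 / (1 - a') + 1 / (1 - b') + 1 / (1 - c') - 2
        = (1 - (a' * b' + c' * (a' + b' - 2 * a' * b'))) / ((1 - a') * (1 - b') * (1 - c'))"
      using that(4-6) by (simp add: divide_simps) (simp add: algebra_simps)
    then show ?thesis by simp
  qed
  show "R \<omega>1 * R \<omega>2 * R \<omega>3 * (R (- \<omega>1) + R (- \<omega>2) + R (- \<omega>3) - 2)
      = (1 - (of_real m)\<^sup>2 * Qfun m h \<omega>1 \<omega>2) / of_real (denom m h \<omega>1 \<omega>2)"
    unfolding den' Q R_def Rfun_def p_def[symmetric] by (rule id) (rule p)+
qed

end

section \<open>The generating functional of the cluster process\<close>

lemma nn_integral_superpose:
  assumes \<mu>: "\<And>j. sets (\<mu> j) = sets borel" and f: "f \<in> borel_measurable borel"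
  shows "(\<integral>\<^sup>+ x. f x \<partial>superpose \<mu>) = (\<Sum>j. \<integral>\<^sup>+ x. f x \<partial>\<mu> j)"
proof -
  have meas: "borel_measurable (superpose \<mu>) = borel_measurable (borel :: real measure)"
    "\<And>j. borel_measurable (\<mu> j) = borel_measurable (borel :: real measure)"
    by (intro measurable_cong_sets sets_superpose \<mu> refl)+
  show ?thesis
    using f
  proof (induction rule: borel_measurable_induct)
    case (cong f g)
    then have "f = g" by auto
    with cong show ?case by simp
  next
    case (set A)
    then show ?case
      by (simp add: \<mu> sets_superpose emeasure_superpose)
  next
    case (mult u c)
    then show ?case by (simp add: nn_integral_cmult meas)
  next
    case (add u v)
    then show ?case by (simp add: nn_integral_add suminf_add meas)
  next
    case (seq u)
    have "(\<integral>\<^sup>+ x. (SUP i. u i) x \<partial>superpose \<mu>) = (SUP i. \<integral>\<^sup>+ x. u i x \<partial>superpose \<mu>)"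
      unfolding SUP_apply by (rule nn_integral_monotone_convergence_SUP) (use seq in \<open>auto simp: meas\<close>)
    also have "\<dots> = (SUP i. \<Sum>j. \<integral>\<^sup>+ x. u i x \<partial>\<mu> j)" using seq by simp
    also have "\<dots> = (\<Sum>j. SUP i. \<integral>\<^sup>+ x. u i x \<partial>\<mu> j)"
      by (rule ennreal_suminf_SUP_eq[symmetric])
        (use seq in \<open>auto simp: incseq_def le_fun_def intro!: nn_integral_mono\<close>)
    also have "\<dots> = (\<Sum>j. \<integral>\<^sup>+ x. (SUP i. u i) x \<partial>\<mu> j)"
      unfolding SUP_apply
      by (intro arg_cong[where f = suminf] ext nn_integral_monotone_convergence_SUP[symmetric])
        (use seq in \<open>auto simp: meas\<close>)
    finally show ?case .
  qed
qed

lemma sets_cluster: "sets (cluster \<gamma>) = sets borel"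
  by (simp add: cluster_def points_def)

lemma nn_integral_shift_cluster:
  fixes f :: "real \<Rightarrow> ennreal"
  assumes [measurable]: "f \<in> borel_measurable borel"
  shows "(\<integral>\<^sup>+ x. f x \<partial>shift u (cluster \<gamma>)) = (\<integral>\<^sup>+ v. f (u + pos \<gamma> v) \<partial>count_space {v. alive \<gamma> v})"
proof -
  have "(\<lambda>x. x + u) \<in> measurable (cluster \<gamma>) borel"
    by (subst measurable_cong_sets[OF sets_cluster refl]) simp
  then have "(\<integral>\<^sup>+ x. f x \<partial>shift u (cluster \<gamma>)) = (\<integral>\<^sup>+ x. f (x + u) \<partial>cluster \<gamma>)"
    unfolding shift_def by (rule nn_integral_distr) simp
  also have "\<dots> = (\<integral>\<^sup>+ v. f (pos \<gamma> v + u) \<partial>count_space {v. alive \<gamma> v})"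
    unfolding cluster_def points_def by (rule nn_integral_distr) simp_all
  finally show ?thesis by (simp only: add.commute)
qed

lemma nn_integral_shift_cluster_finite:
  fixes f :: "real \<Rightarrow> real"
  assumes [measurable]: "f \<in> borel_measurable borel" and "\<And>x. 0 \<le> f x" "finite {v. alive \<gamma> v}"
  shows "(\<integral>\<^sup>+ x. ennreal (f x) \<partial>shift u (cluster \<gamma>)) = ennreal (cluster_sum f \<gamma> u)"
  using assms(2,3)
  by (simp add: nn_integral_shift_cluster nn_integral_count_space_finite cluster_sum_def sum_ennreal)

lemma sets_shift [simp]: "sets (shift u \<mu>) = sets borel"
  by (simp add: shift_def)

text \<open>Stands in for compact support: every test function is bounded by a multiple of some
  window.\<close>

abbreviation window :: "real \<Rightarrow> real \<Rightarrow> real" where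
  "window K \<equiv> indicator {- K..K}"

lemma cluster_sum_nonneg: "(\<And>x. 0 \<le> f x) \<Longrightarrow> 0 \<le> cluster_sum f \<gamma> u" for f :: "real \<Rightarrow> real"
  by (simp add: cluster_sum_def sum_nonneg)

lemma cluster_sum_mono: "(\<And>x. f x \<le> f' x) \<Longrightarrow> cluster_sum f \<gamma> u \<le> cluster_sum f' \<gamma> u" for f :: "real \<Rightarrow> real"
  by (simp add: cluster_sum_def sum_mono)

lemma cluster_sum_cmult: "cluster_sum (\<lambda>x. a * f x) \<gamma> u = a * cluster_sum f \<gamma> u" for f :: "real \<Rightarrow> real"
  by (simp add: cluster_sum_def sum_distrib_left)

lemma abs_cluster_sum_le_window:
  assumes "\<And>x. \<bar>f x\<bar> \<le> a * window K x"
  shows "\<bar>cluster_sum f \<gamma> u\<bar> \<le> a * cluster_sum (window K) \<gamma> u"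
  using abs_cluster_sum_le[of f \<gamma> u] cluster_sum_mono[of "\<lambda>x. \<bar>f x\<bar>" "\<lambda>x. a * window K x" \<gamma> u] assms
  by (simp add: cluster_sum_cmult)

lemma cluster_sum_window_le: "cluster_sum (window K) \<gamma> u \<le> cluster_size \<gamma>"
  using norm_cluster_sum_le_size[of "window K" 1 \<gamma> u] by simp

text \<open>Each individual lies in the window for a set of root positions of length
  \<open>2 * K\<close>. This makes up for the infinite mass of \<open>lborel\<close>.\<close>

lemma nn_integral_cluster_sum_window:
  assumes "0 \<le> K"
  shows "(\<integral>\<^sup>+ u. ennreal (cluster_sum (window K) \<gamma> u) \<partial>lborel) = ennreal (2 * K * cluster_size \<gamma>)"
proof -
  have 1: "(\<integral>\<^sup>+ u. ennreal (window K (u + p)) \<partial>lborel) = ennreal (2 * K)" for p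
  proof -
    have "window K (u + p) = indicator {- K - p..K - p} u" for u
      by (auto simp: indicator_def)
    then show ?thesis using assms by (simp add: ennreal_indicator)
  qed
  have "(\<integral>\<^sup>+ u. ennreal (cluster_sum (window K) \<gamma> u) \<partial>lborel) = (\<integral>\<^sup>+ u. (\<Sum>v | alive \<gamma> v. ennreal (window K (u + pos \<gamma> v))) \<partial>lborel)"
    by (simp add: cluster_sum_def sum_ennreal)
  also have "\<dots> = (\<Sum>v | alive \<gamma> v. \<integral>\<^sup>+ u. ennreal (window K (u + pos \<gamma> v)) \<partial>lborel)"
    by (rule nn_integral_sum) simp
  also have "\<dots> = ennreal (2 * K * cluster_size \<gamma>)"
    using assms by (simp only: 1) (simp add: cluster_size_def ennreal_of_nat_eq_real_of_nat ennreal_mult' mult.commute)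
  finally show ?thesis .
qed

context branching_cluster
begin

text \<open>The window sum in the bound provides decay in the root position; integrating it out
  costs a factor \<open>2 * K * Z w\<close>, which explains the weight \<open>Z w\<close> in the
  first hypothesis.\<close>

lemma integrable_pair_lborel:
  fixes F :: "'w \<times> real \<Rightarrow> 'b::{banach, second_countable_topology}"
  assumes v: "integrable M (\<lambda>w. Z w * v w)" and v_nonneg: "\<And>w. 0 \<le> v w" and v_meas [measurable]: "v \<in> borel_measurable M"
    and F [measurable]: "F \<in> borel_measurable (M \<Otimes>\<^sub>M lborel)" and K: "0 \<le> K"
    and le: "\<And>w u. norm (F (w, u)) \<le> cluster_sum (window K) (g w) u * v w"
  shows "integrable (M \<Otimes>\<^sub>M lborel) F"
proof (rule integrableI_bounded)
  have "(\<integral>\<^sup>+ z. norm (F z) \<partial>(M \<Otimes>\<^sub>M lborel)) = (\<integral>\<^sup>+ w. (\<integral>\<^sup>+ u. norm (F (w, u)) \<partial>lborel) \<partial>M)"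
    by (rule lborel.nn_integral_fst[symmetric]) measurable
  also have "\<dots> \<le> (\<integral>\<^sup>+ w. ennreal (2 * K * (Z w * v w)) \<partial>M)"
  proof (rule nn_integral_mono)
    fix w assume w: "w \<in> space M"
    have "(\<integral>\<^sup>+ u. norm (F (w, u)) \<partial>lborel) \<le> (\<integral>\<^sup>+ u. ennreal (v w) * ennreal (cluster_sum (window K) (g w) u) \<partial>lborel)"
      using le v_nonneg by (intro nn_integral_mono) (simp add: ennreal_mult'[symmetric] ennreal_leI mult.commute)
    also have "\<dots> = ennreal (v w) * ennreal (2 * K * Z w)"
    proof (subst nn_integral_cmult)
      have "(\<lambda>u. cluster_sum (window K) (g w) u) \<in> borel_measurable borel"
        unfolding cluster_sum_def by measurable
      then show "(\<lambda>u. ennreal (cluster_sum (window K) (g w) u)) \<in> borel_measurable lborel"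
        by measurable
    qed (simp add: nn_integral_cluster_sum_window[OF K])
    also have "\<dots> = ennreal (2 * K * (Z w * v w))"
      using v_nonneg[of w] by (simp add: ennreal_mult'[symmetric] mult_ac)
    finally show "(\<integral>\<^sup>+ u. norm (F (w, u)) \<partial>lborel) \<le> ennreal (2 * K * (Z w * v w))" .
  qed
  also have "\<dots> < \<infinity>"
  proof -
    have int: "integrable M (\<lambda>w. 2 * K * (Z w * v w))" using v by (intro integrable_mult_right)
    have "(\<integral>\<^sup>+ w. ennreal (2 * K * (Z w * v w)) \<partial>M) = ennreal (LINT w|M. 2 * K * (Z w * v w))"
      using v_nonneg K by (intro nn_integral_eq_integral[OF int]) auto
    then show ?thesis by simp
  qed
  finally show "(\<integral>\<^sup>+ z. norm (F z) \<partial>(M \<Otimes>\<^sub>M lborel)) < \<infinity>" .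
qed fact

lemma integrable_exp_S_minus_1:
  assumes f [measurable]: "f \<in> borel_measurable borel" and a: "0 \<le> a" "a < \<epsilon>" and K: "0 \<le> K"
    and f_le: "\<And>x. \<bar>f x\<bar> \<le> a * window K x"
  shows "integrable (M \<Otimes>\<^sub>M lborel) (\<lambda>z. exp (S f z) - 1)"
proof (rule integrable_pair_lborel[where v = "\<lambda>w. a * exp (a * Z w)" and K = K])
  show "integrable M (\<lambda>w. Z w * (a * exp (a * Z w)))"
    using integrable_mult_right[OF integrable_Z_power_exp[OF a(2), of 1], of a] by (simp add: mult_ac)
  fix w u
  have "\<bar>exp (cluster_sum f (g w) u) - 1\<bar> \<le> \<bar>cluster_sum f (g w) u\<bar> * exp \<bar>cluster_sum f (g w) u\<bar>"
    by (rule abs_exp_minus_1_le)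
  also have "\<dots> \<le> (a * cluster_sum (window K) (g w) u) * exp (a * Z w)"
  proof (rule mult_mono)
    show 1: "\<bar>cluster_sum f (g w) u\<bar> \<le> a * cluster_sum (window K) (g w) u"
      by (rule abs_cluster_sum_le_window[OF f_le])
    have "a * cluster_sum (window K) (g w) u \<le> a * Z w"
      using a cluster_sum_window_le by (intro mult_left_mono) auto
    with 1 show "exp \<bar>cluster_sum f (g w) u\<bar> \<le> exp (a * Z w)" by simp
  qed (use a cluster_sum_nonneg[of "window K"] in auto)
  finally show "norm (exp (S f (w, u)) - 1) \<le> cluster_sum (window K) (g w) u * (a * exp (a * Z w))"
    by (simp add: mult_ac)
qed (use a K in auto)

end

section \<open>The stationary process, approximated by its immigrants in bounded intervals\<close>

locale cluster_process = branching_parameters m h + prob_space M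
  for m h and M :: "'w measure" +
  fixes \<nu> :: real and U :: "nat \<Rightarrow> 'w \<Rightarrow> real" and g :: "nat \<Rightarrow> 'w \<Rightarrow> genealogy" and N :: "'w \<Rightarrow> real measure"
  assumes \<nu>: "0 < \<nu>"
    and U_poisson: "poisson_process M (\<lambda>w. points UNIV (\<lambda>j. U j w)) (density lborel (\<lambda>_. ennreal \<nu>))"
    and g_branching: "\<And>j. branching_genealogy M m h (g j)"
    and g_indep: "indep_vars (\<lambda>_. genealogy_space) g UNIV"
    and U_g_indep: "indep_set
          (sets (vimage_algebra (space M) (\<lambda>w j. U j w) (Pi\<^sub>M UNIV (\<lambda>_. borel))))
          (sets (vimage_algebra (space M) (\<lambda>w j. g j w) (Pi\<^sub>M UNIV (\<lambda>_. genealogy_space))))"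
    and N_eq: "\<And>w. w \<in> space M \<Longrightarrow> N w = superpose (\<lambda>j. shift (U j w) (cluster (g j w)))"
begin

text \<open>The genealogies need not be identically distributed, as siblings may be enumerated
  differently for different immigrants. Immigrant \<open>0\<close> is a representative, which is
  legitimate because the generating functionals agree.\<close>

sublocale C: branching_cluster m h M "g 0"
  by unfold_locales (rule g_branching)

lemma g_measurable [measurable]: "g j \<in> measurable M genealogy_space"
  using g_indep by (simp add: indep_vars_def)

lemma g_seq_measurable [measurable]: "(\<lambda>w j. g j w) \<in> measurable M (Pi\<^sub>M UNIV (\<lambda>_. genealogy_space))"
  by (rule measurable_PiM_single') (auto intro: measurable_space[OF g_measurable])

text \<open>The Poisson hypothesis speaks of counts only. Measurability of the positions comes from
  the independence hypothesis, whose sigma-algebras consist of events.\<close>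

lemma U_seq_measurable [measurable]: "(\<lambda>w j. U j w) \<in> measurable M (Pi\<^sub>M UNIV (\<lambda>_. borel))"
proof (rule measurableI)
  fix A :: "(nat \<Rightarrow> real) set" assume "A \<in> sets (Pi\<^sub>M UNIV (\<lambda>_. borel))"
  then show "(\<lambda>w j. U j w) -` A \<inter> space M \<in> events"
    using indep_setD_ev1[OF U_g_indep] in_vimage_algebra by blast
qed (simp add: space_PiM)

lemma U_measurable [measurable]: "U j \<in> borel_measurable M"
  using measurable_compose[OF U_seq_measurable measurable_component_singleton[of j UNIV]] by simp

abbreviation B :: "nat \<Rightarrow> real set" where "B k \<equiv> {- real k..real k}"

text \<open>The roots are cut off, not the individuals: this leaves an immigrant intensity of finite
  mass, as the Poisson formula requires, and keeps clusters whole.\<close>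

definition N_upto :: "nat \<Rightarrow> (real \<Rightarrow> real) \<Rightarrow> 'w \<Rightarrow> real" where
  "N_upto k f w = (\<Sum>j | U j w \<in> B k. cluster_sum f (g j w) (U j w))"

definition gf :: "(real \<Rightarrow> real) \<Rightarrow> real \<Rightarrow> real" where
  "gf f u = (LINT w|M. exp (cluster_sum f (g 0 w) u))"

definition regular :: "'w \<Rightarrow> bool" where
  "regular w \<longleftrightarrow> (\<forall>j. finite {u. alive (g j w) u}) \<and> (\<forall>k. finite {j. U j w \<in> B k})"

lemma emeasure_B: "emeasure (density lborel (\<lambda>_. ennreal \<nu>)) (B k) < \<infinity>"
  by (simp add: emeasure_density_const ennreal_mult_less_top)

lemma AE_regular: "AE w in M. regular w"
proof -
  have "AE w in M. \<forall>j. finite {u. alive (g j w) u}"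
    unfolding AE_all_countable by (intro allI AE_finite_cluster[OF prob_space_axioms g_branching])
  moreover have "AE w in M. \<forall>k. finite {j. U j w \<in> B k}"
    unfolding AE_all_countable
    using AE_poisson_process_finite[OF prob_space_axioms U_poisson _ emeasure_B] by simp
  ultimately show ?thesis by eventually_elim (simp add: regular_def)
qed

lemma N_upto_measurable [measurable]:
  assumes [measurable]: "f \<in> borel_measurable borel"
  shows "N_upto k f \<in> borel_measurable M"
  unfolding N_upto_def[abs_def] by (rule borel_measurable_sum_random_set) measurable

lemma gf_measurable [measurable]:
  assumes [measurable]: "f \<in> borel_measurable borel"
  shows "gf f \<in> borel_measurable borel"
  unfolding gf_def[abs_def] by (rule borel_measurable_lebesgue_integral) measurable

lemma gf_nonneg: "0 \<le> gf f u"
  by (simp add: gf_def)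

lemma gf_le:
  assumes f: "f \<in> borel_measurable borel" and f_le: "\<And>y. \<bar>f y\<bar> \<le> \<epsilon>"
  shows "gf f u \<le> 1 / m"
proof (rule LIMSEQ_le_const2)
  show "(\<lambda>n. gf_upto n f u) \<longlonglongrightarrow> gf f u"
    unfolding gf_def by (rule gf_upto_tendsto[OF prob_space_axioms g_branching f f_le])
  have "f y \<le> \<epsilon>" for y using f_le[of y] by simp
  then show "\<exists>N. \<forall>n\<ge>N. gf_upto n f u \<le> 1 / m" using gf_upto_le[OF f] by blast
qed

text \<open>\<open>gf\<close> is defined through immigrant \<open>0\<close>, yet the formula holds
  for every \<open>j\<close>: both expectations are limits of the same sequence
  \<open>gf_upto\<close>.\<close>

lemma nn_integral_exp_cluster_sum:
  assumes f [measurable]: "f \<in> borel_measurable borel" and f_le: "\<And>y. \<bar>f y\<bar> \<le> \<epsilon>"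
  shows "(\<integral>\<^sup>+ w. ennreal (exp (cluster_sum f (g j w) u)) \<partial>M) = ennreal (gf f u)"
proof -
  have "(\<integral>\<^sup>+ w. ennreal (exp (cluster_sum f (g j w) u)) \<partial>M) = ennreal (LINT w|M. exp (cluster_sum f (g j w) u))"
    by (rule nn_integral_eq_integral[OF integrable_exp_cluster_sum[OF prob_space_axioms g_branching f f_le]]) simp
  also have "(LINT w|M. exp (cluster_sum f (g j w) u)) = gf f u"
    unfolding gf_def
    using gf_upto_tendsto[OF prob_space_axioms g_branching f f_le]
      gf_upto_tendsto[OF prob_space_axioms g_branching f f_le] by (rule LIMSEQ_unique)
  finally show ?thesis .
qed

text \<open>For fixed positions the clusters are independent, so the inner expectation is the
  product of \<open>gf f\<close> over the immigrants in \<open>B k\<close>. The Poisson formula with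
  \<open>\<phi> = gf f\<close>, bounded by \<open>1 / m\<close>, does the rest.\<close>

lemma nn_integral_exp_N_upto:
  assumes f [measurable]: "f \<in> borel_measurable borel" and f_le: "\<And>y. \<bar>f y\<bar> \<le> \<epsilon>"
  shows "(\<integral>\<^sup>+ w. ennreal (exp (N_upto k f w)) \<partial>M)
    = ennreal (exp (\<nu> * (LINT u|lborel. indicator (B k) u * (gf f u - 1))))"
proof -
  let ?S = "Pi\<^sub>M UNIV (\<lambda>_. borel) :: (nat \<Rightarrow> real) measure" and ?T = "Pi\<^sub>M UNIV (\<lambda>_. genealogy_space) :: (nat \<Rightarrow> genealogy) measure"
  define F where "F = (\<lambda>(u :: nat \<Rightarrow> real, G). ennreal (exp (\<Sum>j | u j \<in> B k. cluster_sum f (G j) (u j))))"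
  have F: "F \<in> borel_measurable (?S \<Otimes>\<^sub>M ?T)"
  proof -
    have [measurable]: "(\<lambda>z. fst z j) \<in> borel_measurable (?S \<Otimes>\<^sub>M ?T)" for j
      by (rule measurable_compose[OF measurable_fst measurable_component_singleton]) simp
    have [measurable]: "(\<lambda>z. snd z j) \<in> measurable (?S \<Otimes>\<^sub>M ?T) genealogy_space" for j
      by (rule measurable_compose[OF measurable_snd measurable_component_singleton]) simp
    have [measurable]: "(\<lambda>z. \<Sum>j | fst z j \<in> B k. cluster_sum f (snd z j) (fst z j)) \<in> borel_measurable (?S \<Otimes>\<^sub>M ?T)"
      by (rule borel_measurable_sum_random_set) measurable
    show ?thesis unfolding F_def split_beta by measurable
  qed
  have "(\<integral>\<^sup>+ w. ennreal (exp (N_upto k f w)) \<partial>M) = (\<integral>\<^sup>+ w. F (\<lambda>j. U j w, \<lambda>j. g j w) \<partial>M)"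
    by (simp add: F_def N_upto_def)
  also have "\<dots> = (\<integral>\<^sup>+ w. (\<integral>\<^sup>+ w'. F (\<lambda>j. U j w, \<lambda>j. g j w') \<partial>M) \<partial>M)"
  proof (rule nn_integral_independent_pair[OF U_seq_measurable g_seq_measurable _ F])
    fix A B assume "A \<in> sets ?S" "B \<in> sets ?T"
    then show "prob (((\<lambda>w j. U j w) -` A \<inter> space M) \<inter> ((\<lambda>w j. g j w) -` B \<inter> space M))
        = prob ((\<lambda>w j. U j w) -` A \<inter> space M) * prob ((\<lambda>w j. g j w) -` B \<inter> space M)"
      by (intro indep_setD[OF U_g_indep] in_vimage_algebra)
  qed
  also have "\<dots> = (\<integral>\<^sup>+ w. (\<Prod>j | j \<in> UNIV \<and> U j w \<in> B k. ennreal (gf f (U j w))) \<partial>M)"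
  proof (rule nn_integral_cong_AE)
    show "AE w in M. (\<integral>\<^sup>+ w'. F (\<lambda>j. U j w, \<lambda>j. g j w') \<partial>M) = (\<Prod>j | j \<in> UNIV \<and> U j w \<in> B k. ennreal (gf f (U j w)))"
      using AE_regular
    proof eventually_elim
      case (elim w)
      then have fin: "finite {j. U j w \<in> B k}" by (simp add: regular_def)
      have "(\<integral>\<^sup>+ w'. F (\<lambda>j. U j w, \<lambda>j. g j w') \<partial>M)
          = (\<integral>\<^sup>+ w'. (\<Prod>j\<in>{j. U j w \<in> B k}. ennreal (exp (cluster_sum f (g j w') (U j w)))) \<partial>M)"
        using fin by (simp add: F_def exp_sum prod_ennreal)
      also have "\<dots> = (\<Prod>j\<in>{j. U j w \<in> B k}. \<integral>\<^sup>+ w'. ennreal (exp (cluster_sum f (g j w') (U j w))) \<partial>M)"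
      proof (rule indep_vars_nn_integral[OF fin])
        have "indep_vars (\<lambda>_. genealogy_space) g {j. U j w \<in> B k}"
          by (rule indep_vars_subset[OF g_indep]) simp
        then show "indep_vars (\<lambda>_. borel) (\<lambda>j w'. ennreal (exp (cluster_sum f (g j w') (U j w)))) {j. U j w \<in> B k}"
          by (rule indep_vars_compose2[where Y = "\<lambda>j \<gamma>. ennreal (exp (cluster_sum f \<gamma> (U j w)))"]) measurable
      qed simp
      also have "\<dots> = (\<Prod>j | j \<in> UNIV \<and> U j w \<in> B k. ennreal (gf f (U j w)))"
        by (simp add: nn_integral_exp_cluster_sum[OF f f_le])
      finally show ?case .
    qed
  qed
  also have "\<dots> = ennreal (exp (LINT u|density lborel (\<lambda>_. ennreal \<nu>). indicator (B k) u * (gf f u - 1)))"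
    by (rule nn_integral_poisson_process_prod[OF prob_space_axioms U_poisson _ _ emeasure_B _ gf_nonneg gf_le[OF f f_le]]) auto
  also have "(LINT u|density lborel (\<lambda>_. ennreal \<nu>). indicator (B k) u * (gf f u - 1))
      = \<nu> * (LINT u|lborel. indicator (B k) u * (gf f u - 1))"
    using \<nu> by (subst integral_density) auto
  finally show ?thesis .
qed

lemma nn_integral_N:
  assumes "w \<in> space M" "f \<in> borel_measurable borel"
  shows "(\<integral>\<^sup>+ x. f x \<partial>N w) = (\<Sum>j. \<integral>\<^sup>+ x. f x \<partial>shift (U j w) (cluster (g j w)))"
  unfolding N_eq[OF assms(1)] by (rule nn_integral_superpose[OF _ assms(2)]) simp

lemma sets_N: "w \<in> space M \<Longrightarrow> sets (N w) = sets borel"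
  by (simp add: N_eq sets_superpose)

text \<open>Nothing is assumed about measurability of \<open>N\<close>; the integral is rewritten as
  a countable sum over immigrants and labels.\<close>

lemma nn_integral_N_measurable [measurable]:
  fixes f :: "real \<Rightarrow> ennreal"
  assumes f [measurable]: "f \<in> borel_measurable borel"
  shows "(\<lambda>w. \<integral>\<^sup>+ x. f x \<partial>N w) \<in> borel_measurable M"
proof -
  interpret L: sigma_finite_measure "count_space UNIV :: nat list measure"
    by (rule sigma_finite_measure_count_space)
  have "(\<lambda>w. \<Sum>j. \<integral>\<^sup>+ v. f (U j w + pos (g j w) v) * indicator {v. alive (g j w) v} v \<partial>count_space UNIV) \<in> borel_measurable M"
  proof (rule borel_measurable_suminf_order, rule L.borel_measurable_nn_integral)
    fix j
    have "(\<lambda>z. (\<lambda>v z. f (U j (fst z) + pos (g j (fst z)) v) * indicator {v. alive (g j (fst z)) v} v) (snd z) z)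
        \<in> borel_measurable (M \<Otimes>\<^sub>M count_space UNIV)"
    proof (rule measurable_compose_countable)
      fix v :: "nat list"
      have "(\<lambda>z. f (U j (fst z) + pos (g j (fst z)) v) * (if alive (g j (fst z)) v then 1 else 0)) \<in> borel_measurable (M \<Otimes>\<^sub>M count_space UNIV)"
        by measurable
      then show "(\<lambda>z. f (U j (fst z) + pos (g j (fst z)) v) * indicator {v. alive (g j (fst z)) v} v) \<in> borel_measurable (M \<Otimes>\<^sub>M count_space UNIV)"
        by (simp add: indicator_def)
    qed simp
    then show "(\<lambda>(w, v). f (U j w + pos (g j w) v) * indicator {v. alive (g j w) v} v) \<in> borel_measurable (M \<Otimes>\<^sub>M count_space UNIV)"
      by (simp add: case_prod_unfold)
  qed
  then show ?thesis
    by (rule measurable_cong[THEN iffD2, rotated])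
      (simp add: nn_integral_N[OF _ f] nn_integral_shift_cluster[OF f] nn_integral_count_space_indicator)
qed

lemma integral_N_measurable [measurable]:
  fixes f :: "real \<Rightarrow> real"
  assumes f [measurable]: "f \<in> borel_measurable borel"
  shows "(\<lambda>w. LINT x|N w. f x) \<in> borel_measurable M"
proof -
  \<comment> \<open>A Bochner integral is \<open>0\<close> when the function is not integrable,
    hence the case distinction.\<close>
  have eq: "(LINT x|N w. f x) = (if (\<integral>\<^sup>+ x. ennreal \<bar>f x\<bar> \<partial>N w) < \<infinity>
      then enn2real (\<integral>\<^sup>+ x. ennreal (f x) \<partial>N w) - enn2real (\<integral>\<^sup>+ x. ennreal (- f x) \<partial>N w) else 0)"
    if w: "w \<in> space M" for w
  proof -
    have "f \<in> borel_measurable (N w)"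
      using f by (subst measurable_cong_sets[OF sets_N[OF w] refl])
    then have "integrable (N w) f \<longleftrightarrow> (\<integral>\<^sup>+ x. ennreal \<bar>f x\<bar> \<partial>N w) < \<infinity>"
      by (simp add: integrable_iff_bounded)
    then show ?thesis
      using real_lebesgue_integral_def[of "N w" f] not_integrable_integral_eq[of "N w" f] by auto
  qed
  show ?thesis
    by (subst measurable_cong[OF eq]) measurable
qed

abbreviation N_total :: "(real \<Rightarrow> real) \<Rightarrow> 'w \<Rightarrow> ennreal" where
  "N_total q w \<equiv> \<integral>\<^sup>+ x. ennreal (q x) \<partial>N w"

lemma N_upto_tendsto:
  fixes q :: "real \<Rightarrow> real"
  assumes w: "w \<in> space M" "regular w" and q [measurable]: "q \<in> borel_measurable borel" and q_nonneg: "\<And>x. 0 \<le> q x"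
  shows "(\<lambda>k. ennreal (N_upto k q w)) \<longlonglongrightarrow> N_total q w"
    and "ennreal (N_upto k q w) \<le> N_total q w"
proof -
  let ?c = "\<lambda>j. cluster_sum q (g j w) (U j w)"
  have c: "0 \<le> ?c j" for j by (rule cluster_sum_nonneg[OF q_nonneg])
  have N: "N_total q w = (\<integral>\<^sup>+ j. ennreal (?c j) \<partial>count_space UNIV)"
    using w by (simp add: nn_integral_N nn_integral_shift_cluster_finite q_nonneg regular_def nn_integral_count_space_nat)
  have N_upto: "ennreal (N_upto k q w) = (\<integral>\<^sup>+ j. ennreal (?c j) * indicator {j. U j w \<in> B k} j \<partial>count_space UNIV)" for k
  proof -
    have "(\<integral>\<^sup>+ j. ennreal (?c j) * indicator {j. U j w \<in> B k} j \<partial>count_space UNIV) = (\<integral>\<^sup>+ j. ennreal (?c j) \<partial>count_space {j. U j w \<in> B k})"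
      by (simp add: nn_integral_count_space_indicator)
    then show ?thesis
      using w(2) c by (simp add: N_upto_def nn_integral_count_space_finite regular_def sum_ennreal)
  qed
  show "ennreal (N_upto k q w) \<le> N_total q w" for k
    unfolding N N_upto by (intro nn_integral_mono) (simp add: indicator_def)
  show "(\<lambda>k. ennreal (N_upto k q w)) \<longlonglongrightarrow> N_total q w"
    unfolding N N_upto
  proof (rule nn_integral_LIMSEQ)
    show "incseq (\<lambda>k j. ennreal (?c j) * indicator {j. U j w \<in> B k} j)"
      by (auto simp: incseq_def le_fun_def indicator_def)
    fix j
    obtain k0 :: nat where "\<bar>U j w\<bar> \<le> k0" using real_arch_simple by blast
    then have "ennreal (?c j) * indicator {j. U j w \<in> B k} j = ennreal (?c j)" if "k \<ge> k0" for k
      using that by (auto simp: indicator_def)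
    then show "(\<lambda>k. ennreal (?c j) * indicator {j. U j w \<in> B k} j) \<longlonglongrightarrow> ennreal (?c j)"
      by (intro tendsto_eventually) (auto simp: eventually_sequentially)
  qed simp
qed

text \<open>Dominated convergence along \<open>N_upto k f\<close>. The work lies in the majorant:
  Fatou's lemma for \<open>p = a * window K\<close> shows that the total \<open>V\<close> of
  \<open>p\<close> under \<open>N\<close> has a finite exponential moment. Almost sure finiteness of
  \<open>V\<close> also ensures that the integral of \<open>f\<close> against \<open>N w\<close> is
  not the default \<open>0\<close>.\<close>

lemma exp_moment_N:
  assumes f [measurable]: "f \<in> borel_measurable borel" and a: "0 \<le> a" "a < \<epsilon>" and K: "0 \<le> K"
    and f_le: "\<And>x. \<bar>f x\<bar> \<le> a * window K x"
  shows "(LINT w|M. exp (LINT x|N w. f x)) = exp (\<nu> * (LINT z|(M \<Otimes>\<^sub>M lborel). exp (C.S f z) - 1))"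
proof -
  interpret pair_sigma_finite M lborel by (rule C.pair_sigma_finite_M) unfold_locales
  define p where "p x = a * window K x" for x
  have p [measurable]: "p \<in> borel_measurable borel" unfolding p_def[abs_def] by measurable
  have p_nonneg: "0 \<le> p x" for x using a by (simp add: p_def)
  have le_\<epsilon>: "\<bar>q x\<bar> \<le> \<epsilon>" if "\<And>x. \<bar>q x\<bar> \<le> p x" for q x
    using that[of x] a by (cases "x \<in> {- K..K}") (auto simp: p_def)
  have int_exp: "integrable M (\<lambda>w. exp (cluster_sum q (g 0 w) u))"
    if "q \<in> borel_measurable borel" "\<And>x. \<bar>q x\<bar> \<le> p x" for q u
    by (rule integrable_exp_cluster_sum[OF prob_space_axioms g_branching that(1)]) (rule le_\<epsilon>[OF that(2)])
  have gf_eq: "(LINT w|M. exp (C.S q (w, u)) - 1) = gf q u - 1"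
    if "q \<in> borel_measurable borel" "\<And>x. \<bar>q x\<bar> \<le> p x" for q u
    using int_exp[OF that] by (simp add: gf_def prob_space)
  have int_S: "integrable (M \<Otimes>\<^sub>M lborel) (\<lambda>z. exp (C.S q z) - 1)"
    if "q \<in> borel_measurable borel" "\<And>x. \<bar>q x\<bar> \<le> p x" for q
    using that(1) a K by (rule C.integrable_exp_S_minus_1) (use that(2) in \<open>simp add: p_def\<close>)
  have int_gf: "integrable lborel (\<lambda>u. gf q u - 1)"
    if "q \<in> borel_measurable borel" "\<And>x. \<bar>q x\<bar> \<le> p x" for q
    using integrable_snd[of "\<lambda>w u. exp (C.S q (w, u)) - 1"] int_S[OF that] gf_eq[OF that]
    by (simp add: case_prod_unfold)
  have p_p: "\<bar>p x\<bar> \<le> p x" for x using p_nonneg by simp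
  have f_p: "\<bar>f x\<bar> \<le> p x" for x using f_le by (simp add: p_def)
  define D where "D k q = \<nu> * (LINT u|lborel. indicator (B k) u * (gf q u - 1))" for k q
  define V where "V w = N_total p w" for w
  have V_meas [measurable]: "V \<in> borel_measurable M" unfolding V_def by measurable
  \<comment> \<open>The integrand \<open>gf p u - 1\<close> is nonnegative, so its integrals over
    \<open>B k\<close> are bounded by the full integral, uniformly in \<open>k\<close>.\<close>
  have gf_p: "1 \<le> gf p u" for u
  proof -
    have "(LINT w|M. 1) \<le> gf p u"
      unfolding gf_def using cluster_sum_nonneg[OF p_nonneg]
      by (intro integral_mono int_exp[OF p p_p]) auto
    then show ?thesis by (simp add: prob_space)
  qed
  have D_p: "D k p \<le> \<nu> * (LINT u|lborel. gf p u - 1)" for k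
    unfolding D_def
  proof (intro mult_left_mono integral_mono int_gf[OF p p_p])
    show "integrable lborel (\<lambda>u. indicator (B k) u * (gf p u - 1))"
      using integrable_mult_indicator[OF _ int_gf[OF p p_p], of "B k"] by simp
  qed (use gf_p \<nu> in \<open>auto simp: indicator_def\<close>)
  \<comment> \<open>The lower limit serves Fatou's lemma. Since \<open>x \<le> exp x\<close>,
    finiteness of \<open>L w\<close> gives finiteness of \<open>V w\<close>, and then
    \<open>L w\<close> turns out to be \<open>exp (V w)\<close>.\<close>
  define L where "L w = liminf (\<lambda>k. ennreal (exp (N_upto k p w)))" for w
  have L_meas [measurable]: "L \<in> borel_measurable M" unfolding L_def by measurable
  have "(\<integral>\<^sup>+ w. L w \<partial>M) \<le> liminf (\<lambda>k. \<integral>\<^sup>+ w. ennreal (exp (N_upto k p w)) \<partial>M)"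
    unfolding L_def by (rule nn_integral_liminf) measurable
  also have "\<dots> \<le> liminf (\<lambda>k::nat. ennreal (exp (\<nu> * (LINT u|lborel. gf p u - 1))))"
    using D_p by (intro Liminf_mono always_eventually allI)
      (simp add: nn_integral_exp_N_upto[OF p le_\<epsilon>[OF p_p]] D_def ennreal_leI)
  also have "\<dots> = ennreal (exp (\<nu> * (LINT u|lborel. gf p u - 1)))"
    by (simp add: Liminf_const)
  finally have L_le: "(\<integral>\<^sup>+ w. L w \<partial>M) < \<infinity>"
    by (metis ennreal_less_top infinity_ennreal_def le_less_trans)
  then have "AE w in M. L w \<noteq> \<infinity>"
    by (intro nn_integral_noteq_infinite) auto
  then have V_fin: "AE w in M. V w < \<infinity>"
    using AE_regular AE_space
  proof eventually_elim
    case (elim w)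
    have "V w = liminf (\<lambda>k. ennreal (N_upto k p w))"
      unfolding V_def using N_upto_tendsto(1)[OF elim(3,2) p p_nonneg]
      by (intro lim_imp_Liminf[symmetric]) auto
    also have "\<dots> \<le> L w"
      unfolding L_def
    proof (intro Liminf_mono always_eventually allI ennreal_leI)
      show "N_upto k p w \<le> exp (N_upto k p w)" for k
        using exp_ge_add_one_self[of "N_upto k p w"] by linarith
    qed
    finally show ?case using elim(1) by (auto simp: less_top[symmetric] top_unique)
  qed
  have conv: "(\<lambda>k. N_upto k q w) \<longlonglongrightarrow> enn2real (N_total q w)"
    "N_total q w < \<infinity>" "N_upto k q w \<le> enn2real (V w)"
    if w: "w \<in> space M" "regular w" "V w < \<infinity>" and q: "q \<in> borel_measurable borel" "\<And>x. 0 \<le> q x" "\<And>x. q x \<le> p x" for w q k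
  proof -
    have "N_total q w \<le> V w"
      unfolding V_def by (intro nn_integral_mono ennreal_leI q(3))
    then show fin: "N_total q w < \<infinity>" using w(3) by (rule le_less_trans)
    have pos: "0 \<le> N_upto k q w" for k
      unfolding N_upto_def by (intro sum_nonneg cluster_sum_nonneg q(2))
    have "(\<lambda>k. enn2real (ennreal (N_upto k q w))) \<longlonglongrightarrow> enn2real (N_total q w)"
      using fin N_upto_tendsto(1)[OF w(1,2) q(1,2)] by (intro tendsto_enn2real) auto
    then show "(\<lambda>k. N_upto k q w) \<longlonglongrightarrow> enn2real (N_total q w)" using pos by simp
    have "enn2real (ennreal (N_upto k q w)) \<le> enn2real (V w)"
      using N_upto_tendsto(2)[OF w(1,2) q(1,2), of k] \<open>N_total q w \<le> V w\<close> w(3)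
      by (intro enn2real_mono) auto
    then show "N_upto k q w \<le> enn2real (V w)" using pos by simp
  qed
  \<comment> \<open>The convergence statement \<open>conv\<close> is for nonnegative functions below
    \<open>p\<close>, which both parts of \<open>f\<close> are.\<close>
  have split: "N_upto k f w = N_upto k (\<lambda>x. max 0 (f x)) w - N_upto k (\<lambda>x. max 0 (- f x)) w" for k w
    unfolding N_upto_def cluster_sum_def sum_subtractf[symmetric] by (intro sum.cong refl) auto
  have plus: "0 \<le> max 0 (f x)" "max 0 (f x) \<le> p x" "0 \<le> max 0 (- f x)" "max 0 (- f x) \<le> p x" for x
    using f_p[of x] p_nonneg[of x] by auto
  have "(\<lambda>k. LINT w|M. exp (N_upto k f w)) \<longlonglongrightarrow> (LINT w|M. exp (LINT x|N w. f x))"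
  proof (rule integral_dominated_convergence[where w = "\<lambda>w. exp (enn2real (V w))"])
    show "integrable M (\<lambda>w. exp (enn2real (V w)))"
    proof (rule integrableI_bounded)
      have "(\<integral>\<^sup>+ w. ennreal (norm (exp (enn2real (V w)))) \<partial>M) = (\<integral>\<^sup>+ w. L w \<partial>M)"
      proof (rule nn_integral_cong_AE)
        show "AE w in M. ennreal (norm (exp (enn2real (V w)))) = L w"
          using V_fin AE_regular AE_space
        proof eventually_elim
          case (elim w)
          have "(\<lambda>k. ennreal (exp (N_upto k p w))) \<longlonglongrightarrow> ennreal (exp (enn2real (V w)))"
            using conv(1)[OF elim(3,2,1) p p_nonneg] by (intro tendsto_ennrealI tendsto_exp) (simp add: V_def)
          then have "L w = ennreal (exp (enn2real (V w)))"
            unfolding L_def by (rule lim_imp_Liminf[rotated]) simp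
          then show ?case by simp
        qed
      qed
      then show "(\<integral>\<^sup>+ w. ennreal (norm (exp (enn2real (V w)))) \<partial>M) < \<infinity>" using L_le by simp
    qed measurable
    show "AE w in M. (\<lambda>k. exp (N_upto k f w)) \<longlonglongrightarrow> exp (LINT x|N w. f x)"
      using V_fin AE_regular AE_space
    proof eventually_elim
      case (elim w)
      note c = conv(1)[OF elim(3,2,1) _ plus(1,2)] conv(1)[OF elim(3,2,1) _ plus(3,4)]
      have fN: "f \<in> borel_measurable (N w)"
        using f by (subst measurable_cong_sets[OF sets_N[OF elim(3)] refl])
      have "N_total (\<lambda>x. \<bar>f x\<bar>) w \<le> V w"
        unfolding V_def by (intro nn_integral_mono ennreal_leI f_p)
      then have "integrable (N w) f"
        using elim(1) fN by (intro integrableI_bounded) auto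
      then have "(LINT x|N w. f x) = enn2real (N_total (\<lambda>x. max 0 (f x)) w) - enn2real (N_total (\<lambda>x. max 0 (- f x)) w)"
        by (simp add: real_lebesgue_integral_def)
      then show ?case unfolding split by (simp only:) (intro tendsto_intros c, measurable)
    qed
    show "AE w in M. norm (exp (N_upto k f w)) \<le> exp (enn2real (V w))" for k
      using V_fin AE_regular AE_space
    proof eventually_elim
      case (elim w)
      have "N_upto k (\<lambda>x. max 0 (f x)) w \<le> enn2real (V w)"
        by (rule conv(3)[OF elim(3,2,1) _ plus(1,2)]) measurable
      moreover have "0 \<le> N_upto k (\<lambda>x. max 0 (- f x)) w"
        unfolding N_upto_def by (intro sum_nonneg cluster_sum_nonneg) simp
      ultimately show ?case by (simp add: split)
    qed
  qed measurable
  moreover have "(LINT w|M. exp (N_upto k f w)) = exp (D k f)" for k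
    unfolding D_def
    by (subst integral_eq_nn_integral) (simp_all add: nn_integral_exp_N_upto[OF f le_\<epsilon>[OF f_p]])
  moreover have "(\<lambda>k. exp (D k f)) \<longlonglongrightarrow> exp (\<nu> * (LINT u|lborel. gf f u - 1))"
    unfolding D_def
  proof (intro tendsto_intros integral_dominated_convergence[where w = "\<lambda>u. \<bar>gf f u - 1\<bar>"])
    show "integrable lborel (\<lambda>u. \<bar>gf f u - 1\<bar>)" using int_gf[OF f f_p] by simp
    show "AE u in lborel. (\<lambda>k. indicator (B k) u * (gf f u - 1)) \<longlonglongrightarrow> gf f u - 1"
    proof (rule AE_I2)
      fix u :: real
      obtain k0 :: nat where k0: "\<bar>u\<bar> \<le> k0" using real_arch_simple by blast
      have "indicator (B k) u * (gf f u - 1) = gf f u - 1" if "k \<ge> k0" for k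
        using k0 that by (auto simp: indicator_def)
      then show "(\<lambda>k. indicator (B k) u * (gf f u - 1)) \<longlonglongrightarrow> gf f u - 1"
        by (intro tendsto_eventually) (auto simp: eventually_sequentially)
    qed
  qed (auto simp: indicator_def)
  moreover have "(LINT u|lborel. gf f u - 1) = (LINT z|(M \<Otimes>\<^sub>M lborel). exp (C.S f z) - 1)"
    using integral_snd'[OF int_S[OF f f_p]] by (simp only: gf_eq[OF f f_p])
  ultimately show ?thesis by (simp add: LIMSEQ_unique)
qed

end

section \<open>The third cumulant measure\<close>

lemma test_function_obtain:
  assumes "test_function f"
  obtains b K where "0 < b" "0 \<le> K" "\<And>x. \<bar>f x\<bar> \<le> b * window K x"
proof -
  obtain b where b: "0 < b" "\<And>x. \<bar>f x\<bar> \<le> b"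
    using assms unfolding test_function_def bounded_pos by auto
  have "bounded {x. f x \<noteq> 0}"
    using assms by (simp add: test_function_def)
  then obtain K where K: "0 < K" "\<And>x. f x \<noteq> 0 \<Longrightarrow> \<bar>x\<bar> \<le> K"
    unfolding bounded_pos by auto
  have "\<bar>f x\<bar> \<le> b * window K x" for x
    using b(2)[of x] K(2)[of x] by (cases "f x = 0") (auto simp: indicator_def b(1) less_imp_le)
  with b K that show ?thesis by (meson less_imp_le)
qed

lemma test_functions_obtain:
  fixes f :: "nat \<Rightarrow> real \<Rightarrow> real"
  assumes "\<And>j. j < n \<Longrightarrow> test_function (f j)"
  obtains b K where "0 < b" "0 \<le> K" "\<And>j x. j < n \<Longrightarrow> \<bar>f j x\<bar> \<le> b * window K x"
proof -
  have "\<exists>b K. 0 < b \<and> 0 \<le> K \<and> (\<forall>j<n. \<forall>x. \<bar>f j x\<bar> \<le> b * window K x)"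
    using assms
  proof (induction n)
    case 0
    show ?case by (intro exI[of _ 1]) auto
  next
    case (Suc n)
    then obtain b K where bK: "0 < b" "0 \<le> K" "\<And>j x. j < n \<Longrightarrow> \<bar>f j x\<bar> \<le> b * window K x"
      by (metis less_Suc_eq)
    obtain b' K' where bK': "0 < b'" "0 \<le> K'" "\<And>x. \<bar>f n x\<bar> \<le> b' * window K' x"
      using test_function_obtain[OF Suc.prems[of n]] by blast
    have "a * window L x \<le> max b b' * window (max K K') x" if "0 < a" "a \<le> max b b'" "L \<le> max K K'" for a L x
      using that by (auto simp: indicator_def)
    then have "\<bar>f j x\<bar> \<le> max b b' * window (max K K') x" if "j < Suc n" for j x
      using that bK(1) bK'(1) bK(3)[of j x] bK'(3)[of x] by (metis less_Suc_eq max.cobounded1 max.cobounded2 order_trans)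
    then show ?case using bK bK' by (intro exI[of _ "max b b'"] exI[of _ "max K K'"]) auto
  qed
  with that show ?thesis by blast
qed

lemma prod_lessThan_3: "(\<Prod>j<3. f j) = f 0 * f 1 * f (2::nat)" for f :: "nat \<Rightarrow> 'a::comm_monoid_mult"
  by (simp add: numeral_3_eq_3 numeral_2_eq_2 lessThan_Suc mult_ac)

context cluster_process
begin

text \<open>The logarithm in \<open>K_comp\<close> cancels the exponential of the Poisson formula,
  and \<open>mixed_partial_3\<close> applies. The majorant is a window sum and not the cluster size,
  because the latter is not integrable over all root positions.\<close>

lemma joint_cumulant_3:
  assumes f: "\<And>j. j < 3 \<Longrightarrow> test_function (f j)"
  shows "joint_cumulant M N 3 f = \<nu> * (LINT z|(M \<Otimes>\<^sub>M lborel). (\<Prod>j<3. C.S (f j) z))"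
proof -
  obtain b K where b: "0 < b" and K: "0 \<le> K" and f_le: "\<And>j x. j < 3 \<Longrightarrow> \<bar>f j x\<bar> \<le> b * window K x"
    using test_functions_obtain[of 3 f] f by blast
  have fm [measurable]: "f j \<in> borel_measurable borel" if "j < 3" for j
    using f[OF that] by (simp add: test_function_def)
  \<comment> \<open>Then \<open>c * ?W\<close> is at most \<open>\<epsilon> / 2\<close> times the
    cluster size, and for small \<open>s\<close> the combined test function is at most
    \<open>3 * (c / 6) * b = \<epsilon> / 4\<close> on the window, below the threshold
    \<open>\<epsilon>\<close> of \<open>exp_moment_N\<close>.\<close>
  define c where "c = \<epsilon> / (2 * b)"
  have c: "0 < c" "c * b = \<epsilon> / 2" using \<epsilon>_pos b by (auto simp: c_def)
  let ?W = "\<lambda>z. b * C.S (window K) z"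
  have W_nonneg: "0 \<le> cluster_sum (window K) \<gamma> u" for \<gamma> u
    by (rule cluster_sum_nonneg) simp
  interpret Q: exponential_family "M \<Otimes>\<^sub>M lborel" "\<lambda>j. C.S (f j)" ?W c
  proof
    show "integrable (M \<Otimes>\<^sub>M lborel) (\<lambda>z. ?W z * exp (c * ?W z))"
    proof (rule C.integrable_pair_lborel[where v = "\<lambda>w. b * exp (\<epsilon> / 2 * C.Z w)" and K = K])
      show "integrable M (\<lambda>w. C.Z w * (b * exp (\<epsilon> / 2 * C.Z w)))"
        using integrable_mult_right[OF C.integrable_Z_power_exp[of "\<epsilon> / 2" 1], of b] \<epsilon>_pos by (simp add: mult_ac)
      fix w u
      have "c * (b * cluster_sum (window K) (g 0 w) u) \<le> \<epsilon> / 2 * C.Z w"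
        using \<epsilon>_pos cluster_sum_window_le[of K "g 0 w" u] unfolding mult.assoc[symmetric] c(2) by simp
      then show "norm (?W (w, u) * exp (c * ?W (w, u))) \<le> cluster_sum (window K) (g 0 w) u * (b * exp (\<epsilon> / 2 * C.Z w))"
        using b W_nonneg[of "g 0 w" u] by (simp add: abs_mult mult_left_mono mult_ac)
    qed (use b K in auto)
    show "\<bar>C.S (f j) z\<bar> \<le> ?W z" if "j < 3" for j z
      by (rule abs_cluster_sum_le_window[OF f_le[OF that]])
  qed (use fm c in auto)
  have "K_comp M N (\<lambda>x. \<Sum>j<3. s j * f j x) = \<nu> * (LINT z|(M \<Otimes>\<^sub>M lborel). exp (Q.lin s z) - 1)"
    if s: "small (c / 6) s" for s
  proof -
    let ?f = "\<lambda>x. \<Sum>j<3. s j * f j x"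
    have f_s: "\<bar>?f x\<bar> \<le> \<epsilon> / 4 * window K x" for x
    proof -
      have "\<bar>?f x\<bar> \<le> (\<Sum>j<(3::nat). c / 6 * (b * window K x))"
        by (rule order_trans[OF sum_abs], unfold abs_mult, intro sum_mono mult_mono)
          (use small_abs[OF s] f_le c in \<open>auto intro: less_imp_le\<close>)
      also have "\<dots> = c * b / 2 * window K x" by simp
      finally show ?thesis unfolding c(2) by simp
    qed
    have "?f \<in> borel_measurable borel"
      by (intro borel_measurable_sum borel_measurable_times fm) auto
    from exp_moment_N[OF this _ _ K f_s] \<epsilon>_pos show ?thesis
      by (simp add: K_comp_def Q.lin_def cluster_sum_linear)
  qed
  then show ?thesis
    unfolding joint_cumulant_def by (rule Q.mixed_partial_3)
qed

section \<open>The measure of triples of individuals in one cluster\<close>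

definition alive3 :: "'w \<Rightarrow> nat list \<times> nat list \<times> nat list \<Rightarrow> bool" where
  "alive3 w = (\<lambda>(u, v, v'). alive (g 0 w) u \<and> alive (g 0 w) v \<and> alive (g 0 w) v')"

text \<open>Ordered triples, repetitions included, each of weight \<open>\<nu>\<close>; the total
  mass is \<open>\<nu>\<close> times the third moment of the cluster size. The reduced cumulant
  measure will be an image of this measure, so that its finiteness is inherited.\<close>

definition triples :: "('w \<times> nat list \<times> nat list \<times> nat list) measure" where
  "triples = density (M \<Otimes>\<^sub>M count_space UNIV) (\<lambda>z. ennreal (if alive3 (fst z) (snd z) then \<nu> else 0))"

lemma measurable_pair_countable:
  fixes F :: "'w \<times> 'i::countable \<Rightarrow> 'b"
  assumes F: "\<And>t. (\<lambda>w. F (w, t)) \<in> measurable M L"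
  shows "F \<in> measurable (M \<Otimes>\<^sub>M count_space UNIV) L"
proof -
  have "(\<lambda>z. (\<lambda>t z. F (fst z, t)) (snd z) z) \<in> measurable (M \<Otimes>\<^sub>M count_space UNIV) L"
    by (rule measurable_compose_countable[OF measurable_compose[OF measurable_fst F] measurable_snd])
  then show ?thesis by simp
qed

lemma alive3_measurable [measurable]: "Measurable.pred M (\<lambda>w. alive3 w t)"
  unfolding alive3_def split_beta by measurable

lemma alive3_measurable' [measurable]: "Measurable.pred (M \<Otimes>\<^sub>M count_space UNIV) (\<lambda>z. alive3 (fst z) (snd z))"
  by (rule measurable_pair_countable) simp

lemma alive3_Collect: "{t. alive3 w t} = {u. alive (g 0 w) u} \<times> {u. alive (g 0 w) u} \<times> {u. alive (g 0 w) u}"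
  by (auto simp: alive3_def)

lemma AE_finite_alive3: "AE w in M. finite {t. alive3 w t}"
  using AE_finite_cluster[OF prob_space_axioms g_branching[of 0]]
  by eventually_elim (simp add: alive3_Collect)

lemma sum_alive3:
  fixes a b c :: "nat list \<Rightarrow> 'b::comm_semiring_1"
  shows "(\<Sum>t | alive3 w t. case t of (u, v, v') \<Rightarrow> a u * b v * c v')
    = (\<Sum>u | alive (g 0 w) u. a u) * (\<Sum>u | alive (g 0 w) u. b u) * (\<Sum>u | alive (g 0 w) u. c u)"
  unfolding alive3_Collect
  by (simp add: sum.cartesian_product[symmetric] mult.assoc)
    (simp add: sum_distrib_left[symmetric] sum_distrib_right[symmetric])

lemma sigma_finite_labels: "sigma_finite_measure (count_space UNIV :: (nat list \<times> nat list \<times> nat list) measure)"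
  by (rule sigma_finite_measure_count_space)

sublocale triples: finite_measure triples
proof (rule finite_measureI)
  interpret L: sigma_finite_measure "count_space UNIV :: (nat list \<times> nat list \<times> nat list) measure"
    by (rule sigma_finite_labels)
  have "emeasure triples (space triples) = (\<integral>\<^sup>+ z. ennreal (if alive3 (fst z) (snd z) then \<nu> else 0) \<partial>(M \<Otimes>\<^sub>M count_space UNIV))"
    unfolding triples_def by (subst emeasure_density) (auto intro!: nn_integral_cong)
  also have "\<dots> = (\<integral>\<^sup>+ w. (\<integral>\<^sup>+ t. ennreal (if alive3 w t then \<nu> else 0) \<partial>count_space UNIV) \<partial>M)"
    by (subst L.nn_integral_fst[symmetric]) auto
  also have "\<dots> = (\<integral>\<^sup>+ w. ennreal (\<nu> * C.Z w ^ 3) \<partial>M)"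
  proof (rule nn_integral_cong_AE)
    show "AE w in M. (\<integral>\<^sup>+ t. ennreal (if alive3 w t then \<nu> else 0) \<partial>count_space UNIV) = ennreal (\<nu> * C.Z w ^ 3)"
      using AE_finite_alive3
    proof eventually_elim
      case (elim w)
      have "(\<integral>\<^sup>+ t. ennreal (if alive3 w t then \<nu> else 0) \<partial>count_space UNIV) = (\<integral>\<^sup>+ t. ennreal \<nu> * indicator {t. alive3 w t} t \<partial>count_space UNIV)"
        by (intro nn_integral_cong) auto
      also have "\<dots> = ennreal \<nu> * of_nat (card {t. alive3 w t})"
        using elim by (simp add: nn_integral_cmult_indicator emeasure_count_space_finite)
      also have "card {t. alive3 w t} = cluster_size (g 0 w) ^ 3"
        by (simp add: alive3_Collect card_cartesian_product cluster_size_def power3_eq_cube)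
      finally show ?case
        using \<nu> by (simp add: ennreal_of_nat_eq_real_of_nat ennreal_mult' flip: of_nat_power)
    qed
  qed
  also have "\<dots> = ennreal (LINT w|M. \<nu> * C.Z w ^ 3)"
    using \<nu> by (intro nn_integral_eq_integral integrable_mult_right C.integrable_Z_power) auto
  finally show "emeasure triples (space triples) \<noteq> \<infinity>" by simp
qed

lemma integral_triples:
  fixes F :: "'w \<times> nat list \<times> nat list \<times> nat list \<Rightarrow> 'b::{banach, second_countable_topology}"
  assumes F: "\<And>t. (\<lambda>w. F (w, t)) \<in> borel_measurable M" and F_le: "\<And>z. norm (F z) \<le> b"
  shows "(LINT z|triples. F z) = \<nu> *\<^sub>R (LINT w|M. (\<Sum>t | alive3 w t. F (w, t)))"
proof -
  let ?L = "count_space UNIV :: (nat list \<times> nat list \<times> nat list) measure"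
  interpret pair_sigma_finite M ?L by (rule C.pair_sigma_finite_M[OF sigma_finite_labels])
  have [measurable]: "F \<in> borel_measurable (M \<Otimes>\<^sub>M ?L)"
    by (rule measurable_pair_countable[OF F])
  then have Fm: "F \<in> borel_measurable triples" by (simp add: triples_def)
  have int: "integrable triples F"
    by (rule triples.integrable_const_bound[OF _ Fm, of b]) (use F_le in auto)
  let ?G = "\<lambda>z. (if alive3 (fst z) (snd z) then \<nu> else 0) *\<^sub>R F z"
  have G: "integrable (M \<Otimes>\<^sub>M ?L) ?G"
    using int unfolding triples_def using \<nu> by (subst (asm) integrable_density) auto
  have "(LINT z|triples. F z) = (LINT z|(M \<Otimes>\<^sub>M ?L). ?G z)"
    unfolding triples_def using \<nu> by (intro integral_density) auto
  also have "\<dots> = (LINT w|M. (LINT t|?L. ?G (w, t)))"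
    by (rule integral_fst'[OF G, symmetric])
  also have "\<dots> = (LINT w|M. \<nu> *\<^sub>R (\<Sum>t | alive3 w t. F (w, t)))"
  proof (rule integral_cong_AE)
    show "(\<lambda>w. LINT t|?L. ?G (w, t)) \<in> borel_measurable M"
      by (rule borel_measurable_integrable[OF integrable_fst'[OF G]])
    have "(\<lambda>w. \<Sum>t | alive3 w t. F (w, t)) \<in> borel_measurable M"
      by (rule borel_measurable_sum_random_set) (use F in auto)
    then show "(\<lambda>w. \<nu> *\<^sub>R (\<Sum>t | alive3 w t. F (w, t))) \<in> borel_measurable M" by simp
    \<comment> \<open>Finiteness is needed here: for infinitely many triples the sum on the right
      would be \<open>0\<close> by convention.\<close>
    show "AE w in M. (LINT t|?L. ?G (w, t)) = \<nu> *\<^sub>R (\<Sum>t | alive3 w t. F (w, t))"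
      using AE_finite_alive3
    proof eventually_elim
      case (elim w)
      have sub: "{t. ?G (w, t) \<noteq> 0} \<subseteq> {t. alive3 w t}" by auto
      have "(LINT t|?L. ?G (w, t)) = (\<Sum>t | t \<in> UNIV \<and> ?G (w, t) \<noteq> 0. ?G (w, t))"
        by (rule lebesgue_integral_count_space_finite_support) (use finite_subset[OF sub elim] in simp)
      also have "\<dots> = (\<Sum>t | alive3 w t. ?G (w, t))"
        by (rule sum.mono_neutral_left[OF elim]) auto
      finally show ?case by (simp add: scaleR_sum_right)
    qed
  qed
  finally show "(LINT z|triples. F z) = \<nu> *\<^sub>R (LINT w|M. (\<Sum>t | alive3 w t. F (w, t)))" by simp
qed

end

section \<open>Uniqueness of the cumulant measure and of its reduction\<close>

abbreviation vectors :: "nat set \<Rightarrow> (nat \<Rightarrow> real) measure" where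
  "vectors I \<equiv> Pi\<^sub>M I (\<lambda>_. borel)"

lemma test_function_indicator:
  assumes "A \<in> sets borel" "bounded A"
  shows "test_function (indicator A)"
proof -
  have "{x. indicator A x \<noteq> (0 :: real)} = A" by (auto simp: indicator_def)
  then show ?thesis
    using assms by (auto simp: test_function_def bounded_iff intro!: exI[of _ 1])
qed

text \<open>Indicators of bounded Borel sets are test functions, and their product is the indicator
  of the box, because points of the product space are extensional.\<close>

lemma complete_cumulant_measure_box:
  assumes \<gamma>: "complete_cumulant_measure M N n \<gamma>"
    and A: "\<And>j. j < n \<Longrightarrow> A j \<in> sets borel" "\<And>j. j < n \<Longrightarrow> bounded (A j)"
  shows "emeasure \<gamma> (Pi\<^sub>E {..<n} A) = ennreal (joint_cumulant M N n (\<lambda>j. indicator (A j)))"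
proof -
  have sets: "sets \<gamma> = sets (vectors {..<n})"
    using \<gamma> by (simp add: complete_cumulant_measure_def)
  have box: "Pi\<^sub>E {..<n} A \<in> sets \<gamma>"
    unfolding sets using A by (intro sets_PiM_I_finite) auto
  have eq: "(\<Prod>j<n. indicator (A j) (t j)) = indicat_real (Pi\<^sub>E {..<n} A) t" if t: "t \<in> space \<gamma>" for t
  proof -
    have "t \<in> extensional {..<n}"
      using t sets_eq_imp_space_eq[OF sets] by (simp add: space_PiM PiE_def)
    show ?thesis
    proof (cases "\<forall>j<n. t j \<in> A j")
      case True
      then show ?thesis using \<open>t \<in> extensional {..<n}\<close> by (simp add: PiE_def Pi_def)
    next
      case False
      then obtain j where "j < n" "t j \<notin> A j" by auto
      then have "(\<Prod>j<n. indicat_real (A j) (t j)) = 0" "t \<notin> Pi\<^sub>E {..<n} A"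
        by (auto intro!: prod_zero bexI[of _ j])
      then show ?thesis by simp
    qed
  qed
  have "\<forall>j<n. test_function (indicator (A j))"
    using A by (simp add: test_function_indicator)
  then have int: "integrable \<gamma> (\<lambda>t. \<Prod>j<n. indicat_real (A j) (t j))"
    and val: "(LINT t|\<gamma>. (\<Prod>j<n. indicator (A j) (t j))) = joint_cumulant M N n (\<lambda>j. indicator (A j))"
    using \<gamma>[unfolded complete_cumulant_measure_def, THEN conjunct2, rule_format, of "\<lambda>j. indicator (A j)"]
    by auto
  have "emeasure \<gamma> (Pi\<^sub>E {..<n} A) = (\<integral>\<^sup>+ t. ennreal (\<Prod>j<n. indicat_real (A j) (t j)) \<partial>\<gamma>)"
  proof -
    have "(\<integral>\<^sup>+ t. ennreal (\<Prod>j<n. indicat_real (A j) (t j)) \<partial>\<gamma>) = (\<integral>\<^sup>+ t. indicator (Pi\<^sub>E {..<n} A) t \<partial>\<gamma>)"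
      by (intro nn_integral_cong) (simp only: eq ennreal_indicator)
    then show ?thesis using box by simp
  qed
  also have "\<dots> = ennreal (LINT t|\<gamma>. (\<Prod>j<n. indicator (A j) (t j)))"
    using int by (intro nn_integral_eq_integral) (auto intro!: prod_nonneg)
  finally show ?thesis unfolding val .
qed

text \<open>Boxes form an intersection-stable generator. A box is the increasing union of its
  intersections with the cubes over \<open>W k\<close>, whose masses the cumulants determine; the
  cubes themselves have finite mass and exhaust the space.\<close>

lemma complete_cumulant_measure_unique:
  assumes \<gamma>: "complete_cumulant_measure M N n \<gamma>" and \<gamma>': "complete_cumulant_measure M N n \<gamma>'"
  shows "\<gamma> = \<gamma>'"
proof -
  have sets: "sets \<gamma> = sets (vectors {..<n})" "sets \<gamma>' = sets (vectors {..<n})"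
    using assms by (auto simp: complete_cumulant_measure_def)
  define W :: "nat \<Rightarrow> real set" where "W k = {- real k..real k}" for k
  have W: "W k \<in> sets borel" "bounded (W k)" for k by (auto simp: W_def)
  have W_mono: "W k \<subseteq> W l" if "k \<le> l" for k l using that by (auto simp: W_def)
  have cover: "\<exists>k. \<forall>j<n. t j \<in> W k" for t :: "nat \<Rightarrow> real"
  proof -
    obtain k :: nat where k: "(\<Sum>j<n. \<bar>t j\<bar>) \<le> k" using real_arch_simple by blast
    have "t j \<in> W k" if "j < n" for j
    proof -
      have "\<bar>t j\<bar> \<le> (\<Sum>j<n. \<bar>t j\<bar>)"
        using that by (intro member_le_sum) auto
      with k have "\<bar>t j\<bar> \<le> k" by linarith
      then show ?thesis by (auto simp: W_def)
    qed
    then show ?thesis by blast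
  qed
  have box: "emeasure \<mu> (Pi\<^sub>E {..<n} A) = (SUP k. ennreal (joint_cumulant M N n (\<lambda>j. indicator (A j \<inter> W k))))"
    if A: "\<And>j. j < n \<Longrightarrow> A j \<in> sets borel" and \<mu>: "complete_cumulant_measure M N n \<mu>" for A \<mu>
  proof -
    have s: "sets \<mu> = sets (vectors {..<n})"
      using \<mu> by (simp add: complete_cumulant_measure_def)
    have "Pi\<^sub>E {..<n} A = (\<Union>k. Pi\<^sub>E {..<n} (\<lambda>j. A j \<inter> W k))"
    proof (intro equalityI subsetI)
      fix t assume t: "t \<in> Pi\<^sub>E {..<n} A"
      obtain k where "\<forall>j<n. t j \<in> W k" using cover by blast
      with t show "t \<in> (\<Union>k. Pi\<^sub>E {..<n} (\<lambda>j. A j \<inter> W k))" by (auto simp: PiE_iff)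
    qed (auto simp: PiE_iff)
    moreover have "emeasure \<mu> (\<Union>k. Pi\<^sub>E {..<n} (\<lambda>j. A j \<inter> W k)) = (SUP k. emeasure \<mu> (Pi\<^sub>E {..<n} (\<lambda>j. A j \<inter> W k)))"
    proof (rule SUP_emeasure_incseq[symmetric])
      show "range (\<lambda>k. Pi\<^sub>E {..<n} (\<lambda>j. A j \<inter> W k)) \<subseteq> sets \<mu>"
        unfolding s using A W(1) by (auto intro!: sets_PiM_I_finite)
      show "incseq (\<lambda>k. Pi\<^sub>E {..<n} (\<lambda>j. A j \<inter> W k))"
        unfolding incseq_def using W_mono by (intro allI impI PiE_mono) auto
    qed
    moreover have "emeasure \<mu> (Pi\<^sub>E {..<n} (\<lambda>j. A j \<inter> W k)) = ennreal (joint_cumulant M N n (\<lambda>j. indicator (A j \<inter> W k)))" for k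
      using A W by (intro complete_cumulant_measure_box[OF \<mu>]) (auto intro: bounded_subset)
    ultimately show ?thesis by simp
  qed
  show ?thesis
  proof (rule measure_eqI_PiM_finite[where I = "{..<n}" and M = "\<lambda>_. borel" and A = "\<lambda>k. Pi\<^sub>E {..<n} (\<lambda>_. W k)"])
    show "emeasure \<gamma> (Pi\<^sub>E {..<n} A) = emeasure \<gamma>' (Pi\<^sub>E {..<n} A)"
      if "\<And>j. j \<in> {..<n} \<Longrightarrow> A j \<in> sets borel" for A
      using box[OF _ \<gamma>, of A] box[OF _ \<gamma>', of A] that by simp
    show "range (\<lambda>k. Pi\<^sub>E {..<n} (\<lambda>_. W k)) \<subseteq> prod_algebra {..<n} (\<lambda>_. borel)"
      using W(1) by (auto intro!: prod_algebraI_finite)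
    show "(\<Union>k. Pi\<^sub>E {..<n} (\<lambda>_. W k)) = space (vectors {..<n})"
    proof (intro equalityI subsetI)
      fix t :: "nat \<Rightarrow> real" assume t: "t \<in> space (vectors {..<n})"
      obtain k where "\<forall>j<n. t j \<in> W k" using cover by blast
      with t show "t \<in> (\<Union>k. Pi\<^sub>E {..<n} (\<lambda>_. W k))" by (auto simp: space_PiM PiE_iff)
    qed (auto simp: space_PiM PiE_iff)
    show "emeasure \<gamma> (Pi\<^sub>E {..<n} (\<lambda>_. W k)) \<noteq> \<infinity>" for k
      using W by (simp add: complete_cumulant_measure_box[OF \<gamma>])
  qed (use sets in auto)
qed

text \<open>The defining identity is tested on functions of the displacements, localised by
  restricting coordinate \<open>0\<close> to an interval of length one; the outer integral then
  contributes the factor \<open>1\<close> and the mass of \<open>A\<close> remains.\<close>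

lemma reduced_measure_unique:
  assumes \<rho>: "reduced_measure n \<gamma> \<rho>" and \<rho>': "reduced_measure n \<gamma> \<rho>'" and n: "0 < n"
  shows "\<rho> = \<rho>'"
proof (rule measure_eqI)
  show sets: "sets \<rho> = sets \<rho>'" using assms by (simp add: reduced_measure_def)
  fix A assume "A \<in> sets \<rho>"
  then have A: "A \<in> sets (vectors {1..<n})" using \<rho> by (simp add: reduced_measure_def)
  define F :: "(nat \<Rightarrow> real) \<Rightarrow> ennreal" where
    "F t = indicator {0..1} (t 0) * indicator A (\<lambda>j\<in>{1..<n}. t j - t 0)" for t
  have [measurable]: "(\<lambda>t. t 0) \<in> borel_measurable (vectors {..<n})"
    using n by (intro measurable_component_singleton) simp
  have [measurable]: "(\<lambda>t. \<lambda>j\<in>{1..<n}. t j - t 0) \<in> measurable (vectors {..<n}) (vectors {1..<n})"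
    by (intro measurable_restrict borel_measurable_diff measurable_component_singleton) (use n in auto)
  have F: "F \<in> borel_measurable (vectors {..<n})"
    unfolding F_def[abs_def] using A by measurable
  have "(\<integral>\<^sup>+ t. F t \<partial>\<gamma>) = emeasure \<mu> A" if \<mu>: "reduced_measure n \<gamma> \<mu>" for \<mu>
  proof -
    have s: "sets \<mu> = sets (vectors {1..<n})" using \<mu> by (simp add: reduced_measure_def)
    have "(\<integral>\<^sup>+ t. F t \<partial>\<gamma>) = (\<integral>\<^sup>+ t0. (\<integral>\<^sup>+ \<tau>. F (\<lambda>j\<in>{..<n}. if j = 0 then t0 else t0 + \<tau> j) \<partial>\<mu>) \<partial>lborel)"
      using \<mu> F unfolding reduced_measure_def by blast
    also have "\<dots> = (\<integral>\<^sup>+ t0. (\<integral>\<^sup>+ \<tau>. indicator {0..1 :: real} t0 * indicator A \<tau> \<partial>\<mu>) \<partial>lborel)"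
    proof (intro nn_integral_cong)
      fix t0 :: real and \<tau> assume "\<tau> \<in> space \<mu>"
      then have "\<tau> \<in> extensional {1..<n}"
        using sets_eq_imp_space_eq[OF s] by (simp add: space_PiM PiE_def)
      \<comment> \<open>Subtracting \<open>t0\<close> recovers \<open>\<tau>\<close> exactly, since
        \<open>\<tau>\<close> is extensional on the indices from \<open>1\<close>.\<close>
      then have "(\<lambda>j\<in>{1..<n}. (\<lambda>j\<in>{..<n}. if j = 0 then t0 else t0 + \<tau> j) j - t0) = \<tau>"
        by (auto simp: extensional_def fun_eq_iff)
      then show "F (\<lambda>j\<in>{..<n}. if j = 0 then t0 else t0 + \<tau> j) = indicator {0..1} t0 * indicator A \<tau>"
        using n by (simp add: F_def)
    qed
    also have "\<dots> = emeasure \<mu> A"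
      using A s by (simp add: nn_integral_cmult nn_integral_multc)
    finally show ?thesis .
  qed
  from this[OF \<rho>] this[OF \<rho>'] show "emeasure \<rho> A = emeasure \<rho>' A" by simp
qed

section \<open>Construction of the reduced measure and its transform\<close>

context cluster_process
begin

definition displacements :: "'w \<times> nat list \<times> nat list \<times> nat list \<Rightarrow> nat \<Rightarrow> real" where
  "displacements = (\<lambda>(w, u, v, v'). \<lambda>j\<in>{1..<3}.
    (if j = 1 then pos (g 0 w) v else pos (g 0 w) v') - pos (g 0 w) u)"

definition reduced_cumulant :: "(nat \<Rightarrow> real) measure" where
  "reduced_cumulant = distr triples (vectors {1..<3}) displacements"

definition place :: "real \<times> (nat \<Rightarrow> real) \<Rightarrow> nat \<Rightarrow> real" where
  "place = (\<lambda>(t, \<tau>). \<lambda>j\<in>{..<3}. if j = 0 then t else t + \<tau> j)"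

definition third_cumulant :: "(nat \<Rightarrow> real) measure" where
  "third_cumulant = distr (lborel \<Otimes>\<^sub>M reduced_cumulant) (vectors {..<3}) place"

lemma measurable_triples:
  assumes "\<And>t. (\<lambda>w. F (w, t)) \<in> measurable M L"
  shows "F \<in> measurable triples L"
  using measurable_pair_countable[OF assms] by (simp add: triples_def)

lemma displacements_measurable [measurable]: "displacements \<in> measurable triples (vectors {1..<3})"
proof (rule measurable_triples)
  fix t :: "nat list \<times> nat list \<times> nat list"
  obtain u v v' where t: "t = (u, v, v')" by (cases t)
  show "(\<lambda>w. displacements (w, t)) \<in> measurable M (vectors {1..<3})"
    unfolding t displacements_def prod.case by (rule measurable_restrict) measurable
qed

lemma sets_reduced [measurable_cong]: "sets reduced_cumulant = sets (vectors {1..<3})"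
  by (simp add: reduced_cumulant_def)

lemma component_measurable:
  "j \<in> {1..<3} \<Longrightarrow> (\<lambda>\<tau>. \<tau> j) \<in> borel_measurable reduced_cumulant"
  by (subst measurable_cong_sets[OF sets_reduced refl]) (rule measurable_component_singleton)

lemma place_measurable [measurable]:
  "place \<in> measurable (lborel \<Otimes>\<^sub>M reduced_cumulant) (vectors {..<3})"
  unfolding place_def split_beta
proof (rule measurable_restrict)
  fix j :: nat assume j: "j \<in> {..<3}"
  show "(\<lambda>p. if j = 0 then fst p else fst p + snd p j) \<in> borel_measurable (lborel \<Otimes>\<^sub>M reduced_cumulant)"
  proof (cases "j = 0")
    case False
    then have [measurable]: "(\<lambda>\<tau>. \<tau> j) \<in> borel_measurable reduced_cumulant"
      using j by (intro component_measurable) auto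
    show ?thesis using False by simp measurable
  qed simp
qed

sublocale reduced: finite_measure reduced_cumulant
  unfolding reduced_cumulant_def by (rule triples.finite_measure_distr) measurable

lemma reduced_measure_third_cumulant: "reduced_measure 3 third_cumulant reduced_cumulant"
  unfolding reduced_measure_def
proof (intro conjI allI impI)
  fix F :: "(nat \<Rightarrow> real) \<Rightarrow> ennreal"
  assume F [measurable]: "F \<in> borel_measurable (vectors {..<3})"
  have "(\<integral>\<^sup>+ t. F t \<partial>third_cumulant) = (\<integral>\<^sup>+ p. F (place p) \<partial>(lborel \<Otimes>\<^sub>M reduced_cumulant))"
    unfolding third_cumulant_def by (rule nn_integral_distr) measurable
  also have "\<dots> = (\<integral>\<^sup>+ t0. (\<integral>\<^sup>+ \<tau>. F (place (t0, \<tau>)) \<partial>reduced_cumulant) \<partial>lborel)"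
    by (rule reduced.nn_integral_fst[symmetric]) measurable
  finally show "(\<integral>\<^sup>+ t. F t \<partial>third_cumulant) = (\<integral>\<^sup>+ t0. (\<integral>\<^sup>+ \<tau>. F (\<lambda>j\<in>{..<3}. if j = 0 then t0 else t0 + \<tau> j) \<partial>reduced_cumulant) \<partial>lborel)"
    by (simp add: place_def)
qed (rule sets_reduced)

text \<open>Expanding the two displacements in the exponent collects the frequency
  \<open>- \<omega>1 - \<omega>2\<close> at the reference individual \<open>u\<close>. The sum over
  triples then factors into three cluster sums.\<close>

lemma B_comp_reduced_cumulant:
  "B_comp reduced_cumulant \<omega>1 \<omega>2
    = of_real \<nu> * C.E3 (wave (- \<omega>1 - \<omega>2)) (wave \<omega>1) (wave \<omega>2)"
proof -
  let ?F = "\<lambda>(w, u, v, v'). wave (- \<omega>1 - \<omega>2) (pos (g 0 w) u) * wave \<omega>1 (pos (g 0 w) v) * wave \<omega>2 (pos (g 0 w) v')"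
  have "B_comp reduced_cumulant \<omega>1 \<omega>2 = (LINT \<tau>|reduced_cumulant. wave \<omega>1 (\<tau> 1) * wave \<omega>2 (\<tau> 2))"
  proof -
    have "{1..<3} = {1, 2 :: nat}" by auto
    then show ?thesis
      by (simp add: B_comp_def fourier_stieltjes_def wave_def distrib_left flip: exp_add)
  qed
  also have "\<dots> = (LINT z|triples. wave \<omega>1 (displacements z 1) * wave \<omega>2 (displacements z 2))"
    unfolding reduced_cumulant_def
  proof (rule integral_distr)
    have [measurable]: "(\<lambda>\<tau>. \<tau> 1) \<in> borel_measurable (vectors {1..<3})"
      "(\<lambda>\<tau>. \<tau> 2) \<in> borel_measurable (vectors {1..<3})"
      by (intro measurable_component_singleton; simp)+
    show "(\<lambda>\<tau>. wave \<omega>1 (\<tau> (1 :: nat)) * wave \<omega>2 (\<tau> 2)) \<in> borel_measurable (vectors {1..<3})"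
      by measurable
  qed measurable
  also have "\<dots> = (LINT z|triples. ?F z)"
  proof (rule Bochner_Integration.integral_cong[OF refl])
    fix z :: "'w \<times> nat list \<times> nat list \<times> nat list"
    obtain w u v v' where z: "z = (w, u, v, v')" by (cases z)
    show "wave \<omega>1 (displacements z 1) * wave \<omega>2 (displacements z 2) = ?F z"
      by (simp add: z displacements_def wave_def algebra_simps flip: exp_add)
  qed
  also have "\<dots> = \<nu> *\<^sub>R (LINT w|M. (\<Sum>t | alive3 w t. ?F (w, t)))"
  proof (rule integral_triples[where b = 1])
    fix t :: "nat list \<times> nat list \<times> nat list"
    obtain u v v' where t: "t = (u, v, v')" by (cases t)
    show "(\<lambda>w. ?F (w, t)) \<in> borel_measurable M"
      unfolding t prod.case by measurable
  qed (auto simp: norm_mult)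
  also have "\<dots> = of_real \<nu> * C.E3 (wave (- \<omega>1 - \<omega>2)) (wave \<omega>1) (wave \<omega>2)"
    unfolding C.E3_def cluster_sum_def by (simp add: sum_alive3 scaleR_conv_of_real)
  finally show ?thesis .
qed

text \<open>Fubini's theorem, integrating the position of the reference individual first.
  Translation invariance of \<open>lborel\<close> moves the reference point from that individual to
  the root, and the sum over triples becomes a product of cluster sums.\<close>

lemma
  fixes f0 f1 f2 :: "real \<Rightarrow> real"
  assumes meas [measurable]: "f0 \<in> borel_measurable borel" "f1 \<in> borel_measurable borel" "f2 \<in> borel_measurable borel"
    and b: "0 \<le> b" and K: "0 \<le> K"
    and le: "\<And>x. \<bar>f0 x\<bar> \<le> b * window K x" "\<And>x. \<bar>f1 x\<bar> \<le> b * window K x" "\<And>x. \<bar>f2 x\<bar> \<le> b * window K x"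
  defines "\<Phi> \<equiv> \<lambda>p :: real \<times> (nat \<Rightarrow> real). f0 (fst p) * f1 (fst p + snd p 1) * f2 (fst p + snd p 2)"
  shows integrable_place: "integrable (lborel \<Otimes>\<^sub>M reduced_cumulant) \<Phi>"
    and integral_place: "(LINT p|(lborel \<Otimes>\<^sub>M reduced_cumulant). \<Phi> p)
      = \<nu> * (LINT z|(M \<Otimes>\<^sub>M lborel). C.S f0 z * C.S f1 z * C.S f2 z)"
proof -
  interpret P: pair_sigma_finite lborel reduced_cumulant
    by (simp add: pair_sigma_finite_def reduced.sigma_finite_measure_axioms lborel.sigma_finite_measure_axioms)
  interpret PM: pair_sigma_finite M lborel by (rule C.pair_sigma_finite_M) unfold_locales
  have [measurable]: "(\<lambda>\<tau>. \<tau> 1) \<in> borel_measurable reduced_cumulant" "(\<lambda>\<tau>. \<tau> 2) \<in> borel_measurable reduced_cumulant"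
    by (intro component_measurable; simp)+
  have \<Phi>_meas: "\<Phi> \<in> borel_measurable (lborel \<Otimes>\<^sub>M reduced_cumulant)"
    unfolding \<Phi>_def by measurable
  note [measurable] = \<Phi>_meas
  have f_b: "\<bar>f1 x\<bar> \<le> b" "\<bar>f2 x\<bar> \<le> b" for x
    using le(2,3)[of x] b by (cases "x \<in> {- K..K}"; simp)+
  \<comment> \<open>The window of the first factor alone localises \<open>t\<close>; the bound is
    uniform in the displacements, and their measure is finite.\<close>
  have prod_le: "\<bar>f0 x * f1 y * f2 z\<bar> \<le> b ^ 3 * window K x" for x y z
  proof -
    have "\<bar>f0 x\<bar> * \<bar>f1 y\<bar> * \<bar>f2 z\<bar> \<le> b * window K x * b * b"
      by (intro mult_mono le f_b) (use b in auto)
    then show ?thesis by (simp add: abs_mult power3_eq_cube mult_ac)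
  qed
  have window_int: "integrable lborel (\<lambda>x. b ^ 3 * window K x)"
    using K by (intro integrable_mult_right integrable_real_indicator) auto
  have window_int': "integrable lborel (\<lambda>x. b ^ 3 * window K (x + p))" for p
    using lborel_integrable_real_affine[OF window_int, of 1 p] by (simp add: add.commute)
  show \<Phi>_int: "integrable (lborel \<Otimes>\<^sub>M reduced_cumulant) \<Phi>"
  proof (rule integrableI_bounded[OF \<Phi>_meas])
    have "(\<integral>\<^sup>+ p. ennreal (norm (\<Phi> p)) \<partial>(lborel \<Otimes>\<^sub>M reduced_cumulant))
        = (\<integral>\<^sup>+ t. (\<integral>\<^sup>+ \<tau>. ennreal (norm (\<Phi> (t, \<tau>))) \<partial>reduced_cumulant) \<partial>lborel)"
      by (rule reduced.nn_integral_fst[symmetric]) measurable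
    also have "\<dots> \<le> (\<integral>\<^sup>+ t. (\<integral>\<^sup>+ \<tau>. ennreal (b ^ 3 * window K t) \<partial>reduced_cumulant) \<partial>lborel)"
      unfolding \<Phi>_def real_norm_def fst_conv by (intro nn_integral_mono ennreal_leI prod_le)
    also have "\<dots> = (\<integral>\<^sup>+ t. ennreal (b ^ 3 * window K t) \<partial>lborel) * emeasure reduced_cumulant (space reduced_cumulant)"
      unfolding nn_integral_const by (rule nn_integral_multc) measurable
    also have "(\<integral>\<^sup>+ t. ennreal (b ^ 3 * window K t) \<partial>lborel) = ennreal (LINT t|lborel. b ^ 3 * window K t)"
      using b by (intro nn_integral_eq_integral[OF window_int]) auto
    finally show "(\<integral>\<^sup>+ p. ennreal (norm (\<Phi> p)) \<partial>(lborel \<Otimes>\<^sub>M reduced_cumulant)) < \<infinity>"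
      by (rule le_less_trans) (simp add: reduced.emeasure_eq_measure flip: ennreal_mult'')
  qed
  define \<Psi> where "\<Psi> x y = (LINT t|lborel. f0 t * f1 (t + x) * f2 (t + y))" for x y
  let ?\<Psi> = "\<lambda>w u v v'. \<Psi> (pos (g 0 w) v - pos (g 0 w) u) (pos (g 0 w) v' - pos (g 0 w) u)"
  \<comment> \<open>Substitution of \<open>t + p\<close>, where \<open>p\<close> is the position of
    the reference individual relative to the root; the new variable is the root position.\<close>
  have \<Psi>_shift: "\<Psi> (q - p) (r - p) = (LINT t|lborel. f0 (t + p) * f1 (t + q) * f2 (t + r))" for p q r
    unfolding \<Psi>_def by (subst lborel_integral_real_affine[where c = 1 and t = p]) (simp_all add: algebra_simps)
  have \<Psi>_le: "\<bar>\<Psi> x y\<bar> \<le> (LINT t|lborel. b ^ 3 * window K t)" for x y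
    unfolding \<Psi>_def using prod_le b
    by (intro order_trans[OF integral_abs_bound] integral_mono' window_int) auto
  have \<Psi>_meas: "(\<lambda>z. \<Psi> (X z) (Y z)) \<in> borel_measurable L"
    if [measurable]: "X \<in> borel_measurable L" "Y \<in> borel_measurable L" for X Y and L :: "'z measure"
    unfolding \<Psi>_def by (rule lborel.borel_measurable_lebesgue_integral) measurable
  have shift_int: "integrable lborel (\<lambda>t. f0 (t + p) * f1 (t + q) * f2 (t + r))" for p q r
    by (rule Bochner_Integration.integrable_bound[OF window_int'[of p]]) (use prod_le b in \<open>auto simp: abs_mult\<close>)
  have "(LINT p|(lborel \<Otimes>\<^sub>M reduced_cumulant). \<Phi> p) = (LINT \<tau>|reduced_cumulant. \<Psi> (\<tau> 1) (\<tau> 2))"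
    unfolding P.integral_snd'[OF \<Phi>_int, symmetric] by (simp add: \<Phi>_def \<Psi>_def)
  also have "\<dots> = (LINT z|triples. \<Psi> (displacements z 1) (displacements z 2))"
    unfolding reduced_cumulant_def
    by (rule integral_distr[OF displacements_measurable]; rule \<Psi>_meas; rule measurable_component_singleton; simp)
  also have "\<dots> = (LINT z|triples. (case z of (w, u, v, v') \<Rightarrow> ?\<Psi> w u v v'))"
    by (intro Bochner_Integration.integral_cong refl) (simp add: displacements_def split_beta)
  also have "\<dots> = \<nu> *\<^sub>R (LINT w|M. (\<Sum>t | alive3 w t. case (w, t) of (w, u, v, v') \<Rightarrow> ?\<Psi> w u v v'))"
  proof (rule integral_triples)
    fix t :: "nat list \<times> nat list \<times> nat list"
    obtain u v v' where t: "t = (u, v, v')" by (cases t)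
    show "(\<lambda>w. case (w, t) of (w, u, v, v') \<Rightarrow> ?\<Psi> w u v v') \<in> borel_measurable M"
      unfolding t prod.case by (rule \<Psi>_meas) measurable
  qed (use \<Psi>_le in \<open>auto simp: split_beta\<close>)
  also have "(LINT w|M. (\<Sum>t | alive3 w t. case (w, t) of (w, u, v, v') \<Rightarrow> ?\<Psi> w u v v'))
    = (LINT w|M. (LINT y|lborel. C.S f0 (w, y) * C.S f1 (w, y) * C.S f2 (w, y)))"
  proof (rule Bochner_Integration.integral_cong[OF refl])
    fix w
    let ?p = "pos (g 0 w)"
    have "(\<Sum>t | alive3 w t. case (w, t) of (w, u, v, v') \<Rightarrow> ?\<Psi> w u v v')
      = (\<Sum>t | alive3 w t. LINT y|lborel. (case t of (u, v, v') \<Rightarrow> f0 (y + ?p u) * f1 (y + ?p v) * f2 (y + ?p v')))"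
      by (intro sum.cong refl) (simp add: \<Psi>_shift split_beta)
    also have "\<dots> = (LINT y|lborel. (\<Sum>t | alive3 w t. case t of (u, v, v') \<Rightarrow> f0 (y + ?p u) * f1 (y + ?p v) * f2 (y + ?p v')))"
      by (rule Bochner_Integration.integral_sum[symmetric]) (simp add: shift_int split_beta)
    also have "\<dots> = (LINT y|lborel. C.S f0 (w, y) * C.S f1 (w, y) * C.S f2 (w, y))"
      by (simp only: sum_alive3 cluster_sum_def fst_conv snd_conv)
    finally show "(\<Sum>t | alive3 w t. case (w, t) of (w, u, v, v') \<Rightarrow> ?\<Psi> w u v v')
      = (LINT y|lborel. C.S f0 (w, y) * C.S f1 (w, y) * C.S f2 (w, y))" .
  qed
  also have "\<dots> = (LINT z|(M \<Otimes>\<^sub>M lborel). C.S f0 z * C.S f1 z * C.S f2 z)"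
  proof (rule PM.integral_fst')
    show "integrable (M \<Otimes>\<^sub>M lborel) (\<lambda>z. C.S f0 z * C.S f1 z * C.S f2 z)"
    proof (rule C.integrable_pair_lborel[where v = "\<lambda>w. b ^ 3 * C.Z w ^ 2" and K = K])
      show "integrable M (\<lambda>w. C.Z w * (b ^ 3 * C.Z w ^ 2))"
        using integrable_mult_right[OF C.integrable_Z_power[of 3], of "b ^ 3"] by (simp add: power3_eq_cube power2_eq_square mult_ac)
      fix w u
      have "\<bar>cluster_sum f0 (g 0 w) u\<bar> * \<bar>cluster_sum f1 (g 0 w) u\<bar> * \<bar>cluster_sum f2 (g 0 w) u\<bar>
          \<le> b * cluster_sum (window K) (g 0 w) u * (b * C.Z w) * (b * C.Z w)"
        using abs_cluster_sum_le_window[of f0 b K "g 0 w" u, OF le(1)]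
          norm_cluster_sum_le_size[of f1 b "g 0 w" u] norm_cluster_sum_le_size[of f2 b "g 0 w" u] f_b b
          cluster_sum_nonneg[of "window K" "g 0 w" u]
        by (intro mult_mono) auto
      then show "norm (C.S f0 (w, u) * C.S f1 (w, u) * C.S f2 (w, u)) \<le> cluster_sum (window K) (g 0 w) u * (b ^ 3 * C.Z w ^ 2)"
        by (simp add: abs_mult power3_eq_cube power2_eq_square mult_ac)
    qed (use b K in auto)
  qed
  finally show "(LINT p|(lborel \<Otimes>\<^sub>M reduced_cumulant). \<Phi> p)
      = \<nu> * (LINT z|(M \<Otimes>\<^sub>M lborel). C.S f0 z * C.S f1 z * C.S f2 z)" by simp
qed

lemma complete_third_cumulant: "complete_cumulant_measure M N 3 third_cumulant"
  unfolding complete_cumulant_measure_def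
proof (intro conjI allI impI)
  show "sets third_cumulant = sets (vectors {..<3})"
    by (simp add: third_cumulant_def)
  fix f :: "nat \<Rightarrow> real \<Rightarrow> real" assume "\<forall>j<3. test_function (f j)"
  then have f: "\<And>j. j < 3 \<Longrightarrow> test_function (f j)" by simp
  obtain b K where b: "0 < b" and K: "0 \<le> K" and f_le: "\<And>j x. j < 3 \<Longrightarrow> \<bar>f j x\<bar> \<le> b * window K x"
    using test_functions_obtain[of 3 f] f by blast
  have fm: "f 0 \<in> borel_measurable borel" "f 1 \<in> borel_measurable borel" "f 2 \<in> borel_measurable borel"
    using f[of 0] f[of 1] f[of 2] by (simp_all add: test_function_def)
  have prod_place: "(\<Prod>j<3. f j (place p j)) = f 0 (fst p) * f 1 (fst p + snd p 1) * f 2 (fst p + snd p 2)" for p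
    by (simp add: prod_lessThan_3 place_def split_beta)
  note place = integrable_place[OF fm less_imp_le[OF b] K f_le[of 0] f_le[of 1] f_le[of 2]]
    integral_place[OF fm less_imp_le[OF b] K f_le[of 0] f_le[of 1] f_le[of 2]]
  have prod_meas: "(\<lambda>t. \<Prod>j<3. f j (t j)) \<in> borel_measurable (vectors {..<3})"
  proof (rule borel_measurable_prod)
    fix j :: nat assume j: "j \<in> {..<3}"
    have "(\<lambda>t. t j) \<in> borel_measurable (vectors {..<3})"
      using j by (rule measurable_component_singleton)
    moreover have "f j \<in> borel_measurable borel" using f[of j] j by (simp add: test_function_def)
    ultimately show "(\<lambda>t. f j (t j)) \<in> borel_measurable (vectors {..<3})"
      by (rule measurable_compose)
  qed
  show "integrable third_cumulant (\<lambda>t. \<Prod>j<3. f j (t j))"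
    unfolding third_cumulant_def integrable_distr_eq[OF place_measurable prod_meas] prod_place
    by (rule place) simp_all
  have "(LINT t|third_cumulant. (\<Prod>j<3. f j (t j))) = \<nu> * (LINT z|(M \<Otimes>\<^sub>M lborel). C.S (f 0) z * C.S (f 1) z * C.S (f 2) z)"
    unfolding third_cumulant_def integral_distr[OF place_measurable prod_meas] prod_place
    by (rule place) simp_all
  then show "(LINT t|third_cumulant. (\<Prod>j<3. f j (t j))) = joint_cumulant M N 3 f"
    using joint_cumulant_3[of f, unfolded prod_lessThan_3] f by (simp only: prod_lessThan_3)
qed

lemma B_comp_formula:
  fixes \<omega>1 \<omega>2 :: real
  defines "\<omega>3 \<equiv> - \<omega>1 - \<omega>2" and "R \<equiv> Rfun m h"
  shows "B_comp reduced_cumulant \<omega>1 \<omega>2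
    = of_real (\<nu> / (1 - m)) * R \<omega>1 * R \<omega>2 * R \<omega>3 * (R (- \<omega>1) + R (- \<omega>2) + R (- \<omega>3) - 2)"
proof -
  have "\<omega>3 + \<omega>1 + \<omega>2 = 0" by (simp add: \<omega>3_def)
  from C.E3_wave[OF this] show ?thesis
    unfolding B_comp_reduced_cumulant \<omega>3_def[symmetric] R_def[symmetric]
    by (simp add: \<omega>3_def algebra_simps)
qed

end

theorem theorem2p2:
  fixes M :: "'w measure" and N :: "'w \<Rightarrow> real measure"
    and m \<nu> :: real and h :: "real \<Rightarrow> real"
  assumes "0 < m" and "m < 1" and "0 < \<nu>" and "prob_density h"
    and "poisson_branching_cluster_process M \<nu> m h N"
  shows "(\<exists>\<gamma> \<gamma>red. complete_cumulant_measure M N 3 \<gamma> \<and> reduced_measure 3 \<gamma> \<gamma>red) \<and>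
    (\<forall>\<gamma> \<gamma>red. complete_cumulant_measure M N 3 \<gamma> \<longrightarrow> reduced_measure 3 \<gamma> \<gamma>red \<longrightarrow>
      finite_measure \<gamma>red \<and>
      (\<forall>\<omega>1 \<omega>2.
        (let lam = \<nu> / (1 - m); \<omega>3 = - \<omega>1 - \<omega>2; R = Rfun m h; B = B_comp \<gamma>red \<omega>1 \<omega>2 in
          B = of_real lam * R \<omega>1 * R \<omega>2 * R \<omega>3 * (R (- \<omega>1) + R (- \<omega>2) + R (- \<omega>3) - 2) \<and>
          B = of_real lam * ((1 - (of_real m)\<^sup>2 * Qfun m h \<omega>1 \<omega>2) / of_real (denom m h \<omega>1 \<omega>2)) \<and>
          0 < denom m h \<omega>1 \<omega>2 \<and>
          Im B = - lam * m\<^sup>2 * (Im (Qfun m h \<omega>1 \<omega>2) / denom m h \<omega>1 \<omega>2))))"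
proof -
  interpret prob_space M
    using assms(5) by (simp add: poisson_branching_cluster_process_def)
  obtain U g where "poisson_process M (\<lambda>w. points UNIV (\<lambda>j. U j w)) (density lborel (\<lambda>_. ennreal \<nu>))"
    "\<And>j. branching_genealogy M m h (g j)" "indep_vars (\<lambda>_. genealogy_space) g UNIV"
    "indep_set (sets (vimage_algebra (space M) (\<lambda>w j. U j w) (Pi\<^sub>M UNIV (\<lambda>_. borel))))
      (sets (vimage_algebra (space M) (\<lambda>w j. g j w) (Pi\<^sub>M UNIV (\<lambda>_. genealogy_space))))"
    "\<And>w. w \<in> space M \<Longrightarrow> N w = superpose (\<lambda>j. shift (U j w) (cluster (g j w)))"
    using assms(5) unfolding poisson_branching_cluster_process_def by blast
  then interpret cluster_process m h M \<nu> U g N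
    by unfold_locales (use assms(1-4) in auto)
  \<comment> \<open>The claim concerns arbitrary measures with the defining properties; uniqueness
    reduces it to the pair constructed above.\<close>
  have unique: "\<gamma>red = reduced_cumulant"
    if "complete_cumulant_measure M N 3 \<gamma>" "reduced_measure 3 \<gamma> \<gamma>red" for \<gamma> \<gamma>red
  proof -
    have "\<gamma> = third_cumulant"
      using that(1) complete_third_cumulant by (rule complete_cumulant_measure_unique)
    with that(2) show ?thesis
      using reduced_measure_unique[OF _ reduced_measure_third_cumulant] by simp
  qed
  have rational: "B_comp reduced_cumulant \<omega>1 \<omega>2
      = of_real (\<nu> / (1 - m)) * ((1 - (of_real m)\<^sup>2 * Qfun m h \<omega>1 \<omega>2) / of_real (denom m h \<omega>1 \<omega>2))" for \<omega>1 \<omega>2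
    unfolding B_comp_formula bispectrum_rational_form(1)[symmetric] by (simp only: mult.assoc)
  have Im: "Im (B_comp reduced_cumulant \<omega>1 \<omega>2)
      = - (\<nu> / (1 - m)) * m\<^sup>2 * (Im (Qfun m h \<omega>1 \<omega>2) / denom m h \<omega>1 \<omega>2)" for \<omega>1 \<omega>2
  proof -
    have "of_real (\<nu> / (1 - m)) * ((1 - (of_real m)\<^sup>2 * Qfun m h \<omega>1 \<omega>2) / of_real (denom m h \<omega>1 \<omega>2))
        = of_real (\<nu> / (1 - m) / denom m h \<omega>1 \<omega>2) * (1 - of_real (m\<^sup>2) * Qfun m h \<omega>1 \<omega>2)"
      by simp
    moreover have "Im (of_real a * (1 - of_real c * z)) = - a * c * Im z" for a c :: real and z
      by simp
    ultimately show ?thesis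
      unfolding rational by (simp only:) simp
  qed
  show ?thesis
    unfolding Let_def
  proof (intro conjI allI impI exI)
    show "complete_cumulant_measure M N 3 third_cumulant" by (rule complete_third_cumulant)
    show "reduced_measure 3 third_cumulant reduced_cumulant" by (rule reduced_measure_third_cumulant)
    show "0 < denom m h \<omega>1 \<omega>2" for \<omega>1 \<omega>2 by (rule bispectrum_rational_form(2))
    fix \<gamma> \<gamma>red \<omega>1 \<omega>2
    assume "complete_cumulant_measure M N 3 \<gamma>" "reduced_measure 3 \<gamma> \<gamma>red"
    then have eq: "\<gamma>red = reduced_cumulant" by (rule unique)
    show "finite_measure \<gamma>red"
      unfolding eq by (rule reduced.finite_measure_axioms)
    show "B_comp \<gamma>red \<omega>1 \<omega>2 = of_real (\<nu> / (1 - m)) * Rfun m h \<omega>1 * Rfun m h \<omega>2 * Rfun m h (- \<omega>1 - \<omega>2)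
        * (Rfun m h (- \<omega>1) + Rfun m h (- \<omega>2) + Rfun m h (- (- \<omega>1 - \<omega>2)) - 2)"
      unfolding eq by (rule B_comp_formula)
    show "B_comp \<gamma>red \<omega>1 \<omega>2
        = of_real (\<nu> / (1 - m)) * ((1 - (of_real m)\<^sup>2 * Qfun m h \<omega>1 \<omega>2) / of_real (denom m h \<omega>1 \<omega>2))"
      unfolding eq by (rule rational)
    show "Im (B_comp \<gamma>red \<omega>1 \<omega>2) = - (\<nu> / (1 - m)) * m\<^sup>2 * (Im (Qfun m h \<omega>1 \<omega>2) / denom m h \<omega>1 \<omega>2)"
      unfolding eq by (rule Im)
  qed
qed

end
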